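(* The covering number of the symmetric group $S_8$ is $64$, i.e. $\sigma(S_8)=64$.
   Context: For a group $G$, a cover of $G$ is a finite collection $\{A_1,\dots,A_n\}$ of proper subgroups of $G$ with $G=\bigcup_{i=1}^n A_i$. The covering number $\sigma(G)$ is the smallest number of members in a cover of $G$. $S_n$ denotes the symmetric group of degree $n$. *)

theory Defs
  imports "HOL-Algebra.Sym_Groups" "HOL-Library.Extended_Nat"
begin

definition subgroup_cover :: "('a, 'b) monoid_scheme \<Rightarrow> 'a set set \<Rightarrow> bool"
  where "subgroup_cover G \<A> \<longleftrightarrow>
    finite \<A> \<and> (\<forall>H\<in>\<A>. subgroup H G \<and> H \<noteq> carrier G) \<and> \<Union>\<A> = carrier G"

(* A group need not have a cover (cyclic groups have none); then the infimum is over the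
   empty set and the covering number is \<infinity>, the usual convention.  Otherwise the infimum
   in enat is a minimum. *)
definition covering_number :: "('a, 'b) monoid_scheme \<Rightarrow> enat"
  where "covering_number G = (INF \<A>\<in>{\<A>. subgroup_cover G \<A>}. enat (card \<A>))"

end

(* The upper bound uses the cover by the alternating group, the 28 stabilizers of two-element sets
   and the 35 stabilizers of partitions into two sets of size four: an odd permutation leaves a pair
   invariant unless its cycle type is 8 or 4 + 3 + 1.

   For the lower bound distribute the weights 35, 8, 20 and 1 uniformly over the permutations of
   cycle types 8, 5 + 2 + 1, 3 + 3 + 2 and 5 + 3.  The total weight is 64, so it suffices that every
   proper subgroup H has weight at most 1.  If H is intransitive or imprimitive, it fixes a subset of
   size at most four, a partition 4 + 4 or a partition 2 + 2 + 2 + 2, and the weight of the stabilizer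
   is found by double counting.  If H is primitive, it contains no transposition, which excludes the
   types 5 + 2 + 1 and 3 + 3 + 2; if it contains an 8-cycle, it contains no 3-cycle either, which
   excludes 5 + 3.  In the latter case commutators and fixed point counts show that no nontrivial
   element of H has more than two fixed points.  Hence H has order at most 8 * 7 * 6, and counting
   fixed points of its odd elements leaves at most 84 of the 5040 8-cycles. *)

theory Submission
  imports Defs
begin

text \<open>The weights form an optimal dual solution of the fractional covering problem, so every
  member of the 64-element cover must have weight exactly 1. An 8-cycle preserves exactly one of the
  35 partitions 4 + 4, whence 35. A permutation of type 5 + 2 + 1 or 3 + 3 + 2 leaves exactly one of
  the 28 pairs invariant, so these two weights add up to 28. Point stabilizers allow at most 8 for 5
  + 2 + 1, and stabilizers of partitions 2 + 2 + 2 + 2 allow at most 70 / 3 for 3 + 3 + 2 once 35 is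
  spent; 8 + 20 meets the first bound with equality. Type 5 + 3 is even and leaves no pair and no
  partition 4 + 4 invariant, so it charges the alternating group alone.

  The obstacle is the primitive case, treated without a classification of the primitive groups of
  degree eight. The extremal group with an 8-cycle is PGL(2,7), which attains both the order 336 and
  the 84 8-cycles; weight 1 would tolerate 144 of them.\<close>

section \<open>Cycle types\<close>

text \<open>A cycle of length d contributes all its points if d divides \<open>k\<close> and none
  otherwise. The sizes of these sets for varying \<open>k\<close> therefore encode the cycle type,
  without any reference to the cycles themselves.\<close>

definition fixed :: "'a set \<Rightarrow> ('a \<Rightarrow> 'a) \<Rightarrow> nat \<Rightarrow> 'a set"
  where "fixed S p k = {i \<in> S. (p ^^ k) i = i}"

lemma finite_fixed [simp]: "finite S \<Longrightarrow> finite (fixed S p k)"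
  by (simp add: fixed_def)

lemma fixed_subset: "fixed S p k \<subseteq> S"
  by (auto simp: fixed_def)

lemma evenperm_cycle_of_list:
  "distinct cs \<Longrightarrow> evenperm (cycle_of_list cs) \<longleftrightarrow> even (length cs - 1)"
proof (induction cs rule: cycle_of_list.induct)
  case (1 i j cs)
  have "evenperm (transpose i j \<circ> cycle_of_list (j # cs)) \<longleftrightarrow> \<not> evenperm (cycle_of_list (j # cs))"
    using 1 by (subst evenperm_comp) (auto simp: permutation_swap_id permutation_of_cycle evenperm_swap)
  moreover have "evenperm (cycle_of_list (j # cs)) \<longleftrightarrow> even (length cs)"
    using 1 by simp
  ultimately show ?case
    by (simp add: comp_def)
qed auto

text \<open>By \<open>cyclic_rotation\<close> the power acts on the list as a rotation by
  \<open>k\<close>, and in a distinct list an entry returns to its position only under a full number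
  of turns.\<close>

lemma funpow_cycle_of_list_eq:
  assumes "distinct cs" "i \<in> set cs"
  shows "(cycle_of_list cs ^^ k) i = i \<longleftrightarrow> length cs dvd k"
proof -
  obtain j where j: "j < length cs" "cs ! j = i"
    using assms(2) by (auto simp: in_set_conv_nth)
  have "(cycle_of_list cs ^^ k) i = map (cycle_of_list cs ^^ k) cs ! j"
    using j by simp
  also have "\<dots> = cs ! ((j + k) mod length cs)"
    using cyclic_rotation[OF assms(1), of k] j by (simp add: nth_rotate add.commute)
  finally have "(cycle_of_list cs ^^ k) i = i \<longleftrightarrow> (j + k) mod length cs = j"
    using j assms(1)
    by (metis distinct_conv_nth mod_less_divisor gr_implies_not0 gr_zeroI)
  also have "\<dots> \<longleftrightarrow> length cs dvd k"
    using j(1) by (metis add_diff_cancel_left' dvd_eq_mod_eq_0 mod_add_right_eq mod_eq_dvd_iff_nat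
        le_add1 mod_less add.right_neutral)
  finally show ?thesis .
qed

text \<open>\<open>c d\<close> is the number of cycles of length \<open>d\<close>.\<close>

lemma cycle_type_exists:
  assumes "p permutes S" "finite S" "card S \<le> n"
  shows "\<exists>c. (\<Sum>d=1..n. d * c d) = card S \<and>
     (evenperm p \<longleftrightarrow> even (\<Sum>d=1..n. (d - 1) * c d)) \<and>
     (\<forall>k. card (fixed S p k) = (\<Sum>d=1..n. if d dvd k then d * c d else 0))"
proof -
  have "cycle_decomp S p"
    using cycle_decomposition assms by blast
  then show ?thesis
    using assms
  proof (induction rule: cycle_decomp.induct)
    case empty
    then show ?case
      by (intro exI[of _ "\<lambda>_. 0"]) (auto simp: fixed_def)
  next
    case (comp I p cs)
    let ?q = "cycle_of_list cs" and ?l = "length cs"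
    \<comment> \<open>The induction supplies only that the composite permutes the union. The factor
      \<open>p\<close> is recovered by cancelling the cycle, and it is the identity on
      \<open>cs\<close>.\<close>
    have p: "p permutes I"
    proof -
      have eq: "inv' ?q \<circ> (?q \<circ> p) = p"
        using permutes_inv_o(2)[OF cycle_permutes, of cs] by (simp add: o_assoc)
      have "p permutes (set cs \<union> I)"
        using permutes_compose[OF comp.prems(1) permutes_subset[OF permutes_inv[OF cycle_permutes]]]
        by (metis Un_upper1 eq)
      moreover have "p x = x" if "x \<in> set cs" for x
      proof -
        have "cycle_decomp I p \<Longrightarrow> x \<notin> I \<Longrightarrow> p x = x" for I p
          by (induction rule: cycle_decomp.induct) (auto simp: id_outside_supp)
        then show ?thesis using comp that by blast
      qed
      ultimately show ?thesis
        using permutes_superset[of p "set cs \<union> I" I] by blast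
    qed
    have fin: "finite I" using comp.prems by simp
    have card: "card (set cs \<union> I) = ?l + card I"
      using comp fin by (simp add: card_Un_disjoint distinct_card)
    obtain c where c: "(\<Sum>d=1..n. d * c d) = card I"
       "evenperm p \<longleftrightarrow> even (\<Sum>d=1..n. (d - 1) * c d)"
       "\<And>k. card (fixed I p k) = (\<Sum>d=1..n. if d dvd k then d * c d else 0)"
      using comp.IH[OF p fin] comp.prems(3) card by auto
    show ?case
    \<comment> \<open>\<open>cycle_decomp\<close> admits an empty cycle, whose length 0 lies outside
      the range of summation.\<close>
    proof (cases "cs = []")
      case True
      then show ?thesis using c by (intro exI[of _ c]) auto
    next
      case False
      then have l: "?l \<in> {1..n}"
        using comp.prems(3) card by (simp add: Suc_le_eq)
      define c' where "c' = c(?l := Suc (c ?l))"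
      \<comment> \<open>The coefficient \<open>f\<close> is kept arbitrary because the update is
        needed for \<open>d\<close>, for \<open>d - 1\<close> and for \<open>d\<close> restricted to
        the divisors of \<open>k\<close>.\<close>
      have upd: "(\<Sum>d=1..n. f d * c' d) = f ?l + (\<Sum>d=1..n. f d * c d)" for f :: "nat \<Rightarrow> nat"
      proof -
        have "(\<Sum>d=1..n. f d * c' d) = f ?l * Suc (c ?l) + (\<Sum>d\<in>{1..n} - {?l}. f d * c d)"
          unfolding c'_def by (subst sum.remove[OF _ l]) (auto intro!: sum.cong)
        also have "\<dots> = f ?l + (\<Sum>d=1..n. f d * c d)"
          using sum.remove[OF _ l, of "\<lambda>d. f d * c d"] by simp
        finally show ?thesis .
      qed
      have fixp: "(p ^^ k) i = i" if "i \<in> set cs" for k i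
        using that comp.hyps(3) p by (induction k) (auto simp: permutes_not_in disjoint_iff)
      have fI: "((?q \<circ> p) ^^ k) i = (p ^^ k) i" if "i \<in> I" for i k
      proof (induction k)
        case (Suc k)
        have "(p ^^ Suc k) i \<in> I"
          using permutes_in_image[OF permutes_funpow[OF p]] that by blast
        then have "(p ^^ Suc k) i \<notin> set cs"
          using comp.hyps(3) by blast
        then show ?case
          using Suc by (simp add: id_outside_supp)
      qed simp
      have fC: "((?q \<circ> p) ^^ k) i = (?q ^^ k) i" if "i \<in> set cs" for i k
      proof (induction k)
        case (Suc k)
        have "(?q ^^ k) i \<in> set cs"
          using permutes_in_image[OF permutes_funpow[OF cycle_permutes[of cs], of k], of i] that by simp
        then have "p ((?q ^^ k) i) = (?q ^^ k) i"
          using fixp[of "(?q ^^ k) i" 1] by simp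
        then show ?case
          using Suc by simp
      qed simp
      have "fixed (set cs \<union> I) (?q \<circ> p) k = (if ?l dvd k then set cs else {}) \<union> fixed I p k" for k
        using fI fC funpow_cycle_of_list_eq[OF comp.hyps(2)] by (auto simp: fixed_def)
      moreover have "set cs \<inter> fixed I p k = {}" for k
        using comp.hyps(3) by (auto simp: fixed_def)
      ultimately have "card (fixed (set cs \<union> I) (?q \<circ> p) k)
          = (if ?l dvd k then ?l else 0) + card (fixed I p k)" for k
        using fin comp.hyps by (simp add: card_Un_disjoint distinct_card)
      moreover have "evenperm (?q \<circ> p) \<longleftrightarrow> even (?l - 1 + (\<Sum>d=1..n. (d - 1) * c d))"
        using permutes_imp_permutation[OF fin p] evenperm_cycle_of_list[OF comp.hyps(2)] c(2)
        by (simp add: evenperm_comp permutation_of_cycle)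
      moreover have "(\<Sum>d=1..n. if d dvd k then d * c' d else 0)
          = (if ?l dvd k then ?l else 0) + (\<Sum>d=1..n. if d dvd k then d * c d else 0)" for k
      proof -
        have "(\<Sum>d=1..n. if d dvd k then d * b d else 0)
            = (\<Sum>d=1..n. (if d dvd k then d else 0) * b d)" for b
          by (intro sum.cong) auto
        then show ?thesis using upd by simp
      qed
      ultimately show ?thesis
        using card c upd[of "\<lambda>d. d"] upd[of "\<lambda>d. d - 1"] by (intro exI[of _ c']) (simp add: comp_def)
    qed
  qed
qed

text \<open>The bound 8, in place of equality, lets the lemma serve invariant subsets too, in
  \<open>restricted_cycle_type\<close>. Only cycles of even length influence the parity.\<close>

lemma cycle_type_8:
  assumes "p permutes S" "finite S" "card S \<le> 8"
  obtains c1 c2 c3 c4 c5 c6 c7 c8 :: nat where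
    "c1 + 2 * c2 + 3 * c3 + 4 * c4 + 5 * c5 + 6 * c6 + 7 * c7 + 8 * c8 = card S"
    "evenperm p \<longleftrightarrow> even (c2 + c4 + c6 + c8)"
    "card (fixed S p 1) = c1"
    "card (fixed S p 2) = c1 + 2 * c2"
    "card (fixed S p 3) = c1 + 3 * c3"
    "card (fixed S p 4) = c1 + 2 * c2 + 4 * c4"
    "card (fixed S p 5) = c1 + 5 * c5"
    "card (fixed S p 6) = c1 + 2 * c2 + 3 * c3 + 6 * c6"
    "card (fixed S p 8) = c1 + 2 * c2 + 4 * c4 + 8 * c8"
proof -
  obtain c where c: "(\<Sum>d=1..8. d * c d) = card S"
     "(evenperm p \<longleftrightarrow> even (\<Sum>d=1..8. (d - 1) * c d))"
     "(\<forall>k. card (fixed S p k) = (\<Sum>d=1..8. if d dvd k then d * c d else 0))"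
    using cycle_type_exists[OF assms] by blast
  have s: "(\<Sum>d=1..8. f d) = f 1 + f 2 + f 3 + f 4 + f 5 + f 6 + f 7 + f 8" for f :: "nat \<Rightarrow> nat"
    by (simp add: numeral_eq_Suc)
  show thesis
    using c[unfolded s] by (intro that[of "c 1" "c 2" "c 3" "c 4" "c 5" "c 6" "c 7" "c 8"]) auto
qed

section \<open>Primitive permutation groups\<close>

definition moved :: "('a \<Rightarrow> 'a) \<Rightarrow> 'a set"
  where "moved p = {i. p i \<noteq> i}"

lemma moved_subset: "p permutes S \<Longrightarrow> moved p \<subseteq> S"
  unfolding moved_def using permutes_not_in by fastforce

lemma moved_eq_empty_iff: "moved p = {} \<longleftrightarrow> p = id"
  by (auto simp: moved_def)

lemma apply_in_moved_iff: "inj p \<Longrightarrow> p i \<in> moved p \<longleftrightarrow> i \<in> moved p"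
  by (auto simp: moved_def inj_def)

lemma inv_in_moved_iff: "bij p \<Longrightarrow> inv' p i \<in> moved p \<longleftrightarrow> i \<in> moved p"
  by (metis apply_in_moved_iff bij_inv_eq_iff bij_is_inj)

lemma moved_conj:
  assumes "bij h"
  shows "moved (h \<circ> p \<circ> inv' h) = h ` moved p"
proof -
  have "h (p (inv' h i)) = i \<longleftrightarrow> p (inv' h i) = inv' h i" for i
    using assms by (metis bij_inv_eq_iff)
  then show ?thesis
    using assms unfolding moved_def
    by (auto simp: image_iff) (metis bij_inv_eq_iff)+
qed

lemma transpose_conj:
  assumes "bij h"
  shows "h \<circ> transpose a b \<circ> inv' h = transpose (h a) (h b)"
proof -
  have "h \<circ> transpose a b = transpose (h a) (h b) \<circ> h"
    using transpose_comp_eq[OF assms, of "h a" "h b"] assms by (simp add: bij_is_inj)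
  then show ?thesis
    using assms by (metis bij_is_surj comp_assoc comp_id surj_iff)
qed

text \<open>For distinct points this sends \<open>a\<close> to \<open>b\<close>, \<open>b\<close> to
  \<open>c\<close> and \<open>c\<close> to \<open>a\<close>. Being a product of two overlapping
  transpositions, it links 3-cycles to the even words in transpositions used in
  \<open>primitive_three_cycle\<close>.\<close>

definition three_cycle :: "'a \<Rightarrow> 'a \<Rightarrow> 'a \<Rightarrow> 'a \<Rightarrow> 'a"
  where "three_cycle a b c = transpose a b \<circ> transpose b c"

lemma three_cycle_conj:
  assumes "bij h"
  shows "h \<circ> three_cycle a b c \<circ> inv' h = three_cycle (h a) (h b) (h c)"
proof -
  have "h \<circ> (transpose a b \<circ> transpose b c) \<circ> inv' h
      = (h \<circ> transpose a b \<circ> inv' h) \<circ> (h \<circ> transpose b c \<circ> inv' h)"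
    using assms by (auto simp: fun_eq_iff bij_is_inj)
  then show ?thesis
    unfolding three_cycle_def transpose_conj[OF assms] .
qed

lemma three_cycle_rotate: "distinct [a, b, c] \<Longrightarrow> three_cycle a b c = three_cycle b c a"
  by (auto simp: three_cycle_def fun_eq_iff transpose_def)

lemma inv_three_cycle: "inv' (three_cycle a b c) = three_cycle c b a"
proof -
  have "three_cycle a b c \<circ> three_cycle c b a = id" "three_cycle c b a \<circ> three_cycle a b c = id"
    by (auto simp: three_cycle_def fun_eq_iff transpose_def)
  then show ?thesis
    using inv_unique_comp by blast
qed

lemma three_cycle_apply:
  assumes "distinct [a, b, c]"
  shows "three_cycle a b c a = b" "three_cycle a b c b = c" "three_cycle a b c c = a"
  using assms by (auto simp: three_cycle_def transpose_def)

lemma three_cycle_apply_other: "i \<notin> {a, b, c} \<Longrightarrow> three_cycle a b c i = i"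
  by (auto simp: three_cycle_def transpose_def)

lemma moved_card_2:
  assumes "inj p" "card (moved p) = 2"
  obtains a b where "a \<noteq> b" "p = transpose a b"
proof -
  obtain a b where ab: "moved p = {a, b}" "a \<noteq> b"
    using assms(2) by (auto simp: card_2_iff)
  have "p a \<in> {a, b}" "p b \<in> {a, b}" "p a \<noteq> a" "p b \<noteq> b"
    using apply_in_moved_iff[OF assms(1)] ab by (auto simp: moved_def)
  then have "p = transpose a b"
    using ab by (auto simp: moved_def fun_eq_iff transpose_def)
  then show thesis using that ab by blast
qed

text \<open>An injective map permutes its support without fixed points, and the only derangements of
  three points are the two 3-cycles.\<close>

lemma moved_card_3:
  assumes "inj p" "card (moved p) = 3"
  obtains a b c where "distinct [a, b, c]" "p = three_cycle a b c"
proof -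
  obtain a b c where abc: "moved p = {a, b, c}" "distinct [a, b, c]"
    using assms(2) by (auto simp: card_3_iff)
  have "p a \<in> {a, b, c}" "p b \<in> {a, b, c}" "p c \<in> {a, b, c}"
    using apply_in_moved_iff[OF assms(1)] abc(1) by blast+
  moreover have "p a \<noteq> a" "p b \<noteq> b" "p c \<noteq> c"
    using abc(1) by (auto simp: moved_def)
  moreover have "p a \<noteq> p b" "p b \<noteq> p c" "p a \<noteq> p c"
    using inj_eq[OF assms(1)] abc(2) by auto
  ultimately have "(p a = b \<and> p b = c \<and> p c = a) \<or> (p a = c \<and> p b = a \<and> p c = b)"
    by auto
  moreover have "p = three_cycle a b c" if "p a = b \<and> p b = c \<and> p c = a"
    using that abc by (auto simp: moved_def fun_eq_iff three_cycle_def transpose_def)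
  moreover have "p = three_cycle a c b" if "p a = c \<and> p b = a \<and> p c = b"
    using that abc by (auto simp: moved_def fun_eq_iff three_cycle_def transpose_def)
  ultimately consider "p = three_cycle a b c" | "p = three_cycle a c b"
    by blast
  then show thesis
    by cases (use that[of a b c] that[of a c b] abc(2) in auto)
qed

section \<open>Invariant relations and theorems of Jordan type\<close>

locale perm_group =
  fixes S :: "'a set" and H :: "('a \<Rightarrow> 'a) set"
  assumes finite_S: "finite S"
    and permutes: "h \<in> H \<Longrightarrow> h permutes S"
    and id_closed: "id \<in> H"
    and comp_closed: "g \<in> H \<Longrightarrow> h \<in> H \<Longrightarrow> g \<circ> h \<in> H"
    and inv_closed: "h \<in> H \<Longrightarrow> inv' h \<in> H"
begin

lemma bij: "h \<in> H \<Longrightarrow> bij h"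
  using permutes permutes_bij by blast

lemma inj: "h \<in> H \<Longrightarrow> inj h"
  using permutes permutes_inj by blast

lemma permutation: "h \<in> H \<Longrightarrow> permutation h"
  using permutes finite_S permutation_permutes by blast

lemma finite_H: "finite H"
  using finite_subset[OF _ finite_permutations[OF finite_S]] permutes by blast

lemma in_S_iff: "h \<in> H \<Longrightarrow> h i \<in> S \<longleftrightarrow> i \<in> S"
  using permutes_in_image[OF permutes] .

lemma inv_apply [simp]: "h \<in> H \<Longrightarrow> inv' h (h i) = i" "h \<in> H \<Longrightarrow> h (inv' h i) = i"
  using permutes permutes_inverses by fast+

lemma conj_closed: "h \<in> H \<Longrightarrow> g \<in> H \<Longrightarrow> h \<circ> g \<circ> inv' h \<in> H"
  by (intro comp_closed inv_closed)

lemma funpow_closed: "h \<in> H \<Longrightarrow> h ^^ k \<in> H"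
proof (induction k)
  case (Suc k)
  then show ?case using comp_closed[of h "h ^^ k"] by (simp only: funpow.simps)
qed (use id_closed in \<open>simp add: id_def\<close>)

definition transitive :: bool
  where "transitive \<longleftrightarrow> (\<forall>a\<in>S. \<forall>b\<in>S. \<exists>h\<in>H. h a = b)"

definition invariant_equiv :: "('a \<times> 'a) set \<Rightarrow> bool"
  where "invariant_equiv R \<longleftrightarrow> equiv S R \<and> (\<forall>h\<in>H. \<forall>(a, b)\<in>R. (h a, h b) \<in> R)"

text \<open>Transitivity is not built in; \<open>weight_imprimitive\<close> asks for it
  separately.\<close>

definition primitive :: bool
  where "primitive \<longleftrightarrow> (\<forall>R. invariant_equiv R \<longrightarrow> R = Id_on S \<or> R = S \<times> S)"

text \<open>The form in which primitivity is exploited: an invariant equivalence that relates two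
  distinct points is not the diagonal, hence is everything. Stating it for a predicate spares every
  application the set of pairs.\<close>

lemma primitive_full:
  assumes "primitive"
    and "\<And>a. a \<in> S \<Longrightarrow> P a a"
    and "\<And>a b. a \<in> S \<Longrightarrow> b \<in> S \<Longrightarrow> P a b \<Longrightarrow> P b a"
    and "\<And>a b c. a \<in> S \<Longrightarrow> b \<in> S \<Longrightarrow> c \<in> S \<Longrightarrow> P a b \<Longrightarrow> P b c \<Longrightarrow> P a c"
    and "\<And>a b h. h \<in> H \<Longrightarrow> a \<in> S \<Longrightarrow> b \<in> S \<Longrightarrow> P a b \<Longrightarrow> P (h a) (h b)"
    and "i \<in> S" "j \<in> S" "i \<noteq> j" "P i j"
    and "a \<in> S" "b \<in> S"
  shows "P a b"
proof -
  define R where "R = {(a, b). a \<in> S \<and> b \<in> S \<and> P a b}"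
  have "refl_on S R"
    using assms(2) by (simp add: R_def refl_on_def)
  moreover have "sym R"
    unfolding sym_def R_def using assms(3) by blast
  moreover have "trans R"
    unfolding trans_def R_def using assms(4) by blast
  ultimately have "equiv S R"
    by (intro equivI) (auto simp: R_def)
  moreover have "\<forall>h\<in>H. \<forall>(a, b)\<in>R. (h a, h b) \<in> R"
    unfolding R_def using assms(5) in_S_iff by blast
  ultimately have "R = Id_on S \<or> R = S \<times> S"
    using assms(1) by (auto simp: primitive_def invariant_equiv_def)
  moreover have "(i, j) \<in> R" "(i, j) \<notin> Id_on S"
    using assms(6-9) by (auto simp: R_def)
  ultimately have "(a, b) \<in> R"
    using assms(10,11) by auto
  then show ?thesis
    by (simp add: R_def)
qed

text \<open>Jordan's theorem for transpositions. "The transposition of c and d lies in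
  \<open>H\<close>" is an invariant equivalence on points, so \<open>H\<close> contains all
  transpositions, and these generate.\<close>

lemma primitive_transpose:
  assumes "primitive" "a \<in> S" "b \<in> S" "a \<noteq> b" "transpose a b \<in> H" and "p permutes S"
  shows "p \<in> H"
proof -
  have all: "transpose c d \<in> H" if "c \<in> S" "d \<in> S" for c d
  proof (rule primitive_full[where P = "\<lambda>c d. transpose c d \<in> H" and i = a and j = b])
    show "transpose a c \<in> H" if *: "transpose a b \<in> H" "transpose b c \<in> H" for a b c
    proof (cases "a = b \<or> a = c")
      case False
      then have "transpose b c \<circ> transpose a b \<circ> transpose b c = transpose a c"
        by (auto simp: fun_eq_iff transpose_def)
      with * show ?thesis
        by (metis comp_closed)
    qed (use * id_closed in auto)
    show "transpose (h a) (h b) \<in> H" if "h \<in> H" "transpose a b \<in> H" for a b h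
      using that conj_closed transpose_conj bij by metis
    show "transpose b a \<in> H" if "transpose a b \<in> H" for a b
      using that by (simp add: transpose_commute)
    show "transpose a a \<in> H" for a
      using id_closed by simp
  qed (use assms that in simp_all)
  show ?thesis
    using assms(6) finite_S
    by (induction rule: permutes_induct) (use id_closed all comp_closed in blast)+
qed

text \<open>Jordan's theorem for 3-cycles. The invariant equivalence is now "some 3-cycle of
  \<open>H\<close> carries a to b". It puts some 3-cycle over every ordered pair; conjugation then
  yields all 3-cycles, and these generate the even permutations.\<close>

lemma primitive_three_cycle:
  assumes prim: "primitive"
    and abc: "a \<in> S" "b \<in> S" "c \<in> S" "distinct [a, b, c]" "three_cycle a b c \<in> H"
    and p: "p permutes S" "evenperm p"
  shows "p \<in> H"
proof -
  define P where "P a b \<longleftrightarrow> a = b \<or> (\<exists>c\<in>S. distinct [a, b, c] \<and> three_cycle a b c \<in> H)" for a b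
  have rot: "three_cycle b c a \<in> H" if "distinct [a, b, c]" "three_cycle a b c \<in> H" for a b c
    using that three_cycle_rotate[of a b c] by simp
  have inv3: "three_cycle c b a \<in> H" if "three_cycle a b c \<in> H" for a b c
    using inv_closed[OF that] by (simp add: inv_three_cycle)
  have conj3: "three_cycle (h a) (h b) (h c) \<in> H" if "h \<in> H" "three_cycle a b c \<in> H" for a b c h
    using conj_closed[OF that] bij[OF that(1)] by (simp add: three_cycle_conj)
  have P_sym: "P b a" if "P a b" for a b
  proof -
    have "\<exists>c\<in>S. distinct [b, a, c] \<and> three_cycle b a c \<in> H"
      if c: "c \<in> S" "distinct [a, b, c]" "three_cycle a b c \<in> H" for c
      using c inv3[OF c(3)] rot[of c b a] by (intro bexI[of _ c]) auto
    then show ?thesis using that by (auto simp: P_def)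
  qed
  have P_conj: "P (h a) (h b)" if "h \<in> H" "P a b" for a b h
  proof -
    have "\<exists>c\<in>S. distinct [h a, h b, c] \<and> three_cycle (h a) (h b) c \<in> H"
      if c: "c \<in> S" "distinct [a, b, c]" "three_cycle a b c \<in> H" for c
      using c conj3[OF \<open>h \<in> H\<close> c(3)] inj[OF \<open>h \<in> H\<close>] in_S_iff[OF \<open>h \<in> H\<close>]
      by (intro bexI[of _ "h c"]) (auto simp: inj_eq)
    then show ?thesis using that by (auto simp: P_def)
  qed
  have P_trans: "P a d" if S: "a \<in> S" "b \<in> S" "d \<in> S" and "P a b" "P b d" for a b d
  proof (cases "a = b \<or> b = d \<or> a = d")
    case False
    then obtain e where e: "e \<in> S" "distinct [b, d, e]" "three_cycle b d e \<in> H"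
      using \<open>P b d\<close> by (auto simp: P_def)
    show ?thesis
    proof (cases "e = a")
      case True
      have "three_cycle a d b \<in> H"
        using P_sym e True inv3[of b d e] by auto
      then show ?thesis
        using S False by (auto simp: P_def intro!: bexI[of _ b])
    next
      case ne: False
      \<comment> \<open>This 3-cycle fixes \<open>a\<close> and carries \<open>b\<close> to
        \<open>d\<close>, so conjugating by it turns the relation of \<open>a\<close> to
        \<open>b\<close> into the one of \<open>a\<close> to \<open>d\<close>.\<close>
      have "P (three_cycle b d e a) (three_cycle b d e b)"
        using P_conj[OF e(3) \<open>P a b\<close>] .
      then show ?thesis
        using three_cycle_apply[OF e(2)] three_cycle_apply_other[of a b d e] ne False by auto
    qed
  qed (use that in \<open>auto simp: P_def\<close>)
  have P_all: "P c d" if "c \<in> S" "d \<in> S" for c d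
  proof (rule primitive_full[where P = P and i = a and j = b])
    show "P a b" using abc by (auto simp: P_def)
    show "P a c" if "a \<in> S" "b \<in> S" "c \<in> S" "P a b" "P b c" for a b c
      using P_trans that by blast
    show "P a a" for a by (simp add: P_def)
  qed (use that abc P_sym P_conj prim in auto)
  have all: "three_cycle a b c \<in> H" if S: "a \<in> S" "b \<in> S" "c \<in> S" and dist: "distinct [a, b, c]" for a b c
  proof -
    obtain d where d: "d \<in> S" "distinct [a, b, d]" "three_cycle a b d \<in> H"
      using P_all[OF S(1,2)] dist by (auto simp: P_def)
    show ?thesis
    proof (cases "d = c")
      case False
      obtain e where e: "e \<in> S" "distinct [d, c, e]" "three_cycle d c e \<in> H"
        using P_all[OF d(1) S(3)] False by (auto simp: P_def)
      \<comment> \<open>Conjugation by \<open>?s\<close> replaces \<open>d\<close> by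
        \<open>c\<close> as long as \<open>e\<close> avoids \<open>a\<close> and \<open>b\<close>.
        If \<open>e\<close> is one of them, the inverse \<open>?t\<close> still produces a 3-cycle
        on \<open>a\<close>, \<open>b\<close>, \<open>c\<close>, possibly with the wrong
        orientation, which inversion repairs.\<close>
      let ?s = "three_cycle d c e" and ?t = "three_cycle e c d"
      have t: "?t \<in> H" "distinct [e, c, d]" using inv3 e by auto
      have s_ap: "?s d = c" "?s c = e" "?s e = d" "?t e = c" "?t c = d" "?t d = e"
        using three_cycle_apply[OF e(2)] three_cycle_apply[OF t(2)] by auto
      consider "e = a" | "e = b" | "e \<noteq> a" "e \<noteq> b" by blast
      then show ?thesis
      proof cases
        case 1
        have "?t b = b"
          using three_cycle_apply_other[of b e c d] 1 d(2) dist by auto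
        then have "three_cycle c b a \<in> H"
          using conj3[OF t(1) d(3)] s_ap 1 by simp
        then show ?thesis using inv3 by blast
      next
        case 2
        have "?t a = a"
          using three_cycle_apply_other[of a e c d] 2 d(2) dist by auto
        then have "three_cycle a c b \<in> H"
          using conj3[OF t(1) d(3)] s_ap 2 by simp
        then have "three_cycle b c a \<in> H" using inv3 by blast
        then have "three_cycle c a b \<in> H" using rot[of b c a] dist by auto
        then show ?thesis using rot[of c a b] dist by auto
      next
        case 3
        have "?s a = a" "?s b = b"
          using three_cycle_apply_other[of a d c e] three_cycle_apply_other[of b d c e] 3 d(2) dist
          by auto
        then show ?thesis
          using conj3[OF e(3) d(3)] s_ap by simp
      qed
    qed (use d in simp)
  qed
  have two: "transpose a b \<circ> transpose b c \<in> H" if "a \<in> S" "b \<in> S" "c \<in> S" "a \<noteq> b" "b \<noteq> c" for a b c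
    using all[of a b c] that id_closed by (cases "a = c") (auto simp: three_cycle_def transpose_commute)
  have pair: "transpose a b \<circ> transpose c d \<in> H"
    if "a \<in> S" "b \<in> S" "c \<in> S" "d \<in> S" "a \<noteq> b" "c \<noteq> d" for a b c d
  proof (cases "b = c")
    case False
    \<comment> \<open>Inserting \<open>transpose b c\<close> twice splits the product into two
      products of overlapping transpositions.\<close>
    have "transpose a b \<circ> transpose c d
        = (transpose a b \<circ> transpose b c) \<circ> (transpose b c \<circ> transpose c d)"
      by (simp add: fun_eq_iff)
    then show ?thesis
      using two[of a b c] two[of b c d] that False comp_closed by metis
  qed (use two that in auto)
  have gen: "apply_transps xs \<in> H" if "\<forall>(a,b)\<in>set xs. a \<noteq> b \<and> a \<in> S \<and> b \<in> S" "even (length xs)" for xs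
    using that
  proof (induction xs rule: induct_list012)
    case (3 x y zs)
    have "transpose (fst x) (snd x) \<circ> transpose (fst y) (snd y) \<in> H"
      using 3(3) by (intro pair) auto
    then have "(transpose (fst x) (snd x) \<circ> transpose (fst y) (snd y)) \<circ> apply_transps zs \<in> H"
      using 3 by (intro comp_closed[OF \<open>_ \<circ> _ \<in> H\<close>]) auto
    then show ?case by (simp add: comp_def)
  qed (use id_closed in auto)
  obtain xs where xs: "\<forall>(a,b)\<in>set xs. a \<noteq> b \<and> a \<in> S \<and> b \<in> S" "apply_transps xs = p"
    using permutes_from_transpositions[OF p(1) finite_S] by blast
  have "\<forall>(a,b)\<in>set xs. a \<noteq> b" using xs(1) by auto
  then have "even (length xs)"
    using evenperm_apply_transps_iff[of xs] xs(2) p(2) by simp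
  then show ?thesis using gen xs by blast
qed

lemma primitive_small_support:
  assumes "primitive" "h \<in> H" "h \<noteq> id" "card (moved h) \<le> 3" "p permutes S" "evenperm p"
  shows "p \<in> H"
proof -
  have sub: "moved h \<subseteq> S" using moved_subset permutes assms(2) by blast
  then have fin: "finite (moved h)" using finite_S finite_subset by blast
  have "card (moved h) \<noteq> 0"
    using fin assms(3) by (simp add: moved_eq_empty_iff)
  moreover have "card (moved h) \<noteq> 1"
  proof
    assume "card (moved h) = 1"
    then obtain a where "moved h = {a}" by (auto simp: card_1_singleton_iff)
    then show False
      using apply_in_moved_iff[OF inj[OF assms(2)], of a] by (auto simp: moved_def)
  qed
  ultimately consider "card (moved h) = 2" | "card (moved h) = 3"
    using assms(4) by linarith
  then show ?thesis
  proof cases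
    case 1
    then obtain a b where "a \<noteq> b" "h = transpose a b"
      using moved_card_2 inj[OF assms(2)] by blast
    moreover from this have "a \<in> moved h" "b \<in> moved h" by (auto simp: moved_def)
    ultimately show ?thesis
      using primitive_transpose[of a b] assms sub by blast
  next
    case 2
    then obtain a b c where abc: "distinct [a, b, c]" "h = three_cycle a b c"
      using moved_card_3 inj[OF assms(2)] by blast
    then have "a \<in> moved h" "b \<in> moved h" "c \<in> moved h"
      using three_cycle_apply[OF abc(1)] by (auto simp: moved_def)
    then show ?thesis
      using primitive_three_cycle[of a b c] abc assms sub by blast
  qed
qed

text \<open>A form of Rudio's lemma. Not being separated by any image of \<open>D\<close> is an
  invariant equivalence; if it related two distinct points it would relate all, and \<open>D\<close>
  itself would be empty or all of \<open>S\<close>.\<close>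

lemma primitive_separates:
  assumes "primitive" "D \<subseteq> S" "D \<noteq> {}" "D \<noteq> S" "i \<in> S" "j \<in> S" "i \<noteq> j"
  obtains h where "h \<in> H" "i \<in> h ` D \<longleftrightarrow> j \<notin> h ` D"
proof -
  have "\<not> (\<forall>h\<in>H. i \<in> h ` D \<longleftrightarrow> j \<in> h ` D)"
  proof
    assume *: "\<forall>h\<in>H. i \<in> h ` D \<longleftrightarrow> j \<in> h ` D"
    obtain a where a: "a \<in> D" using assms(3) by (meson ex_in_conv)
    obtain b where b: "b \<in> S - D"
      using assms(2,4) by (metis Diff_eq_empty_iff ex_in_conv subset_antisym)
    note ab = a b
    have "\<forall>h\<in>H. a \<in> h ` D \<longleftrightarrow> b \<in> h ` D"
    proof (rule primitive_full[where P = "\<lambda>i j. \<forall>h\<in>H. i \<in> h ` D \<longleftrightarrow> j \<in> h ` D" and i = i and j = j])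
      fix a b g assume g: "g \<in> H" and ab: "\<forall>h\<in>H. a \<in> h ` D \<longleftrightarrow> b \<in> h ` D"
      have eq: "g i \<in> h ` D \<longleftrightarrow> i \<in> (inv' g \<circ> h) ` D" for h i
      proof -
        have "h ` D = g ` (inv' g \<circ> h) ` D"
          using g by (simp add: image_image)
        then show ?thesis
          using inj_image_mem_iff[OF inj[OF g]] by metis
      qed
      show "\<forall>h\<in>H. g a \<in> h ` D \<longleftrightarrow> g b \<in> h ` D"
        unfolding eq using ab comp_closed[OF inv_closed[OF g]] by blast
    qed (use assms(1,2,5-7) * ab in \<open>simp_all add: subset_iff\<close>)
    then have "a \<in> id ` D \<longleftrightarrow> b \<in> id ` D" using id_closed by blast
    with ab show False by auto
  qed
  then show thesis using that by blast
qed

end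

section \<open>Permutations of eight points\<close>

text \<open>The classical source of 3-cycles. Away from \<open>a\<close>, \<open>g a\<close> and
  \<open>h a\<close>, at most one of the two permutations acts on the points that the commutator
  passes through, so it cancels against its inverse. The point \<open>h a\<close> is sent to
  \<open>a\<close>, so the commutator is not trivial.\<close>

lemma moved_commutator:
  assumes "bij g" "bij h" "moved g \<inter> moved h = {a}"
  shows "moved (g \<circ> h \<circ> inv' g \<circ> inv' h) \<subseteq> {a, g a, h a}"
    and "g \<circ> h \<circ> inv' g \<circ> inv' h \<noteq> id"
proof -
  let ?g = "inv' g" and ?h = "inv' h"
  have fg: "g i = i" "?g i = i" if "i \<notin> moved g" for i
    using that assms(1) by (simp_all add: moved_def inv_f_eq bij_is_inj)
  have fh: "h i = i" "?h i = i" if "i \<notin> moved h" for i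
    using that assms(2) by (simp_all add: moved_def inv_f_eq bij_is_inj)
  have gi: "g (?g i) = i" "?g (g i) = i" and hi: "h (?h i) = i" "?h (h i) = i" for i
    using assms(1,2) by (auto simp: bij_is_inj bij_is_surj surj_f_inv_f)
  have mg: "?g i \<in> moved g \<longleftrightarrow> i \<in> moved g" and mh: "?h i \<in> moved h \<longleftrightarrow> i \<in> moved h" for i
    using inv_in_moved_iff[OF assms(1)] inv_in_moved_iff[OF assms(2)] .
  have "g (h (?g (?h i))) = i" if i: "i \<noteq> a" "i \<noteq> g a" "i \<noteq> h a" for i
  proof (cases "i \<in> moved h")
    case True
    then have "?h i \<in> moved h" "?h i \<noteq> a" "i \<notin> moved g"
      using mh i hi assms(3) by auto
    then have "?h i \<notin> moved g" using assms(3) by auto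
    then show ?thesis using fg \<open>i \<notin> moved g\<close> hi by simp
  next
    case h: False
    show ?thesis
    proof (cases "i \<in> moved g")
      case True
      then have "?g i \<in> moved g" "?g i \<noteq> a" using mg i gi by auto
      then have "?g i \<notin> moved h" using assms(3) by auto
      then show ?thesis using h fh gi by simp
    qed (use h fh fg in simp)
  qed
  then show "moved (g \<circ> h \<circ> ?g \<circ> ?h) \<subseteq> {a, g a, h a}"
    by (auto simp: moved_def)
  have a: "a \<in> moved g" "a \<in> moved h" using assms(3) by auto
  then have "?g a \<in> moved g" using mg by blast
  moreover have "?g a \<noteq> a" using a(1) gi(1)[of a] by (auto simp: moved_def)
  ultimately have "?g a \<notin> moved h" using assms(3) by auto
  then have "g (h (?g (?h (h a)))) = a" using hi gi fh by simp
  moreover have "h a \<noteq> a" using a by (simp add: moved_def)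
  ultimately show "g \<circ> h \<circ> ?g \<circ> ?h \<noteq> id"
    by (metis comp_apply id_apply)
qed

text \<open>Residues modulo 8 stand for positions along an 8-cycle, and \<open>i + (8 - k)\<close>
  is i - k without truncated subtraction. Shifts by k and -k overlap a set equally often and the
  half turn overlaps it evenly, so the shifts 1, 2, 3 decide whether some translate meets it in one
  point. The 256 subsets are checked exhaustively.\<close>

lemma half_turn_invariant_list:
  "list_all (\<lambda>T. length T = 4 \<longrightarrow>
      list_all (\<lambda>k. length (filter (\<lambda>i. (i + (8 - k)) mod 8 \<in> set T) T) \<noteq> 1) [1, 2, 3] \<longrightarrow>
      list_all (\<lambda>i. (i + 4) mod 8 \<in> set T) T) (subseqs [0,1,2,3,4,5,6,7::nat])"
  by code_simp

lemma half_turn_invariant: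
  assumes "T \<subseteq> {..<8::nat}" "card T = 4"
    and "\<And>k. k \<in> {1, 2, 3} \<Longrightarrow> card {i \<in> T. (i + (8 - k)) mod 8 \<in> T} \<noteq> 1"
    and "i \<in> T"
  shows "(i + 4) mod 8 \<in> T"
proof -
  have r: "[0,1,2,3,4,5,6,7::nat] = [0..<8]" by (simp add: upt_rec)
  have "T \<in> set ` set (subseqs [0..<8])"
    using assms(1) unfolding subseqs_powset by auto
  then obtain xs where xs: "set xs = T" "xs \<in> set (subseqs [0..<8])" "distinct xs"
    using subseqs_distinctD[of _ "[0..<8]"] by auto
  have "length xs = 4" using xs distinct_card assms(2) by metis
  moreover have "length (filter (\<lambda>i. (i + (8 - k)) mod 8 \<in> set xs) xs)
      = card {i \<in> T. (i + (8 - k)) mod 8 \<in> T}" for k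
  proof -
    have "{i \<in> T. (i + (8 - k)) mod 8 \<in> T} = set (filter (\<lambda>i. (i + (8 - k)) mod 8 \<in> set xs) xs)"
      using xs(1) by auto
    then show ?thesis
      using distinct_card[OF distinct_filter[OF xs(3)]] by metis
  qed
  ultimately have "length (filter (\<lambda>i. (i + (8 - k)) mod 8 \<in> set xs) xs) \<noteq> 1" if "k \<in> set [1, 2, 3]" for k
    using assms(3) that by simp
  then show ?thesis
    using half_turn_invariant_list[unfolded r list_all_iff] xs(1,2) \<open>length xs = 4\<close> assms(4) by blast
qed

text \<open>In a set of eight points, having no cycles of length 1, 2, 3 or 4 forces a single cycle.\<close>

definition eight_cycle :: "'a set \<Rightarrow> ('a \<Rightarrow> 'a) \<Rightarrow> bool"
  where "eight_cycle S p \<longleftrightarrow> p permutes S \<and> fixed S p 3 = {} \<and> fixed S p 4 = {}"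

text \<open>The tuples are the 22 partitions of 8, written by multiplicities.\<close>

lemma partitions_8:
  fixes c1 c2 c3 c4 c5 c6 c7 c8 :: nat
  assumes "c1 + 2 * c2 + 3 * c3 + 4 * c4 + 5 * c5 + 6 * c6 + 7 * c7 + 8 * c8 = 8"
  shows "(c1, c2, c3, c4, c5, c6, c7, c8) \<in>
    {(0, 0, 0, 0, 0, 0, 0, 1),
     (1, 0, 0, 0, 0, 0, 1, 0),
     (0, 1, 0, 0, 0, 1, 0, 0),
     (2, 0, 0, 0, 0, 1, 0, 0),
     (0, 0, 1, 0, 1, 0, 0, 0),
     (1, 1, 0, 0, 1, 0, 0, 0),
     (3, 0, 0, 0, 1, 0, 0, 0),
     (0, 0, 0, 2, 0, 0, 0, 0),
     (1, 0, 1, 1, 0, 0, 0, 0),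
     (0, 2, 0, 1, 0, 0, 0, 0),
     (2, 1, 0, 1, 0, 0, 0, 0),
     (4, 0, 0, 1, 0, 0, 0, 0),
     (0, 1, 2, 0, 0, 0, 0, 0),
     (2, 0, 2, 0, 0, 0, 0, 0),
     (1, 2, 1, 0, 0, 0, 0, 0),
     (3, 1, 1, 0, 0, 0, 0, 0),
     (5, 0, 1, 0, 0, 0, 0, 0),
     (0, 4, 0, 0, 0, 0, 0, 0),
     (2, 3, 0, 0, 0, 0, 0, 0),
     (4, 2, 0, 0, 0, 0, 0, 0),
     (6, 1, 0, 0, 0, 0, 0, 0),
     (8, 0, 0, 0, 0, 0, 0, 0)}"
proof -
  have "c8 = 0 \<or> c8 = 1" using assms by linarith
  then show ?thesis
  proof
    assume z8: "c8 = 0"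
    have "c7 = 0 \<or> c7 = 1" using assms by linarith
    then show ?thesis
    proof
      assume z7: "c7 = 0"
      have "c6 = 0 \<or> c6 = 1" using assms by linarith
      then show ?thesis
      proof
        assume z6: "c6 = 0"
        have "c5 = 0 \<or> c5 = 1" using assms by linarith
        then show ?thesis
        proof
          assume z5: "c5 = 0"
          have "c4 = 0 \<or> c4 = 1 \<or> c4 = 2" using assms by linarith
          moreover have "c3 = 0 \<or> c3 = 1 \<or> c3 = 2" using assms by linarith
          moreover have "c2 = 0 \<or> c2 = 1 \<or> c2 = 2 \<or> c2 = 3 \<or> c2 = 4" using assms by linarith
          ultimately show ?thesis using assms z8 z7 z6 z5 by (elim disjE) simp_all
        next
          assume e: "c5 = 1"
          have [simp]: "c4 = 0" using assms e by linarith
          have "c3 = 0 \<or> c3 = 1" "c2 = 0 \<or> c2 = 1" using assms e by linarith+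
          then show ?thesis using assms e z8 z7 z6 by auto
        qed
      next
        assume e: "c6 = 1"
        have [simp]: "c5 = 0" "c4 = 0" "c3 = 0" using assms e by linarith+
        have "c2 = 0 \<or> c2 = 1" using assms e by linarith
        then show ?thesis using assms e z8 z7 by auto
      qed
    next
      assume e: "c7 = 1"
      have [simp]: "c6 = 0" "c5 = 0" "c4 = 0" "c3 = 0" "c2 = 0" using assms e by linarith+
      show ?thesis using assms e z8 by simp
    qed
  next
    assume e: "c8 = 1"
    have [simp]: "c7 = 0" "c6 = 0" "c5 = 0" "c4 = 0" "c3 = 0" "c2 = 0" using assms e by linarith+
    show ?thesis using assms e  by simp
  qed
qed

text \<open>The character-like table behind all later case distinctions. Its rows are the cycle
  types in the order of \<open>partitions_8\<close>; its columns are the parity and the fixed point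
  counts of the powers 1 to 6 and 8.\<close>

lemma fixed_profile_8:
  assumes "p permutes S" "card S = 8"
  shows "(evenperm p, card (fixed S p 1), card (fixed S p 2), card (fixed S p 3), card (fixed S p 4),
     card (fixed S p 5), card (fixed S p 6), card (fixed S p 8)) \<in>
    {(False, 0, 0, 0, 0, 0, 0, 8),
     (True, 1, 1, 1, 1, 1, 1, 1),
     (True, 0, 2, 0, 2, 0, 8, 2),
     (False, 2, 2, 2, 2, 2, 8, 2),
     (True, 0, 0, 3, 0, 5, 3, 0),
     (False, 1, 3, 1, 3, 6, 3, 3),
     (True, 3, 3, 3, 3, 8, 3, 3),
     (True, 0, 0, 0, 8, 0, 0, 8),
     (False, 1, 1, 4, 5, 1, 4, 5),
     (False, 0, 4, 0, 8, 0, 4, 8),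
     (True, 2, 4, 2, 8, 2, 4, 8),
     (False, 4, 4, 4, 8, 4, 4, 8),
     (False, 0, 2, 6, 2, 0, 8, 2),
     (True, 2, 2, 8, 2, 2, 8, 2),
     (True, 1, 5, 4, 5, 1, 8, 5),
     (False, 3, 5, 6, 5, 3, 8, 5),
     (True, 5, 5, 8, 5, 5, 8, 5),
     (True, 0, 8, 0, 8, 0, 8, 8),
     (False, 2, 8, 2, 8, 2, 8, 8),
     (True, 4, 8, 4, 8, 4, 8, 8),
     (False, 6, 8, 6, 8, 6, 8, 8),
     (True, 8, 8, 8, 8, 8, 8, 8)}"
proof -
  have "finite S" using assms(2) by (intro card_ge_0_finite) simp
  then show ?thesis
    using assms
  proof (rule_tac cycle_type_8[of p S])
    fix c1 c2 c3 c4 c5 c6 c7 c8 :: nat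
    assume c: "c1 + 2 * c2 + 3 * c3 + 4 * c4 + 5 * c5 + 6 * c6 + 7 * c7 + 8 * c8 = card S"
      "evenperm p \<longleftrightarrow> even (c2 + c4 + c6 + c8)"
      "card (fixed S p 1) = c1"
      "card (fixed S p 2) = c1 + 2 * c2"
      "card (fixed S p 3) = c1 + 3 * c3"
      "card (fixed S p 4) = c1 + 2 * c2 + 4 * c4"
      "card (fixed S p 5) = c1 + 5 * c5"
      "card (fixed S p 6) = c1 + 2 * c2 + 3 * c3 + 6 * c6"
      "card (fixed S p 8) = c1 + 2 * c2 + 4 * c4 + 8 * c8"
    show ?thesis
      using partitions_8[OF c(1)[unfolded assms(2)]] unfolding c(2-9)
      by (elim insertE emptyE) simp_all
  qed auto
qed

lemma dvd_8_not_dvd_4: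
  fixes d :: nat
  assumes "d dvd 8" "\<not> d dvd 4"
  shows "d = 8"
proof -
  have "d \<le> 8" using assms(1) by (auto dest: dvd_imp_le)
  then consider "d = 0" | "d = 1" | "d = 2" | "d = 3" | "d = 4" | "d = 5" | "d = 6" | "d = 7" | "d = 8"
    by linarith
  then show ?thesis using assms by cases simp_all
qed

text \<open>Third and fourth powers without fixed points single out the first row of the table, so
  \<open>x\<close> is odd and its eighth power is the identity. Every orbit length on
  \<open>S\<close> then divides 8 but not 4.\<close>

lemma eight_cycle:
  assumes "eight_cycle S x" "card S = 8"
  shows "\<not> evenperm x" "\<And>a. a \<in> S \<Longrightarrow> (x ^^ k) a = a \<longleftrightarrow> 8 dvd k"
    "\<And>a. a \<in> S \<Longrightarrow> bij_betw (\<lambda>i. (x ^^ i) a) {..<8} S"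
    "x ^^ 8 = id"
proof -
  have x: "x permutes S" "card (fixed S x 3) = 0" "card (fixed S x 4) = 0"
    using assms(1) by (auto simp: eight_cycle_def)
  have fin: "finite S" using assms(2) by (intro card_ge_0_finite) simp
  have c: "\<not> evenperm x" "card (fixed S x 8) = 8"
    using fixed_profile_8[OF x(1) assms(2)] x(2,3) by auto
  then show "\<not> evenperm x" by simp
  have "fixed S x 8 = S"
    using c(2) assms(2) fin fixed_subset[of S x 8] by (intro card_subset_eq) auto
  then have e8: "(x ^^ 8) a = a" if "a \<in> S" for a
    using that by (auto simp: fixed_def)
  moreover have "(x ^^ 8) a = a" if "a \<notin> S" for a
    using that permutes_funpow[OF x(1)] permutes_not_in by metis
  ultimately show "x ^^ 8 = id" by (metis eq_id_iff)
  have perm: "permutation x" using x fin permutation_permutes by blast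
  have dvd: "(x ^^ k) a = a \<longleftrightarrow> 8 dvd k" if "a \<in> S" for a k
  proof -
    let ?d = "least_power x a"
    have "?d dvd 8" using least_power_dvd[OF perm, of a 8] e8[OF that] by simp
    moreover have "\<not> ?d dvd 4"
      using least_power_dvd[OF perm, of a 4] assms(1) that by (auto simp: eight_cycle_def fixed_def)
    ultimately have "?d = 8" by (rule dvd_8_not_dvd_4)
    then show ?thesis using least_power_dvd[OF perm, of a k] by simp
  qed
  show "(x ^^ k) a = a \<longleftrightarrow> 8 dvd k" if "a \<in> S" for a using dvd that .
  show "bij_betw (\<lambda>i. (x ^^ i) a) {..<8} S" if "a \<in> S" for a
  proof -
    have inj: "inj_on (\<lambda>i. (x ^^ i) a) {..<8}"
    proof (intro linorder_inj_onI)
      fix i j :: nat assume ij: "i < j" "i \<in> {..<8}" "j \<in> {..<8}"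
      have "(x ^^ (j - i)) a \<noteq> a" using dvd[OF that] ij by (auto dest: dvd_imp_le)
      then show "(x ^^ i) a \<noteq> (x ^^ j) a"
        using funpow_diff[OF permutes_inj[OF x(1)], of i j a] ij by auto
    qed auto
    have "(\<lambda>i. (x ^^ i) a) ` {..<8} \<subseteq> S"
      using that permutes_in_image[OF permutes_funpow[OF x(1)]] by auto
    then have "(\<lambda>i. (x ^^ i) a) ` {..<8} = S"
      using assms(2) fin inj by (intro card_subset_eq) (auto simp: card_image)
    with inj show ?thesis by (simp add: bij_betw_def)
  qed
qed

section \<open>Primitive groups of degree eight containing an 8-cycle\<close>

text \<open>Assuming \<open>H\<close> proper in the full symmetric group also rules out the
  alternating group, since an 8-cycle is odd.\<close>

locale primitive_8 = perm_group +
  fixes x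
  assumes card_S: "card S = 8"
    and prim: primitive
    and x: "x \<in> H" "eight_cycle S x"
    and proper: "H \<noteq> {p. p permutes S}"
begin

lemma odd_x: "\<not> evenperm x"
  using eight_cycle(1) x(2) card_S by blast

lemma evenperm_compose:
  "g \<in> H \<Longrightarrow> h \<in> H \<Longrightarrow> evenperm (g \<circ> h) \<longleftrightarrow> evenperm g = evenperm h"
  by (intro evenperm_comp permutation)

lemma evenperm_inverse: "h \<in> H \<Longrightarrow> evenperm (inv' h) \<longleftrightarrow> evenperm h"
  by (intro evenperm_inv permutation)

text \<open>A nontrivial element with so small a support forces all even permutations into
  \<open>H\<close>, and multiplying them by the odd \<open>x\<close> gives the odd ones as
  well.\<close>

lemma small_support:
  assumes "h \<in> H" "card (moved h) \<le> 3"
  shows "h = id"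
proof (rule ccontr)
  assume "h \<noteq> id"
  then have even: "p \<in> H" if "p permutes S" "evenperm p" for p
    using primitive_small_support[OF prim assms(1) _ assms(2)] that by blast
  have "p \<in> H" if p: "p permutes S" "\<not> evenperm p" for p
  proof -
    have "evenperm (p \<circ> inv' x)"
      using p odd_x permutation[OF x(1)] permutes_imp_permutation[OF finite_S p(1)]
      by (simp add: evenperm_comp evenperm_inv permutation_inverse del: comp_apply)
    moreover have "p \<circ> inv' x permutes S"
      using p(1) permutes[OF x(1)] by (simp add: permutes_compose permutes_inv)
    ultimately have "(p \<circ> inv' x) \<circ> x \<in> H"
      using even x(1) comp_closed by blast
    moreover have "(p \<circ> inv' x) \<circ> x = p"
      using x(1) by (auto simp: fun_eq_iff)
    ultimately show ?thesis by simp
  qed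
  then show False using even proper permutes by blast
qed

lemma card_moved: "h \<in> H \<Longrightarrow> card (fixed S h 1) + card (moved h) = 8"
proof -
  assume h: "h \<in> H"
  then have "moved h \<subseteq> S" using moved_subset permutes by blast
  moreover have "fixed S h 1 = S - moved h" by (auto simp: fixed_def moved_def)
  moreover have "card (moved h) \<le> 8"
    using card_mono[OF finite_S \<open>moved h \<subseteq> S\<close>] card_S by simp
  ultimately show ?thesis
    using card_S finite_S by (simp add: card_Diff_subset finite_subset)
qed

text \<open>If the support \<open>D\<close> of \<open>g\<close> met one of its translates \<open>x\<^sup>k D\<close> in a single point, the
  commutator of \<open>g\<close> and \<open>x\<^sup>k g x\<^sup>-\<^sup>k\<close> would have support at most 3.  This forces \<open>x\<^sup>4 D = D\<close>, also
  for the conjugates of \<open>g\<close>, so no image of \<open>D\<close> separates \<open>a\<close> from \<open>x\<^sup>4 a\<close>.\<close>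

lemma card_moved_neq_4:
  assumes g: "g \<in> H"
  shows "card (moved g) \<noteq> 4"
proof
  assume card4: "card (moved g) = 4"
  let ?D = "moved g"
  obtain a where a: "a \<in> S" using card_S by fastforce
  let ?f = "\<lambda>i. (x ^^ i) a"
  note bij_f = eight_cycle(3)[OF x(2) card_S a]
  have key: "a \<in> D \<Longrightarrow> (x ^^ 4) a \<in> D" "(x ^^ 4) a \<in> D \<Longrightarrow> a \<in> D"
    if D: "D = moved g'" "g' \<in> H" "card D = 4" for D g'
  proof -
    \<comment> \<open>The positions of \<open>D\<close> along the 8-cycle, counted from
      \<open>a\<close>. Applying \<open>x ^^ k\<close> to \<open>D\<close> becomes the shift by
      \<open>k\<close> modulo 8.\<close>
    define T where "T = {i \<in> {..<8}. ?f i \<in> D}"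
    have DS: "D \<subseteq> S" using D moved_subset permutes by blast
    have img: "?f ` T = D"
      using DS bij_f unfolding T_def bij_betw_def by blast
    have inj_f: "inj_on ?f T"
      using bij_f by (auto simp: T_def bij_betw_def inj_on_def)
    have cardT: "card T = 4"
      using card_image[OF inj_f] img D(3) by simp
    have per: "?f (i mod 8) = ?f i" for i
    proof -
      have "x ^^ i = x ^^ (8 * (i div 8) + i mod 8)" by simp
      also have "\<dots> = (x ^^ 8) ^^ (i div 8) \<circ> x ^^ (i mod 8)"
        unfolding funpow_add funpow_mult by simp
      finally show ?thesis unfolding eight_cycle(4)[OF x(2) card_S] id_funpow by simp
    qed
    have "card {i \<in> T. (i + (8 - k)) mod 8 \<in> T} \<noteq> 1" if k: "k \<in> {1, 2, 3}" for k
    proof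
      assume *: "card {i \<in> T. (i + (8 - k)) mod 8 \<in> T} = 1"
      have xk: "x ^^ k \<in> H" using funpow_closed x(1) by blast
      let ?h = "x ^^ k \<circ> g' \<circ> inv' (x ^^ k)"
      have h: "?h \<in> H" using conj_closed xk D(2) by blast
      have shift: "(x ^^ k) (?f (i + (8 - k))) = ?f i" for i
      proof -
        have "(x ^^ k) (?f (i + (8 - k))) = ?f (k + (i + (8 - k)))"
          by (simp add: funpow_add)
        also have "k + (i + (8 - k)) = i + 8" using k by auto
        also have "?f (i + 8) = ?f i" using per[of "i + 8"] per[of i] by simp
        finally show ?thesis .
      qed
      have mem: "?f i \<in> (x ^^ k) ` D \<longleftrightarrow> (i + (8 - k)) mod 8 \<in> T" for i
      proof -
        have "?f i \<in> (x ^^ k) ` D \<longleftrightarrow> ?f (i + (8 - k)) \<in> D"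
          using shift[of i] inj[OF xk] by (metis inj_image_mem_iff)
        also have "\<dots> \<longleftrightarrow> (i + (8 - k)) mod 8 \<in> T"
          by (simp add: T_def per)
        finally show ?thesis .
      qed
      have "?f ` {i \<in> T. (i + (8 - k)) mod 8 \<in> T} = D \<inter> (x ^^ k) ` D"
      proof -
        have "?f ` {i \<in> T. (i + (8 - k)) mod 8 \<in> T} = ?f ` {i \<in> T. ?f i \<in> (x ^^ k) ` D}"
          using mem by simp
        also have "\<dots> = ?f ` T \<inter> (x ^^ k) ` D" by auto
        finally show ?thesis using img by simp
      qed
      moreover have "moved ?h = (x ^^ k) ` D"
        using moved_conj[OF bij[OF xk]] D(1) by simp
      moreover have "card (?f ` {i \<in> T. (i + (8 - k)) mod 8 \<in> T}) = 1"
        by (subst card_image) (auto intro: inj_on_subset[OF inj_f] simp: * )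
      ultimately have "card (moved g' \<inter> moved ?h) = 1"
        using D(1) by simp
      then obtain b where b: "moved g' \<inter> moved ?h = {b}" by (auto simp: card_1_singleton_iff)
      let ?c = "g' \<circ> ?h \<circ> inv' g' \<circ> inv' ?h"
      have "moved ?c \<subseteq> {b, g' b, ?h b}" "?c \<noteq> id"
        using moved_commutator[OF bij[OF D(2)] bij[OF h] b] by blast+
      moreover have "card {b, g' b, ?h b} \<le> 3"
        by (simp add: card_insert_if)
      ultimately have "card (moved ?c) \<le> 3"
        by (meson card_mono finite.emptyI finite_insert order_trans)
      moreover have "?c \<in> H" using h D(2) xk by (intro comp_closed inv_closed)
      ultimately show False using small_support \<open>?c \<noteq> id\<close> by blast
    qed
    then have half: "(i + 4) mod 8 \<in> T" if "i \<in> T" for i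
      using half_turn_invariant[OF _ cardT _ that] by (auto simp: T_def)
    have "0 \<in> T \<longleftrightarrow> a \<in> D" "4 \<in> T \<longleftrightarrow> (x ^^ 4) a \<in> D" by (auto simp: T_def)
    with half[of 0] half[of 4] show "a \<in> D \<Longrightarrow> (x ^^ 4) a \<in> D" "(x ^^ 4) a \<in> D \<Longrightarrow> a \<in> D"
      by auto
  qed
  have "?D \<subseteq> S" using g moved_subset permutes by blast
  moreover have "?D \<noteq> {}" "?D \<noteq> S" using card4 card_S by auto
  moreover have "(x ^^ 4) a \<in> S" using a in_S_iff[OF funpow_closed[OF x(1)]] by blast
  moreover have "a \<noteq> (x ^^ 4) a" using eight_cycle(2)[OF x(2) card_S a, of 4] by auto
  ultimately obtain h where h: "h \<in> H" "a \<in> h ` ?D \<longleftrightarrow> (x ^^ 4) a \<notin> h ` ?D"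
    using primitive_separates[OF prim] a by metis
  have "h ` ?D = moved (h \<circ> g \<circ> inv' h)" "h \<circ> g \<circ> inv' h \<in> H"
    using moved_conj[OF bij[OF h(1)], of g] conj_closed[OF h(1) g] by auto
  moreover have "card (h ` ?D) = 4"
    using card4 inj[OF h(1)] by (metis card_image inj_on_subset subset_UNIV)
  ultimately show False using key h(2) by metis
qed

text \<open>The power \<open>h ^^ k\<close> lies in \<open>H\<close> too, and supports of size 1 to
  4 do not occur there.\<close>

lemma card_fixed:
  assumes h: "h \<in> H"
  shows "card (fixed S h k) = 8 \<or> card (fixed S h k) \<le> 3"
proof -
  have hk: "h ^^ k \<in> H" using funpow_closed h by blast
  have eq: "fixed S (h ^^ k) 1 = fixed S h k" by (simp add: fixed_def)
  show ?thesis
  proof (cases "card (moved (h ^^ k)) \<le> 3")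
    case True
    then show ?thesis
      using card_moved[OF hk] small_support[OF hk] eq by (auto simp: moved_def)
  next
    case False
    then show ?thesis
      using card_moved[OF hk] card_moved_neq_4[OF hk] eq by auto
  qed
qed

text \<open>Testing the powers 1 to 5 against \<open>card_fixed\<close> leaves only the odd types 8,
  6 + 1 + 1 and 2 + 2 + 2 + 1 + 1.\<close>

lemma card_fixed_odd:
  assumes h: "h \<in> H" "\<not> evenperm h"
  shows "card (fixed S h 1) = 0 \<or> card (fixed S h 1) = 2"
proof -
  show ?thesis
    using fixed_profile_8[OF permutes[OF h(1)] card_S]
    by (elim insertE emptyE)
      (use h(2) card_fixed[OF h(1), of 1] card_fixed[OF h(1), of 2] card_fixed[OF h(1), of 3]
        card_fixed[OF h(1), of 4] card_fixed[OF h(1), of 5] in simp_all)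
qed

text \<open>Such an element is even by \<open>card_fixed_odd\<close>, and the only even type with
  exactly three fixed points is 5 + 1 + 1 + 1.\<close>

lemma card_fixed_3:
  assumes h: "h \<in> H" "card (fixed S h 1) = 3"
  shows "h ^^ 5 = id"
proof -
  have "evenperm h" using card_fixed_odd[OF h(1)] h(2) by auto
  then have "card (fixed S h 5) = 8"
    using fixed_profile_8[OF permutes[OF h(1)] card_S]
    by (elim insertE emptyE) (use h(2) \<open>evenperm h\<close> in simp_all)
  then have "fixed S (h ^^ 5) 1 = S"
    using fixed_subset[of S h 5] card_S finite_S by (simp add: card_subset_eq fixed_def)
  then have "(h ^^ 5) i = i" for i
    using permutes_not_in[OF permutes[OF funpow_closed[OF h(1), of 5]]]
    by (cases "i \<in> S") (auto simp: fixed_def)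
  then show ?thesis by auto
qed

text \<open>The even elements form a normal subgroup, so their orbits are the classes of an
  invariant equivalence. It is not the diagonal because the square of \<open>x\<close> is even and
  moves every point of \<open>S\<close>.\<close>

lemma even_transitive:
  assumes "a \<in> S" "b \<in> S"
  obtains n where "n \<in> H" "evenperm n" "n a = b"
proof -
  obtain i where i: "i \<in> S" using card_S by fastforce
  have x2: "x \<circ> x \<in> H" "evenperm (x \<circ> x)" using x(1) comp_closed evenperm_compose by auto
  have ne: "i \<noteq> (x \<circ> x) i"
  proof -
    have "(x \<circ> x) i = (x ^^ 2) i" by (simp add: numeral_2_eq_2)
    then show ?thesis using eight_cycle(2)[OF x(2) card_S i, of 2] by auto
  qed
  let ?P = "\<lambda>a b. \<exists>n\<in>H. evenperm n \<and> n a = b"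
  have "?P a b"
  proof (rule primitive_full[OF prim, where P = ?P and i = i and j = "(x \<circ> x) i"])
    show "?P a a" for a using id_closed by (intro bexI[of _ id]) auto
    show "?P b a" if "?P a b" for a b
      using that inv_closed evenperm_inverse inv_apply by metis
    show "?P a c" if P: "?P a b" "?P b c" for a b c
    proof -
      obtain m n where "m \<in> H" "evenperm m" "m a = b" "n \<in> H" "evenperm n" "n b = c"
        using P by blast
      then show ?thesis
        using comp_closed[of n m] evenperm_compose[of n m] by (intro bexI[of _ "n \<circ> m"]) auto
    qed
    show "?P (h a) (h b)" if h: "h \<in> H" and P: "?P a b" for a b h
    proof -
      obtain n where n: "n \<in> H" "evenperm n" "n a = b" using P by blast
      then have "evenperm (h \<circ> n \<circ> inv' h)"
        using h by (simp add: evenperm_compose evenperm_inverse comp_closed inv_closed del: comp_apply)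
      then show ?thesis
        using conj_closed[OF h n(1)] h n by (intro bexI[of _ "h \<circ> n \<circ> inv' h"]) auto
    qed
    show "?P i ((x \<circ> x) i)" using x2 by blast
    show "(x \<circ> x) i \<in> S" using in_S_iff[OF x2(1)] i by blast
  qed (use i ne assms in auto)
  then show thesis using that by blast
qed

end

section \<open>Excluding three fixed points; bounds on the order and on the 8-cycles\<close>

context primitive_8
begin

text \<open>Since 5 is prime, every moved point has an orbit of length 5, which fills the
  support.\<close>

lemma funpow_5_orbit:
  assumes g: "g \<in> H" "card (fixed S g 1) = 3" and p: "p \<in> moved g"
  shows "bij_betw (\<lambda>k. (g ^^ k) p) {..<5} (moved g)"
proof -
  have g5: "(g ^^ 5) p = p" using card_fixed_3[OF g] by simp
  have perm: "permutation g" using permutation g(1) .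
  have "least_power g p dvd 5" using g5 least_power_dvd[OF perm] by blast
  moreover have "\<not> least_power g p dvd 1"
    using p least_power_dvd[OF perm, of p 1] by (simp add: moved_def)
  moreover have "d = 5" if "d dvd 5" "\<not> d dvd 1" for d :: nat
  proof -
    have "d \<le> 5" using that(1) by (auto dest: dvd_imp_le)
    then consider "d = 0" | "d = 1" | "d = 2" | "d = 3" | "d = 4" | "d = 5" by linarith
    then show ?thesis using that by cases simp_all
  qed
  ultimately have lp: "least_power g p = 5" by blast
  have inj_f: "inj_on (\<lambda>k. (g ^^ k) p) {..<5}"
  proof (intro linorder_inj_onI)
    fix i j :: nat assume ij: "i < j" "i \<in> {..<5}" "j \<in> {..<5}"
    have "(g ^^ (j - i)) p \<noteq> p"
      using least_power_dvd[OF perm, of p "j - i"] ij lp by (auto dest: dvd_imp_le)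
    then show "(g ^^ i) p \<noteq> (g ^^ j) p"
      using funpow_diff[OF inj[OF g(1)], of i j p] ij by auto
  qed auto
  have mem: "(g ^^ k) p \<in> moved g" for k
    using p by (induction k) (simp_all add: apply_in_moved_iff[OF inj[OF g(1)]])
  have "finite (moved g)" using moved_subset[OF permutes[OF g(1)]] finite_S finite_subset by blast
  moreover have "card (moved g) = 5" using card_moved[OF g(1)] g(2) by simp
  ultimately have "(\<lambda>k. (g ^^ k) p) ` {..<5} = moved g"
    using mem card_image[OF inj_f] by (intro card_subset_eq) auto
  with inj_f show ?thesis by (simp add: bij_betw_def)
qed

text \<open>For odd \<open>s\<close> fixing a fixed point of the 5-cycle \<open>g\<close>, each of the five odd permutations
  \<open>s\<inverse> g\<^sup>k\<close> has exactly two fixed points; counting the ten fixed points in another way leaves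
  only one possibility.\<close>

lemma odd_preserves_fixed:
  assumes g: "g \<in> H" "card (fixed S g 1) = 3"
    and s: "s \<in> H" "\<not> evenperm s" and t: "t \<in> fixed S g 1" "s t = t"
  shows "s ` fixed S g 1 = fixed S g 1"
proof -
  let ?T = "fixed S g 1" and ?D = "moved g"
  have T: "?T = S - ?D" by (auto simp: fixed_def moved_def)
  have DS: "?D \<subseteq> S" using moved_subset permutes g(1) by blast
  have cardD: "card ?D = 5" using card_moved[OF g(1)] g(2) by simp
  have finD: "finite ?D" "finite ?T" using DS finite_S finite_subset by auto
  have even_g: "evenperm g" using card_fixed_odd g by force
  have gT: "(g ^^ k) i = i" if "i \<in> ?T" for i k
    using that by (induction k) (auto simp: fixed_def)
  have "card {p \<in> S. s p = (g ^^ k) p} = 2" for k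
  proof -
    have gk: "g ^^ k \<in> H" using funpow_closed g(1) .
    have "evenperm (g ^^ k)"
    proof (induction k)
      case (Suc k)
      then show ?case
        using evenperm_compose[OF g(1) funpow_closed[OF g(1), of k]] even_g by (simp only: funpow.simps)
    qed (simp add: id_def)
    let ?u = "inv' s \<circ> g ^^ k"
    have u: "?u \<in> H" using comp_closed inv_closed gk s(1) by blast
    have "\<not> evenperm ?u"
      using evenperm_compose[OF inv_closed[OF s(1)] gk] evenperm_inverse[OF s(1)] s(2) \<open>evenperm (g ^^ k)\<close>
      by simp
    then have "card (fixed S ?u 1) = 0 \<or> card (fixed S ?u 1) = 2"
      using card_fixed_odd u by blast
    moreover have eq: "fixed S ?u 1 = {p \<in> S. s p = (g ^^ k) p}"
    proof -
      have "inv' s (g' p) = p \<longleftrightarrow> s p = g' p" for g' :: "'a \<Rightarrow> 'a" and p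
        using inv_apply[OF s(1)] by metis
      then show ?thesis by (simp add: fixed_def)
    qed
    moreover have "t \<in> {p \<in> S. s p = (g ^^ k) p}"
      using t gT[OF t(1)] by (simp add: fixed_def)
    ultimately show ?thesis
      using finite_S by (auto simp: card_eq_0_iff)
  qed
  then have "(\<Sum>k<5. card {p \<in> S. s p = (g ^^ k) p}) = 10" by simp
  moreover have "(\<Sum>k<5. card {p \<in> S. s p = (g ^^ k) p})
      = (\<Sum>k\<in>{..<5}. \<Sum>p\<in>S. if s p = (g ^^ k) p then 1 else 0)"
    using finite_S by (simp add: sum.If_cases Int_def)
  moreover have "\<dots> = (\<Sum>p\<in>S. \<Sum>k\<in>{..<5}. if s p = (g ^^ k) p then 1 else 0)"
    by (rule sum.swap)
  moreover have "\<dots> = (\<Sum>p\<in>?T. \<Sum>k\<in>{..<5}. if s p = (g ^^ k) p then 1 else 0)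
        + (\<Sum>p\<in>?D. \<Sum>k\<in>{..<5}. if s p = (g ^^ k) p then 1 else 0)"
    unfolding T using DS finite_S by (metis (no_types, lifting) sum.subset_diff)
  \<comment> \<open>All powers of \<open>g\<close> agree on \<open>?T\<close>, so a point there
    counts five times or not at all. On \<open>?D\<close> the powers of \<open>g\<close> reach each
    point of \<open>?D\<close> exactly once, so a point counts once if \<open>s\<close> keeps it in
    \<open>?D\<close>.\<close>
  moreover have "(\<Sum>p\<in>?T. \<Sum>k\<in>{..<5::nat}. if s p = (g ^^ k) p then 1 else (0::nat))
      = (\<Sum>p\<in>?T. if s p = p then 5 else 0)"
    using gT by (intro sum.cong) auto
  moreover have "(\<Sum>p\<in>?D. \<Sum>k\<in>{..<5::nat}. if s p = (g ^^ k) p then 1 else (0::nat))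
      = (\<Sum>p\<in>?D. if s p \<in> ?D then 1 else 0)"
  proof (intro sum.cong refl)
    fix p assume p: "p \<in> ?D"
    note bij_p = funpow_5_orbit[OF g p]
    have "(\<Sum>k\<in>{..<5::nat}. if s p = (g ^^ k) p then 1 else (0::nat))
        = (\<Sum>q\<in>?D. if s p = q then 1 else 0)"
      by (rule sum.reindex_bij_betw[OF bij_p, of "\<lambda>q. if s p = q then 1 else 0"])
    also have "\<dots> = (if s p \<in> ?D then 1 else 0)"
      using finD by simp
    finally show "(\<Sum>k\<in>{..<5::nat}. if s p = (g ^^ k) p then 1 else (0::nat))
        = (if s p \<in> ?D then 1 else 0)" .
  qed
  moreover have "(\<Sum>p\<in>?T. if s p = p then 5 else 0) = 5 * card {p \<in> ?T. s p = p}"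
    using finD by (simp add: sum.If_cases Int_def)
  moreover have "(\<Sum>p\<in>?D. if s p \<in> ?D then 1 else 0) = card {p \<in> ?D. s p \<in> ?D}"
    using finD by (simp add: sum.If_cases Int_def)
  ultimately have eq: "5 * card {p \<in> ?T. s p = p} + card {p \<in> ?D. s p \<in> ?D} = 10"
    by linarith
  have "{p \<in> ?T. s p = p} \<noteq> {}" using t by auto
  then have ge1: "card {p \<in> ?T. s p = p} \<ge> 1"
    using finD(2) by (simp add: Suc_le_eq card_gt_0_iff)
  have "card {p \<in> ?D. s p \<notin> ?D} \<le> card ?T"
  proof (rule card_inj_on_le[where f = s])
    show "s ` {p \<in> ?D. s p \<notin> ?D} \<subseteq> ?T"
      unfolding T using DS in_S_iff[OF s(1)] by auto
  qed (use inj[OF s(1)] finD in \<open>auto intro: inj_on_subset\<close>)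
  moreover have "card {p \<in> ?D. s p \<in> ?D} + card {p \<in> ?D. s p \<notin> ?D} = card ?D"
  proof -
    have "card ({p \<in> ?D. s p \<in> ?D} \<union> {p \<in> ?D. s p \<notin> ?D}) = card {p \<in> ?D. s p \<in> ?D} + card {p \<in> ?D. s p \<notin> ?D}"
      using finD by (intro card_Un_disjoint) auto
    moreover have "{p \<in> ?D. s p \<in> ?D} \<union> {p \<in> ?D. s p \<notin> ?D} = ?D" by auto
    ultimately show ?thesis by simp
  qed
  ultimately have "card {p \<in> ?D. s p \<in> ?D} \<ge> 2" using cardD g(2) by linarith
  \<comment> \<open>With f points of \<open>?T\<close> fixed by \<open>s\<close> and d points kept
    in \<open>?D\<close>, the conditions 5 f + d = 10, f >= 1 and 2 <= d <= 5 leave only f = 1 and d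
    = 5.\<close>
  then have "card {p \<in> ?D. s p \<in> ?D} = card ?D" using eq ge1 cardD by presburger
  then have "{p \<in> ?D. s p \<in> ?D} = ?D"
    using finD by (intro card_subset_eq) auto
  then have "s ` ?D \<subseteq> ?D" by auto
  then have "s ` ?D = ?D"
    using card_image[OF inj_on_subset[OF inj[OF s(1)] subset_UNIV], of ?D] finD card_subset_eq by metis
  then show ?thesis
    unfolding T using image_set_diff[OF inj[OF s(1)], of S ?D] permutes_image[OF permutes[OF s(1)]] by simp
qed

text \<open>The fixed point set of a 5-cycle in \<open>H\<close> would be a block: elements fixing
  one of its points preserve it, and hence every image that meets it coincides with it. Then no
  image separates two of its points, against primitivity.\<close>

lemma card_fixed_neq_3:
  assumes g: "g \<in> H"
  shows "card (fixed S g 1) \<noteq> 3"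
proof
  assume card3: "card (fixed S g 1) = 3"
  let ?T = "fixed S g 1" and ?D = "moved g"
  have T: "?T = S - ?D" by (auto simp: fixed_def moved_def)
  have DS: "?D \<subseteq> S" using moved_subset permutes g by blast
  have cardD: "card ?D = 5" using card_moved[OF g] card3 by simp
  have stab: "h ` ?T = ?T" if h: "h \<in> H" and t: "t \<in> ?T" "h t = t" for h t
  proof (cases "evenperm h")
    case True
    have tS: "t \<in> S" using t by (simp add: fixed_def)
    then have "x t \<in> S" using in_S_iff x(1) by blast
    then obtain n where n: "n \<in> H" "evenperm n" "n (x t) = t"
      using even_transitive tS by blast
    \<comment> \<open>An odd element fixing \<open>t\<close>. Multiplying the even \<open>h\<close>
      by it reduces to the odd case twice, for \<open>h \<circ> s\<close> and for
      \<open>s\<close>.\<close>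
    define s where "s = n \<circ> x"
    have s: "s \<in> H" "\<not> evenperm s" "s t = t"
      using n x(1) comp_closed evenperm_compose[OF n(1) x(1)] odd_x by (auto simp: s_def simp del: comp_apply) (simp add: n)
    have hs: "h \<circ> s \<in> H" "\<not> evenperm (h \<circ> s)" "(h \<circ> s) t = t"
      using s h True t comp_closed evenperm_compose[OF h s(1)] by (auto simp del: comp_apply) (simp add: s t)
    have "h ` s ` ?T = ?T" using odd_preserves_fixed[OF g card3 hs(1,2) t(1) hs(3)] by (simp add: image_image)
    then show ?thesis using odd_preserves_fixed[OF g card3 s(1,2) t(1) s(3)] by simp
  qed (use odd_preserves_fixed[OF g card3 h _ t] in blast)
  have block: "h ` ?T = ?T" if h: "h \<in> H" and t: "t \<in> ?T" "t \<in> h ` ?T" for h t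
  proof -
    obtain r where r: "r \<in> ?T" "t = h r" using t by blast
    \<comment> \<open>Conjugated back by \<open>h\<close>, the 5-cycle \<open>g\<close> fixes the
      point \<open>r\<close>, so it preserves \<open>?T\<close>. The image of \<open>?T\<close>
      under \<open>h\<close> is thus a union of orbits of \<open>g\<close>; having three points, it
      cannot contain the orbit \<open>?D\<close>.\<close>
    have inv: "g ` h ` ?T = h ` ?T"
    proof -
      let ?u = "inv' h \<circ> g \<circ> h"
      have "?u \<in> H" using h g comp_closed inv_closed by blast
      moreover have "?u r = r" using r t h by (simp add: fixed_def)
      ultimately have "?u ` ?T = ?T" using stab r by blast
      then have "h ` ?u ` ?T = h ` ?T" by simp
      then show ?thesis using h by (simp add: image_image)
    qed
    have powinv: "(g ^^ k) p \<in> h ` ?T" if "p \<in> h ` ?T" for k p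
      using that inv by (induction k) auto
    have cardhT: "card (h ` ?T) = 3"
      using card3 inj[OF h] by (metis card_image inj_on_subset subset_UNIV)
    have "h ` ?T \<inter> ?D = {}"
    proof (rule ccontr)
      assume "h ` ?T \<inter> ?D \<noteq> {}"
      then obtain p where p: "p \<in> h ` ?T" "p \<in> ?D" by blast
      have "?D = (\<lambda>k. (g ^^ k) p) ` {..<5}"
        using funpow_5_orbit[OF g card3 p(2)] by (simp add: bij_betw_def)
      then have "?D \<subseteq> h ` ?T" using powinv[OF p(1)] by auto
      then have "card ?D \<le> card (h ` ?T)" using finite_S by (intro card_mono) auto
      then show False using cardD cardhT by simp
    qed
    moreover have "h ` ?T \<subseteq> S" using in_S_iff[OF h] by (auto simp: fixed_def)
    ultimately have "h ` ?T \<subseteq> ?T" unfolding T by blast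
    then show ?thesis using cardhT card3 finite_S by (intro card_subset_eq) auto
  qed
  obtain a b where ab: "a \<in> ?T" "b \<in> ?T" "a \<noteq> b"
    using card3 by (auto simp: card_3_iff)
  have "?T \<subseteq> S" by (rule fixed_subset)
  moreover have "?T \<noteq> {}" "?T \<noteq> S" using card3 card_S by auto
  moreover have "a \<in> S" "b \<in> S" using ab by (auto simp: fixed_def)
  ultimately obtain h where h: "h \<in> H" "a \<in> h ` ?T \<longleftrightarrow> b \<notin> h ` ?T"
    using primitive_separates[OF prim] ab(3) by metis
  then show False using block[OF h(1)] ab by blast
qed

text \<open>The quotient of the two elements has at least three fixed points, which now forces the
  identity.\<close>

lemma eq_if_agree_on_3:
  assumes "g \<in> H" "h \<in> H" "A \<subseteq> S" "card A = 3" "\<And>a. a \<in> A \<Longrightarrow> g a = h a"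
  shows "g = h"
proof -
  let ?u = "inv' g \<circ> h"
  have u: "?u \<in> H" using assms comp_closed inv_closed by blast
  have "A \<subseteq> fixed S ?u 1"
    using assms by (auto simp: fixed_def) (metis inv_apply(1) assms(1))
  then have "3 \<le> card (fixed S ?u 1)"
    using assms(4) finite_S by (metis card_mono finite_fixed)
  then have "card (fixed S ?u 1) = 8"
    using card_fixed[OF u, of 1] card_fixed_neq_3[OF u] by linarith
  then have "?u = id" using small_support[OF u] card_moved[OF u] by simp
  then have "g \<circ> ?u = g" by simp
  moreover have "g \<circ> ?u = h" using assms(1) by (auto simp: fun_eq_iff)
  ultimately show ?thesis by simp
qed

text \<open>An element is determined by the images of three points, and there are 8 * 7 * 6 = 336
  triples of distinct images.\<close>

lemma card_H_le: "card H \<le> 336"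
proof -
  obtain A where A: "A \<subseteq> S" "card A = 3"
    by (rule obtain_subset_with_card_n[of 3 S]) (use card_S in auto)
  from A(2) obtain a b c where abc: "A = {a, b, c}" "a \<noteq> b" "b \<noteq> c" "a \<noteq> c"
    unfolding card_3_iff by blast
  let ?B = "{xs. length xs = 3 \<and> distinct xs \<and> set xs \<subseteq> S}"
  have B: "card ?B = 336"
    using card_lists_distinct_length_eq[OF finite_S, of 3] card_S by (simp add: numeral_eq_Suc)
  have "card H \<le> card ?B"
  proof (rule card_inj_on_le[where f = "\<lambda>h. map h [a, b, c]"])
    show "inj_on (\<lambda>h. map h [a, b, c]) H"
      using eq_if_agree_on_3[OF _ _ A] abc(1) by (auto simp: inj_on_def)
    show "(\<lambda>h. map h [a, b, c]) ` H \<subseteq> ?B"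
      using abc A(1) in_S_iff inj by (auto simp: inj_eq)
    show "finite ?B" using B by (intro card_ge_0_finite) simp
  qed
  then show ?thesis using B by simp
qed

text \<open>The fixed points of the odd elements average to one by transitivity of the even ones, but
  an odd element has at most two and an 8-cycle has none.\<close>

lemma card_eight_cycles_le: "card {h \<in> H. eight_cycle S h} \<le> 84"
proof -
  define Od where "Od = {h \<in> H. \<not> evenperm h}"
  define X where "X = {h \<in> H. eight_cycle S h}"
  have fin: "finite Od" "finite X" using finite_H by (auto simp: Od_def X_def)
  have XO: "X \<subseteq> Od" using eight_cycle(1) card_S by (auto simp: Od_def X_def)
  have cardO: "card Od \<le> 168"
  proof -
    have "card Od \<le> card (H - Od)"
    \<comment> \<open>Right multiplication by the odd \<open>x\<close> injects the odd elements into
      the even ones, so they make up at most half of \<open>H\<close>.\<close>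
    proof (rule card_inj_on_le[where f = "\<lambda>h. h \<circ> x"])
      show "inj_on (\<lambda>h. h \<circ> x) Od"
      proof (rule inj_onI)
        fix g h assume eq: "g \<circ> x = h \<circ> x"
        have "g i = h i" for i
          using fun_cong[OF eq, of "inv' x i"] x(1) by simp
        then show "g = h" by blast
      qed
      show "(\<lambda>h. h \<circ> x) ` Od \<subseteq> H - Od"
        using evenperm_compose[OF _ x(1)] odd_x comp_closed x(1) by (auto simp: Od_def simp del: comp_apply)
    qed (use finite_H in auto)
    moreover have "card (H - Od) = card H - card Od"
      using fin by (intro card_Diff_subset) (auto simp: Od_def)
    ultimately show ?thesis using card_H_le by linarith
  qed
  have same: "card {h \<in> Od. h p = q} = card {h \<in> Od. h p = p}" if pq: "p \<in> S" "q \<in> S" for p q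
  proof -
    obtain n where n: "n \<in> H" "evenperm n" "n p = q" using even_transitive pq by blast
    have "bij_betw (\<lambda>h. n \<circ> h) {h \<in> Od. h p = p} {h \<in> Od. h p = q}"
    proof (rule bij_betwI[where g = "\<lambda>h. inv' n \<circ> h"])
      show "(\<circ>) n \<in> {h \<in> Od. h p = p} \<rightarrow> {h \<in> Od. h p = q}"
        using n comp_closed evenperm_compose[OF n(1)] by (auto simp: Od_def)
      show "(\<circ>) (inv' n) \<in> {h \<in> Od. h p = q} \<rightarrow> {h \<in> Od. h p = p}"
        using n comp_closed[OF inv_closed[OF n(1)]] evenperm_compose[OF inv_closed[OF n(1)]] evenperm_inverse[OF n(1)]
        by (auto simp: Od_def)
    qed (use n in \<open>auto simp: fun_eq_iff\<close>)
    from bij_betw_same_card[OF this] show ?thesis by simp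
  qed
  have "card {h \<in> Od. h p = p} * 8 = (\<Sum>q\<in>S. card {h \<in> Od. h p = q})" if "p \<in> S" for p
  proof -
    have "(\<Sum>q\<in>S. card {h \<in> Od. h p = q}) = (\<Sum>q\<in>S. card {h \<in> Od. h p = p})"
      by (rule sum.cong[OF refl]) (rule same[OF that])
    then show ?thesis using card_S by simp
  qed
  moreover have "(\<Sum>q\<in>S. card {h \<in> Od. h p = q}) = card Od" if "p \<in> S" for p
  proof -
    have "card (\<Union>q\<in>S. {h \<in> Od. h p = q}) = (\<Sum>q\<in>S. card {h \<in> Od. h p = q})"
      using finite_S fin by (intro card_UN_disjoint) auto
    moreover have "(\<Union>q\<in>S. {h \<in> Od. h p = q}) = Od"
      using that in_S_iff by (auto simp: Od_def)
    ultimately show ?thesis by simp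
  qed
  ultimately have "card {h \<in> Od. h p = p} * 8 = card Od" if "p \<in> S" for p
    using that by simp
  then have "(\<Sum>p\<in>S. card {h \<in> Od. h p = p}) * 8 = (\<Sum>p\<in>S. card Od)"
    by (simp add: sum_distrib_right)
  then have "card Od = (\<Sum>p\<in>S. card {h \<in> Od. h p = p})"
    using card_S by simp
  also have "\<dots> = (\<Sum>p\<in>S. \<Sum>h\<in>Od. if h p = p then 1 else 0)"
    using fin by (simp add: sum.If_cases Int_def)
  also have "\<dots> = (\<Sum>h\<in>Od. \<Sum>p\<in>S. if h p = p then 1 else 0)"
    by (rule sum.swap)
  also have "\<dots> = (\<Sum>h\<in>Od. card (fixed S h 1))"
    using finite_S by (simp add: sum.If_cases Int_def fixed_def)
  also have "\<dots> = (\<Sum>h\<in>Od - X. card (fixed S h 1)) + (\<Sum>h\<in>X. card (fixed S h 1))"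
    using XO fin by (metis sum.subset_diff)
  also have "(\<Sum>h\<in>X. card (fixed S h 1)) = 0"
  proof (rule sum.neutral, rule)
    fix h assume "h \<in> X"
    then have "fixed S h 1 = {}" using eight_cycle(2)[of S h _ 1] card_S by (auto simp: X_def fixed_def)
    then show "card (fixed S h 1) = 0" by simp
  qed
  also have "(\<Sum>h\<in>Od - X. card (fixed S h 1)) \<le> (\<Sum>h\<in>Od - X. 2)"
    using card_fixed_odd by (intro sum_mono) (force simp: Od_def)
  also have "\<dots> = 2 * (card Od - card X)"
    using XO fin by (simp add: card_Diff_subset)
  \<comment> \<open>The chain bounds the number of odd elements by twice the number of those that
    are not 8-cycles. Hence at most half of the at most 168 odd elements are 8-cycles.\<close>
  finally have "card X \<le> 84" using cardO card_mono[OF fin(1) XO] by linarith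
  then show ?thesis by (simp add: X_def)
qed

end

section \<open>Double counting over conjugacy-invariant sets\<close>

lemma funpow_conj:
  assumes "bij g"
  shows "(g \<circ> p \<circ> inv' g) ^^ k = g \<circ> p ^^ k \<circ> inv' g"
proof (induction k)
  case 0
  then show ?case using assms by (auto simp: fun_eq_iff bij_is_surj surj_f_inv_f)
next
  case (Suc k)
  then show ?case using assms by (auto simp: fun_eq_iff bij_is_inj)
qed

lemma fixed_conj:
  assumes "g permutes S"
  shows "fixed S (g \<circ> p \<circ> inv' g) k = g ` fixed S p k"
proof -
  note g = permutes_bij[OF assms]
  have "(g \<circ> p \<circ> inv' g) ^^ k = g \<circ> p ^^ k \<circ> inv' g" by (rule funpow_conj[OF g])
  then have *: "((g \<circ> p \<circ> inv' g) ^^ k) i = i \<longleftrightarrow> (p ^^ k) (inv' g i) = inv' g i" for i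
    using g by (metis bij_inv_eq_iff comp_apply)
  show ?thesis
  proof (rule Set.set_eqI, rule iffI)
    fix i assume "i \<in> fixed S (g \<circ> p \<circ> inv' g) k"
    then have "inv' g i \<in> fixed S p k"
      using * permutes_in_image[OF permutes_inv[OF assms]] by (simp add: fixed_def)
    then show "i \<in> g ` fixed S p k"
      using permutes_inverses(1)[OF assms] by (metis imageI)
  next
    fix i assume "i \<in> g ` fixed S p k"
    then show "i \<in> fixed S (g \<circ> p \<circ> inv' g) k"
      using * permutes_in_image[OF assms] permutes_inverses(2)[OF assms] by (auto simp: fixed_def)
  qed
qed

lemma card_fixed_conj:
  assumes "g permutes S"
  shows "card (fixed S (g \<circ> p \<circ> inv' g) k) = card (fixed S p k)"
  unfolding fixed_conj[OF assms] by (rule card_image) (rule permutes_inj_on[OF assms])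

text \<open>These are the unions of conjugacy classes of the symmetric group on
  \<open>S\<close>.\<close>

definition conj_invariant :: "'a set \<Rightarrow> ('a \<Rightarrow> 'a) set \<Rightarrow> bool"
  where "conj_invariant S X \<longleftrightarrow> X \<subseteq> {p. p permutes S} \<and>
    (\<forall>g p. g permutes S \<longrightarrow> p \<in> X \<longrightarrow> g \<circ> p \<circ> inv' g \<in> X)"

lemma conj_permutes: "g permutes S \<Longrightarrow> p permutes S \<Longrightarrow> g \<circ> p \<circ> inv' g permutes S"
  by (intro permutes_compose permutes_inv)

lemma conj_cancel:
  assumes "g permutes S"
  shows "g \<circ> (inv' g \<circ> p \<circ> g) \<circ> inv' g = p" "inv' g \<circ> (g \<circ> p \<circ> inv' g) \<circ> g = p"
  using permutes_inverses[OF assms] by (auto simp: fun_eq_iff)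

lemma card_conj_invariant:
  assumes "conj_invariant S X" "g permutes S"
    and "\<And>p. p \<in> X \<Longrightarrow> Q (g \<circ> p \<circ> inv' g) \<longleftrightarrow> P p"
  shows "card {p \<in> X. Q p} = card {p \<in> X. P p}"
proof -
  have inv2: "inv' (inv' g) = g" using permutes_inv_inv[OF assms(2)] .
  have conj_X: "inv' g \<circ> p \<circ> g \<in> X" if "p \<in> X" for p
    using assms(1) permutes_inv[OF assms(2)] that inv2 unfolding conj_invariant_def by metis
  have "bij_betw (\<lambda>p. g \<circ> p \<circ> inv' g) {p \<in> X. P p} {p \<in> X. Q p}"
  proof (rule bij_betwI[where g = "\<lambda>p. inv' g \<circ> p \<circ> g"])
    show "(\<lambda>p. g \<circ> p \<circ> inv' g) \<in> {p \<in> X. P p} \<rightarrow> {p \<in> X. Q p}"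
      using assms by (simp add: conj_invariant_def)
    show "(\<lambda>p. inv' g \<circ> p \<circ> g) \<in> {p \<in> X. Q p} \<rightarrow> {p \<in> X. P p}"
      using conj_X assms(3) conj_cancel(1)[OF assms(2)] by (simp add: Pi_iff) metis
  qed (simp_all only: conj_cancel[OF assms(2)])
  from bij_betw_same_card[OF this] show ?thesis by simp
qed

lemma double_count:
  assumes "finite X" "finite Y"
    and "\<And>y. y \<in> Y \<Longrightarrow> card {p \<in> X. I p y} = n"
    and "\<And>p. p \<in> X \<Longrightarrow> card {y \<in> Y. I p y} \<le> m"
  shows "n * card Y \<le> m * card X"
proof -
  have "n * card Y = (\<Sum>y\<in>Y. card {p \<in> X. I p y})" using assms(3) by simp
  also have "\<dots> = (\<Sum>y\<in>Y. \<Sum>p\<in>X. if I p y then 1 else 0)"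
    using assms(1) by (simp add: sum.If_cases Int_def)
  also have "\<dots> = (\<Sum>p\<in>X. \<Sum>y\<in>Y. if I p y then 1 else 0)" by (rule sum.swap)
  also have "\<dots> = (\<Sum>p\<in>X. card {y \<in> Y. I p y})"
    using assms(2) by (simp add: sum.If_cases Int_def)
  also have "\<dots> \<le> (\<Sum>p\<in>X. m)" using assms(4) by (intro sum_mono)
  finally show ?thesis by (simp add: mult.commute)
qed

lemma permutes_subset_to_subset:
  assumes "finite S" "A \<subseteq> S" "B \<subseteq> S" "card A = card B"
  obtains g where "g permutes S" "g ` A = B"
proof -
  have fin: "finite A" "finite B" using assms finite_subset by auto
  obtain f where f: "bij_betw f A B"
    using finite_same_card_bij[OF fin assms(4)] by blast
  have "card (S - A) = card (S - B)" using assms fin by (simp add: card_Diff_subset)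
  then obtain h where h: "bij_betw h (S - A) (S - B)"
    using finite_same_card_bij[of "S - A" "S - B"] assms(1) by auto
  define g where "g = (\<lambda>i. if i \<in> A then f i else if i \<in> S then h i else i)"
  have "bij_betw g A B" using f by (subst bij_betw_cong[of A g f]) (auto simp: g_def)
  moreover have "bij_betw g (S - A) (S - B)"
    using h by (subst bij_betw_cong[of "S - A" g h]) (auto simp: g_def)
  ultimately have "bij_betw g (A \<union> (S - A)) (B \<union> (S - B))"
    by (rule bij_betw_combine) auto
  then have "bij_betw g S S" using assms(2,3) by (simp add: Un_absorb1 Un_Diff_cancel)
  then have "g permutes S" by (rule bij_imp_permutes) (use assms(2) in \<open>auto simp: g_def\<close>)
  moreover have "g ` A = B" using \<open>bij_betw g A B\<close> by (simp add: bij_betw_def)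
  ultimately show thesis using that by blast
qed

text \<open>The symmetric group is transitive on \<open>k\<close>-subsets, so each of them is
  incident with equally many elements of \<open>X\<close>; counting incidences gives the bound. The
  incidence \<open>I\<close> is left abstract to cover both stabilizers of sets and stabilizers of
  partitions 4 + 4.\<close>

lemma card_class_subset_le:
  assumes S: "finite S" and X: "conj_invariant S X" and A: "A \<subseteq> S" "card A = k"
    and equi: "\<And>g p B. g permutes S \<Longrightarrow> B \<subseteq> S \<Longrightarrow> I (g \<circ> p \<circ> inv' g) (g ` B) \<longleftrightarrow> I p B"
    and m: "\<And>p. p \<in> X \<Longrightarrow> card {B. B \<subseteq> S \<and> card B = k \<and> I p B} \<le> m"
  shows "card {p \<in> X. I p A} * (card S choose k) \<le> m * card X"
proof -
  let ?Y = "{B. B \<subseteq> S \<and> card B = k}"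
  have "finite X" using X finite_permutations[OF S] finite_subset by (auto simp: conj_invariant_def)
  moreover have "finite ?Y" using S by simp
  moreover have "card {p \<in> X. I p B} = card {p \<in> X. I p A}" if B: "B \<in> ?Y" for B
  proof -
    obtain g where g: "g permutes S" "g ` A = B"
      using permutes_subset_to_subset[OF S A(1), of B] B A(2) by auto
    show ?thesis
      by (rule card_conj_invariant[OF X g(1)]) (use equi[OF g(1) A(1)] g(2) in blast)
  qed
  moreover have "card {B \<in> ?Y. I p B} \<le> m" if "p \<in> X" for p
    using m[OF that] by (simp add: conj_assoc)
  ultimately have "card {p \<in> X. I p A} * card ?Y \<le> m * card X"
    by (rule double_count)
  then show ?thesis using n_subsets[OF S] by simp
qed

lemma image_conj:
  assumes "g permutes S"
  shows "(g \<circ> p \<circ> inv' g) ` (g ` B) = g ` C \<longleftrightarrow> p ` B = C"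
proof -
  have "(g \<circ> p \<circ> inv' g) ` (g ` B) = g ` (p ` B)"
    using permutes_inverses(2)[OF assms] by (simp add: image_image)
  then show ?thesis using inj_image_eq_iff[OF permutes_inj[OF assms]] by metis
qed

lemma card_class_stabilizer_le:
  assumes S: "finite S" and X: "conj_invariant S X" and A: "A \<subseteq> S" "card A = k"
    and m: "\<And>p. p \<in> X \<Longrightarrow> card {B. B \<subseteq> S \<and> card B = k \<and> p ` B = B} \<le> m"
  shows "card {p \<in> X. p ` A = A} * (card S choose k) \<le> m * card X"
  by (rule card_class_subset_le[OF S X A _ m]) (rule image_conj)

text \<open>Halves are counted instead of partitions. For \<open>k = 4\<close> in eight points this
  doubles both sides: 70 halves, two for each invariant partition.\<close>

lemma card_class_bisection_le:
  assumes S: "finite S" and X: "conj_invariant S X" and A: "A \<subseteq> S" "card A = k"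
    and m: "\<And>p. p \<in> X \<Longrightarrow> card {B. B \<subseteq> S \<and> card B = k \<and> (p ` B = B \<or> p ` B = S - B)} \<le> m"
  shows "card {p \<in> X. p ` A = A \<or> p ` A = S - A} * (card S choose k) \<le> m * card X"
proof (rule card_class_subset_le[OF S X A _ m])
  fix g p B assume g: "g permutes S" and "B \<subseteq> S"
  have "S - g ` B = g ` (S - B)"
    using image_set_diff[OF permutes_inj[OF g]] permutes_image[OF g] by metis
  then show "((g \<circ> p \<circ> inv' g) ` g ` B = g ` B \<or> (g \<circ> p \<circ> inv' g) ` g ` B = S - g ` B)
      \<longleftrightarrow> (p ` B = B \<or> p ` B = S - B)"
    using image_conj[OF g] by metis
qed

text \<open>A partition into pairs, encoded as the fixed-point-free involution that exchanges the
  members of each pair. Preserving the partition then means commuting with the involution.\<close>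

definition matching :: "'a set \<Rightarrow> ('a \<Rightarrow> 'a) \<Rightarrow> bool"
  where "matching S y \<longleftrightarrow> y permutes S \<and> y \<circ> y = id \<and> (\<forall>i\<in>S. y i \<noteq> i)"

lemma matching_apply: "matching S y \<Longrightarrow> y (y i) = i"
  by (metis comp_apply id_apply matching_def)

lemma matching_conj:
  assumes "matching S y" "g permutes S"
  shows "matching S (g \<circ> y \<circ> inv' g)"
proof -
  have "g \<circ> y \<circ> inv' g \<circ> (g \<circ> y \<circ> inv' g) = id"
    using matching_apply[OF assms(1)] permutes_inverses[OF assms(2)] by (auto simp: fun_eq_iff)
  moreover have "(g \<circ> y \<circ> inv' g) i \<noteq> i" if "i \<in> S" for i
  proof -
    have "inv' g i \<in> S" using permutes_in_image[OF permutes_inv[OF assms(2)]] that by blast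
    then have "y (inv' g i) \<noteq> inv' g i" using assms(1) by (simp add: matching_def)
    then show ?thesis using permutes_inverses[OF assms(2)] by (metis comp_apply)
  qed
  ultimately show ?thesis
    using assms conj_permutes by (auto simp: matching_def)
qed

lemma matching_insert_pair:
  assumes "matching S z" "finite A" "A \<subseteq> S" "z ` A \<subseteq> A" "j \<in> S - A"
  shows "card (insert j (insert (z j) A)) = card A + 2"
    and "insert j (insert (z j) A) \<subseteq> S"
    and "z ` insert j (insert (z j) A) \<subseteq> insert j (insert (z j) A)"
proof -
  have "z j \<noteq> j" "z j \<in> S"
    using assms(1,5) permutes_in_image by (fastforce simp: matching_def)+
  moreover have "z j \<notin> A"
  proof
    assume "z j \<in> A"
    then have "z (z j) \<in> A" using assms(4) by blast
    then show False using matching_apply[OF assms(1)] assms(5) by simp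
  qed
  ultimately show "card (insert j (insert (z j) A)) = card A + 2"
    "insert j (insert (z j) A) \<subseteq> S"
    "z ` insert j (insert (z j) A) \<subseteq> insert j (insert (z j) A)"
    using assms matching_apply[OF assms(1)] by simp_all blast+
qed

lemma matching_pairs:
  assumes S: "finite S" and z: "matching S z"
    and "i \<in> S" "j \<in> S - {i, z i}" "k \<in> S - {j, z j, i, z i}" "l \<in> S - {k, z k, j, z j, i, z i}"
  shows "card {i, z i} = 2" "{i, z i} \<subseteq> S"
    and "card {j, z j, i, z i} = 4" "{j, z j, i, z i} \<subseteq> S"
    and "card {k, z k, j, z j, i, z i} = 6" "{k, z k, j, z j, i, z i} \<subseteq> S"
    and "card {l, z l, k, z k, j, z j, i, z i} = 8" "{l, z l, k, z k, j, z j, i, z i} \<subseteq> S"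
proof -
  have i: "i \<in> S - {}" using assms(3) by simp
  have 1: "card {i, z i} = 2" "{i, z i} \<subseteq> S" "z ` {i, z i} \<subseteq> {i, z i}"
    using matching_insert_pair[OF z finite.emptyI empty_subsetI _ i] by auto
  have 2: "card {j, z j, i, z i} = 4" "{j, z j, i, z i} \<subseteq> S"
      "z ` {j, z j, i, z i} \<subseteq> {j, z j, i, z i}"
    using matching_insert_pair[OF z _ 1(2,3) assms(4)] 1(1) by auto
  have 3: "card {k, z k, j, z j, i, z i} = 6" "{k, z k, j, z j, i, z i} \<subseteq> S"
      "z ` {k, z k, j, z j, i, z i} \<subseteq> {k, z k, j, z j, i, z i}"
    using matching_insert_pair[OF z _ 2(2,3) assms(5)] 2(1) by auto
  have 4: "card {l, z l, k, z k, j, z j, i, z i} = 8" "{l, z l, k, z k, j, z j, i, z i} \<subseteq> S"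
    using matching_insert_pair[OF z _ 3(2,3) assms(6)] 3(1) by auto
  show "card {i, z i} = 2" "{i, z i} \<subseteq> S" "card {j, z j, i, z i} = 4" "{j, z j, i, z i} \<subseteq> S"
    "card {k, z k, j, z j, i, z i} = 6" "{k, z k, j, z j, i, z i} \<subseteq> S"
    "card {l, z l, k, z k, j, z j, i, z i} = 8" "{l, z l, k, z k, j, z j, i, z i} \<subseteq> S"
    by (rule 1 2 3 4)+
qed

text \<open>A permutation \<open>g\<close> is determined by \<open>g \<circ> y \<circ> g\<inverse>\<close> and the images of one point of each of
  the four pairs, which leaves \<open>8 * 6 * 4 * 2 = 384\<close> choices for given \<open>g \<circ> y \<circ> g\<inverse>\<close>.\<close>

lemma card_conjugates_matching:
  assumes S: "card S = 8" and y: "matching S y"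
  shows "card {g \<circ> y \<circ> inv' g | g. g permutes S} \<ge> 105"
proof -
  have fin: "finite S" using S by (intro card_ge_0_finite) simp
  let ?Y = "{g \<circ> y \<circ> inv' g | g. g permutes S}"
  have ex: "S - A \<noteq> {}" if "length xs < 8" "A = set xs" for A xs
  proof
    assume "S - A = {}"
    then have "card S \<le> card A" using that by (intro card_mono) auto
    then show False using card_length[of xs] S that by simp
  qed
  obtain a where a: "a \<in> S" using ex[of "[]" "{}"] by (metis Diff_empty ex_in_conv length_0_conv list.set(1) zero_less_numeral)
  have "S - {a, y a} \<noteq> {}" by (rule ex[of "[a, y a]"]) auto
  then obtain b where b: "b \<in> S - {a, y a}" by (meson ex_in_conv)
  have "S - {b, y b, a, y a} \<noteq> {}" by (rule ex[of "[b, y b, a, y a]"]) auto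
  then obtain c where c: "c \<in> S - {b, y b, a, y a}" by (meson ex_in_conv)
  have "S - {c, y c, b, y b, a, y a} \<noteq> {}" by (rule ex[of "[c, y c, b, y b, a, y a]"]) auto
  then obtain d where d: "d \<in> S - {c, y c, b, y b, a, y a}" by (meson ex_in_conv)
  have P: "{d, y d, c, y c, b, y b, a, y a} = S"
    using matching_pairs(7,8)[OF fin y a b c d] S by (intro card_subset_eq[OF fin]) simp_all
  \<comment> \<open>The possible images of \<open>a\<close>, \<open>b\<close>, \<open>c\<close>,
    \<open>d\<close> under a permutation that conjugates \<open>y\<close> to \<open>z\<close>: each
    must avoid the pairs of \<open>z\<close> already used.\<close>
  let ?C = "\<lambda>z. SIGMA i:S. SIGMA j:S - {i, z i}. SIGMA k:S - {j, z j, i, z i}. S - {k, z k, j, z j, i, z i}"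
  have cardC: "card (?C z) = 384" if z: "matching S z" for z
  proof -
    have 1: "card (S - {i, z i}) = 6" if "i \<in> S" for i
      using matching_insert_pair[OF z finite.emptyI empty_subsetI, of i] that S
      by (subst card_Diff_subset) auto
    have 2: "card (S - {j, z j, i, z i}) = 4" if ij: "i \<in> S" "j \<in> S - {i, z i}" for i j
    proof -
      have "{i, z i} \<subseteq> S" "z ` {i, z i} \<subseteq> {i, z i}" "card {i, z i} = 2"
        using matching_insert_pair[OF z finite.emptyI empty_subsetI, of i] ij by auto
      then show ?thesis
        using matching_insert_pair[OF z _ _ _ ij(2)] S by (subst card_Diff_subset) auto
    qed
    have 3: "card (S - {k, z k, j, z j, i, z i}) = 2"
      if ijk: "i \<in> S" "j \<in> S - {i, z i}" "k \<in> S - {j, z j, i, z i}" for i j k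
    proof -
      have "card (S - {k, z k, j, z j, i, z i}) \<noteq> 0"
        using ex[of "[k, z k, j, z j, i, z i]" "{k, z k, j, z j, i, z i}"] fin by simp
      then obtain l where "l \<in> S - {k, z k, j, z j, i, z i}" by (metis card.empty ex_in_conv)
      then show ?thesis
        using matching_pairs(5,6)[OF fin z ijk] S by (subst card_Diff_subset) auto
    qed
    have "card (SIGMA k:S - {j, z j, i, z i}. S - {k, z k, j, z j, i, z i}) = 8"
      if "i \<in> S" "j \<in> S - {i, z i}" for i j
      using fin 2[OF that] 3[OF that] by (subst card_SigmaI) auto
    then have "card (SIGMA j:S - {i, z i}. SIGMA k:S - {j, z j, i, z i}. S - {k, z k, j, z j, i, z i}) = 48"
      if "i \<in> S" for i
      using fin 1[OF that] that by (subst card_SigmaI) auto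
    then show ?thesis using fin S by (subst card_SigmaI) auto
  qed
  have finY: "finite ?Y"
    using finite_imageI[OF finite_permutations[OF fin], of "\<lambda>g. g \<circ> y \<circ> inv' g"]
    by (simp add: setcompr_eq_image)
  let ?f = "\<lambda>g. (g \<circ> y \<circ> inv' g, g a, g b, g c, g d)"
  have conj_ap: "(g \<circ> y \<circ> inv' g) (g i) = g (y i)" if "g permutes S" for g i
    using permutes_inverses[OF that] by simp
  have "card {g. g permutes S} \<le> card (SIGMA z:?Y. ?C z)"
  proof (rule card_inj_on_le)
    show "inj_on ?f {g. g permutes S}"
    proof (rule inj_onI)
      fix g h assume gh: "g \<in> {g. g permutes S}" "h \<in> {g. g permutes S}" "?f g = ?f h"
      then have eq: "g \<circ> y \<circ> inv' g = h \<circ> y \<circ> inv' h" and ab: "g a = h a" "g b = h b" "g c = h c" "g d = h d"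
        by auto
      have "g (y i) = h (y i)" if "g i = h i" for i
        using conj_ap[of g i] conj_ap[of h i] gh(1,2) eq that by (metis mem_Collect_eq)
      then have "g i = h i" if "i \<in> S" for i using ab that P by blast
      then show "g = h" using gh(1,2) permutes_not_in by (metis ext mem_Collect_eq)
    qed
    show "?f ` {g. g permutes S} \<subseteq> (SIGMA z:?Y. ?C z)"
    proof (rule image_subsetI)
      fix g assume "g \<in> {g. g permutes S}"
      then have g: "g permutes S" by simp
      let ?z = "g \<circ> y \<circ> inv' g"
      have z: "?z (g i) = g (y i)" for i by (rule conj_ap[OF g])
      have gi: "g i = g j \<longleftrightarrow> i = j" for i j using inj_eq[OF permutes_inj[OF g]] .
      have gS: "g i \<in> S \<longleftrightarrow> i \<in> S" for i using permutes_in_image[OF g] .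
      have "?z \<in> ?Y" using g by blast
      then show "?f g \<in> (SIGMA z:?Y. ?C z)"
        unfolding mem_Sigma_iff z Diff_iff insert_iff empty_iff gi gS using a b c d by blast
    qed
    show "finite (SIGMA z:?Y. ?C z)" using finY fin by (intro finite_SigmaI) auto
  qed
  also have "\<dots> = (\<Sum>z\<in>?Y. card (?C z))"
    using finY fin by (intro card_SigmaI) auto
  also have "\<dots> = (\<Sum>z\<in>?Y. 384)"
    using cardC matching_conj[OF y] by (intro sum.cong) auto
  finally have "fact 8 \<le> 384 * card ?Y"
    using card_permutations[OF S fin] by simp
  then show ?thesis by (simp add: fact_numeral)
qed

text \<open>The double count runs over the conjugates of \<open>y\<close>. All of them are
  matchings, so \<open>m\<close> bounds the ones commuting with \<open>p\<close>, and there are at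
  least 105 of them.\<close>

lemma card_class_matching_le:
  assumes S: "card S = 8" and X: "conj_invariant S X" and y: "matching S y"
    and m: "\<And>p. p \<in> X \<Longrightarrow> card {z. matching S z \<and> p \<circ> z = z \<circ> p} \<le> m"
  shows "card {p \<in> X. p \<circ> y = y \<circ> p} * 105 \<le> m * card X"
proof -
  have fin: "finite S" using S by (intro card_ge_0_finite) simp
  let ?Y = "{g \<circ> y \<circ> inv' g | g. g permutes S}"
  have "finite X" using X finite_permutations[OF fin] finite_subset by (auto simp: conj_invariant_def)
  moreover have "finite ?Y"
    using finite_imageI[OF finite_permutations[OF fin], of "\<lambda>g. g \<circ> y \<circ> inv' g"]
    by (simp add: setcompr_eq_image)
  moreover have "card {p \<in> X. p \<circ> z = z \<circ> p} = card {p \<in> X. p \<circ> y = y \<circ> p}" if z: "z \<in> ?Y" for z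
  proof -
    obtain g where g: "g permutes S" "z = g \<circ> y \<circ> inv' g" using z by blast
    have "g \<circ> p \<circ> inv' g \<circ> z = g \<circ> (p \<circ> y) \<circ> inv' g" "z \<circ> (g \<circ> p \<circ> inv' g) = g \<circ> (y \<circ> p) \<circ> inv' g" for p
      using permutes_inverses[OF g(1)] g(2) by (auto simp: fun_eq_iff)
    then have "(g \<circ> p \<circ> inv' g) \<circ> z = z \<circ> (g \<circ> p \<circ> inv' g) \<longleftrightarrow> p \<circ> y = y \<circ> p" for p
      using conj_cancel(2)[OF g(1)] by metis
    then show ?thesis by (rule card_conj_invariant[OF X g(1)])
  qed
  moreover have "card {z \<in> ?Y. p \<circ> z = z \<circ> p} \<le> m" if p: "p \<in> X" for p
  proof -
    have "finite {z. matching S z \<and> p \<circ> z = z \<circ> p}"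
      by (rule finite_subset[OF _ finite_permutations[OF fin]]) (unfold matching_def, blast)
    moreover have "{z \<in> ?Y. p \<circ> z = z \<circ> p} \<subseteq> {z. matching S z \<and> p \<circ> z = z \<circ> p}"
      using matching_conj[OF y] by blast
    ultimately show ?thesis using m[OF p] card_mono by (meson order_trans)
  qed
  ultimately have "card {p \<in> X. p \<circ> y = y \<circ> p} * card ?Y \<le> m * card X"
    by (rule double_count)
  then show ?thesis using card_conjugates_matching[OF S y] by (meson mult_le_mono2 order_trans)
qed

section \<open>Invariant subsets and commuting matchings\<close>

definition cycles_8 :: "'a set \<Rightarrow> ('a \<Rightarrow> 'a) set"
  where "cycles_8 S = {p. eight_cycle S p}"

text \<open>In a set of eight points the following are the permutations of cycle type
  5 + 2 + 1, 3 + 3 + 2 and 5 + 3.\<close>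

definition cycles_521 :: "'a set \<Rightarrow> ('a \<Rightarrow> 'a) set"
  where "cycles_521 S = {p. p permutes S \<and>
    card (fixed S p 1) = 1 \<and> card (fixed S p 2) = 3 \<and> card (fixed S p 5) = 6}"

definition cycles_332 :: "'a set \<Rightarrow> ('a \<Rightarrow> 'a) set"
  where "cycles_332 S = {p. p permutes S \<and>
    card (fixed S p 1) = 0 \<and> card (fixed S p 2) = 2 \<and> card (fixed S p 3) = 6}"

definition cycles_53 :: "'a set \<Rightarrow> ('a \<Rightarrow> 'a) set"
  where "cycles_53 S = {p. p permutes S \<and> card (fixed S p 3) = 3 \<and> card (fixed S p 5) = 5}"

lemmas cycles_defs = cycles_8_def cycles_521_def cycles_332_def cycles_53_def

lemma conj_invariant_cycles:
  "conj_invariant S (cycles_8 S)" "conj_invariant S (cycles_521 S)"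
  "conj_invariant S (cycles_332 S)" "conj_invariant S (cycles_53 S)"
proof -
  show "conj_invariant S (cycles_8 S)"
    unfolding conj_invariant_def cycles_8_def eight_cycle_def
    by (auto simp only: mem_Collect_eq subset_iff conj_permutes fixed_conj image_is_empty)
qed (unfold conj_invariant_def cycles_defs,
    auto simp only: mem_Collect_eq subset_iff conj_permutes card_fixed_conj)

lemma cycles_permutes:
  "p \<in> cycles_8 S \<Longrightarrow> p permutes S" "p \<in> cycles_521 S \<Longrightarrow> p permutes S"
  "p \<in> cycles_332 S \<Longrightarrow> p permutes S" "p \<in> cycles_53 S \<Longrightarrow> p permutes S"
  by (auto simp: cycles_defs eight_cycle_def)

lemma fixed_profile_cycles:
  assumes "card S = 8"
  shows "p \<in> cycles_8 S \<Longrightarrow> card (fixed S p 1) = 0 \<and> card (fixed S p 2) = 0 \<and> card (fixed S p 3) = 0 \<and> card (fixed S p 4) = 0"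
    and "p \<in> cycles_521 S \<Longrightarrow> card (fixed S p 1) = 1 \<and> card (fixed S p 2) = 3 \<and> card (fixed S p 3) = 1 \<and> card (fixed S p 4) = 3"
    and "p \<in> cycles_332 S \<Longrightarrow> card (fixed S p 1) = 0 \<and> card (fixed S p 2) = 2 \<and> card (fixed S p 3) = 6 \<and> card (fixed S p 4) = 2"
    and "p \<in> cycles_53 S \<Longrightarrow> card (fixed S p 1) = 0 \<and> card (fixed S p 2) = 0 \<and> card (fixed S p 3) = 3 \<and> card (fixed S p 4) = 0"
proof -
  assume p: "p \<in> cycles_8 S"
  then have "card (fixed S p 3) = 0" "card (fixed S p 4) = 0" by (auto simp: cycles_8_def eight_cycle_def)
  with fixed_profile_8[OF cycles_permutes(1)[OF p] assms]
  show "card (fixed S p 1) = 0 \<and> card (fixed S p 2) = 0 \<and> card (fixed S p 3) = 0 \<and> card (fixed S p 4) = 0"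
    by (elim insertE emptyE) simp_all
next
  assume p: "p \<in> cycles_521 S"
  then have "card (fixed S p 1) = 1" "card (fixed S p 2) = 3" "card (fixed S p 5) = 6" by (auto simp: cycles_521_def)
  with fixed_profile_8[OF cycles_permutes(2)[OF p] assms]
  show "card (fixed S p 1) = 1 \<and> card (fixed S p 2) = 3 \<and> card (fixed S p 3) = 1 \<and> card (fixed S p 4) = 3"
    by (elim insertE emptyE) simp_all
next
  assume p: "p \<in> cycles_332 S"
  then have "card (fixed S p 1) = 0" "card (fixed S p 2) = 2" "card (fixed S p 3) = 6" by (auto simp: cycles_332_def)
  with fixed_profile_8[OF cycles_permutes(3)[OF p] assms]
  show "card (fixed S p 1) = 0 \<and> card (fixed S p 2) = 2 \<and> card (fixed S p 3) = 6 \<and> card (fixed S p 4) = 2"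
    by (elim insertE emptyE) simp_all
next
  assume p: "p \<in> cycles_53 S"
  then have "card (fixed S p 3) = 3" "card (fixed S p 5) = 5" by (auto simp: cycles_53_def)
  with fixed_profile_8[OF cycles_permutes(4)[OF p] assms]
  show "card (fixed S p 1) = 0 \<and> card (fixed S p 2) = 0 \<and> card (fixed S p 3) = 3 \<and> card (fixed S p 4) = 0"
    by (elim insertE emptyE) simp_all
qed

text \<open>The cycles of the restriction to \<open>A\<close> are the cycles of \<open>p\<close>
  inside \<open>A\<close>, and none of them is longer than 4. Intersecting \<open>A\<close> with the
  fixed sets of \<open>p\<close> thus reveals which cycles make up \<open>A\<close>.\<close>

lemma restricted_cycle_type:
  assumes p: "p permutes S" and S: "finite S" and A: "A \<subseteq> S" "p ` A = A" "card A \<le> 4"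
  shows "\<exists>c1 c2 c3 c4 :: nat. c1 + 2 * c2 + 3 * c3 + 4 * c4 = card A \<and>
    card (A \<inter> fixed S p 1) = c1 \<and> card (A \<inter> fixed S p 2) = c1 + 2 * c2 \<and>
    card (A \<inter> fixed S p 3) = c1 + 3 * c3 \<and> card (A \<inter> fixed S p 4) = c1 + 2 * c2 + 4 * c4"
proof -
  let ?q = "restrict_id p A"
  have fin: "finite A" using A(1) S finite_subset by blast
  have "bij_betw p A A" using A(2) permutes_inj_on[OF p] by (simp add: bij_betw_def)
  then have q: "?q permutes A" by (rule permutes_restrict_id)
  have "(?q ^^ k) i = (p ^^ k) i \<and> (p ^^ k) i \<in> A" if "i \<in> A" for i k
    using that A(2) by (induction k) auto
  then have eq: "fixed A ?q k = A \<inter> fixed S p k" for k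
    using A(1) by (auto simp: fixed_def)
  have "card A \<le> 8" using A(3) by simp
  then show ?thesis
    using q fin
  proof (rule_tac cycle_type_8[of ?q A])
    fix c1 c2 c3 c4 c5 c6 c7 c8 :: nat
    assume c: "c1 + 2 * c2 + 3 * c3 + 4 * c4 + 5 * c5 + 6 * c6 + 7 * c7 + 8 * c8 = card A"
      "card (fixed A ?q 1) = c1"
      "card (fixed A ?q 2) = c1 + 2 * c2"
      "card (fixed A ?q 3) = c1 + 3 * c3"
      "card (fixed A ?q 4) = c1 + 2 * c2 + 4 * c4"
    have "c5 = 0" "c6 = 0" "c7 = 0" "c8 = 0" using c(1) A(3) by linarith+
    then show ?thesis
      using c unfolding eq by (intro exI[of _ c1] exI[of _ c2] exI[of _ c3] exI[of _ c4]) simp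
  qed auto
qed

lemma card_Int_fixed_le: "finite S \<Longrightarrow> card (A \<inter> fixed S p k) \<le> card (fixed S p k)"
  by (intro card_mono) auto

lemma subset_fixedI:
  assumes "finite A" "card (A \<inter> fixed S p k) = card A"
  shows "A \<subseteq> fixed S p k"
  using card_subset_eq[OF assms(1) Int_lower1 assms(2)] by blast

lemma fixed_1_subset: "fixed S p 1 \<subseteq> fixed S p k"
proof -
  have "(p ^^ k) i = i" if "p i = i" for i using that by (induction k) auto
  then show ?thesis by (auto simp: fixed_def)
qed

lemma card_le_1I:
  assumes "\<And>y. y \<in> Y \<Longrightarrow> y = z"
  shows "card Y \<le> 1"
  using card_mono[of "{z}" Y] assms by auto

context
  fixes S :: "'a set"
  assumes S: "card S = 8"
begin

lemma finite_S8: "finite S"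
  using S by (intro card_ge_0_finite) simp

lemma restricted_profile:
  assumes p: "p permutes S" and A: "A \<subseteq> S" "p ` A = A" "card A = k"
  defines "a \<equiv> \<lambda>j. card (A \<inter> fixed S p j)"
  shows "k = 1 \<Longrightarrow> a 1 = 1"
    and "k = 2 \<Longrightarrow> a 1 = 2 \<or> a 1 = 0 \<and> a 2 = 2"
    and "k = 3 \<Longrightarrow> a 1 = 3 \<or> a 1 = 1 \<and> a 2 = 3 \<or> a 1 = 0 \<and> a 2 = 0 \<and> a 3 = 3"
    and "k = 4 \<Longrightarrow> a 1 \<ge> 2 \<or> a 1 = 1 \<and> a 3 = 4 \<or> a 1 = 0 \<and> a 4 = 4"
proof -
  have ex: "\<exists>c1 c2 c3 c4 :: nat. c1 + 2 * c2 + 3 * c3 + 4 * c4 = k \<and>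
    a 1 = c1 \<and> a 2 = c1 + 2 * c2 \<and> a 3 = c1 + 3 * c3 \<and> a 4 = c1 + 2 * c2 + 4 * c4" if "k \<le> 4"
    using restricted_cycle_type[OF p finite_S8 A(1,2)] A(3) that unfolding a_def by simp
  show "a 1 = 1" if k: "k = 1"
  proof -
    have "k \<le> 4" using k by simp
    from ex[OF this] obtain c1 c2 c3 c4 :: nat where c: "c1 + 2 * c2 + 3 * c3 + 4 * c4 = k"
      "a 1 = c1" "a 2 = c1 + 2 * c2" "a 3 = c1 + 3 * c3" "a 4 = c1 + 2 * c2 + 4 * c4"
      by blast
    have "c1 = 1"
      using c(1)[unfolded k] by presburger
    then show ?thesis unfolding c(2-5) .
  qed
  show "a 1 = 2 \<or> a 1 = 0 \<and> a 2 = 2" if k: "k = 2"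
  proof -
    have "k \<le> 4" using k by simp
    from ex[OF this] obtain c1 c2 c3 c4 :: nat where c: "c1 + 2 * c2 + 3 * c3 + 4 * c4 = k"
      "a 1 = c1" "a 2 = c1 + 2 * c2" "a 3 = c1 + 3 * c3" "a 4 = c1 + 2 * c2 + 4 * c4"
      by blast
    have "c1 = 2 \<or> c1 = 0 \<and> c1 + 2 * c2 = 2"
      using c(1)[unfolded k] by presburger
    then show ?thesis unfolding c(2-5) .
  qed
  show "a 1 = 3 \<or> a 1 = 1 \<and> a 2 = 3 \<or> a 1 = 0 \<and> a 2 = 0 \<and> a 3 = 3" if k: "k = 3"
  proof -
    have "k \<le> 4" using k by simp
    from ex[OF this] obtain c1 c2 c3 c4 :: nat where c: "c1 + 2 * c2 + 3 * c3 + 4 * c4 = k"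
      "a 1 = c1" "a 2 = c1 + 2 * c2" "a 3 = c1 + 3 * c3" "a 4 = c1 + 2 * c2 + 4 * c4"
      by blast
    note sum = c(1)[unfolded k]
    have c4: "c4 = 0" using sum by linarith
    consider "c3 = 1" | "c3 = 0" "c2 = 1" | "c3 = 0" "c2 = 0" using sum by linarith
    then have "c1 = 3 \<or> c1 = 1 \<and> c1 + 2 * c2 = 3 \<or> c1 = 0 \<and> c1 + 2 * c2 = 0 \<and> c1 + 3 * c3 = 3"
      by cases (use sum c4 in presburger)+
    then show ?thesis unfolding c(2-5) .
  qed
  show "a 1 \<ge> 2 \<or> a 1 = 1 \<and> a 3 = 4 \<or> a 1 = 0 \<and> a 4 = 4" if k: "k = 4"
  proof -
    have "k \<le> 4" using k by simp
    from ex[OF this] obtain c1 c2 c3 c4 :: nat where c: "c1 + 2 * c2 + 3 * c3 + 4 * c4 = k"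
      "a 1 = c1" "a 2 = c1 + 2 * c2" "a 3 = c1 + 3 * c3" "a 4 = c1 + 2 * c2 + 4 * c4"
      by blast
    have "c1 \<ge> 2 \<or> c1 = 1 \<and> c1 + 3 * c3 = 4 \<or> c1 = 0 \<and> c1 + 2 * c2 + 4 * c4 = 4"
      using c(1)[unfolded k] by presburger
    then show ?thesis unfolding c(2-5) .
  qed
qed

lemma no_invariant_cycles_8:
  assumes p: "p \<in> cycles_8 S" and A: "A \<subseteq> S" "p ` A = A" "card A = k" "k \<in> {1, 2, 3, 4}"
  shows False
proof -
  note prof = restricted_profile[OF cycles_permutes(1)[OF p] A(1-3)]
  have le: "card (A \<inter> fixed S p j) = 0" if "j \<in> {1, 2, 3, 4}" for j
    using card_Int_fixed_le[OF finite_S8, of A p j] fixed_profile_cycles(1)[OF S p] that by auto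
  show False
    using A(4) prof le[of 1] le[of 2] le[of 3] le[of 4] by auto
qed

text \<open>An invariant set is a union of cycles. Of lengths 5, 2 and 1 there is exactly one way to
  form the sizes 1, 2 and 3, and none to form 4.\<close>

lemma invariant_cycles_521:
  assumes p: "p \<in> cycles_521 S" and A: "A \<subseteq> S" "p ` A = A" "card A = k"
  shows "k = 1 \<Longrightarrow> A = fixed S p 1" "k = 2 \<Longrightarrow> A = fixed S p 2 - fixed S p 1"
    "k = 3 \<Longrightarrow> A = fixed S p 2" "k \<noteq> 4"
proof -
  have fin: "finite A" using A(1) finite_S8 finite_subset by blast
  note prof = restricted_profile[OF cycles_permutes(2)[OF p] A]
  note f = fixed_profile_cycles(2)[OF S p]
  note le = card_Int_fixed_le[OF finite_S8, of A p]
  show "A = fixed S p 1" if "k = 1"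
    using prof(1)[OF that] f A(3) that finite_S8 subset_fixedI[OF fin, of S p 1]
    by (intro card_subset_eq) auto
  show "A = fixed S p 2 - fixed S p 1" if "k = 2"
  proof -
    have "card (A \<inter> fixed S p 1) = 0" "card (A \<inter> fixed S p 2) = 2"
      using prof(2)[OF that] f le[of 1] by auto
    then have "A \<subseteq> fixed S p 2 - fixed S p 1"
      using subset_fixedI[OF fin, of S p 2] A(3) that fin by auto
    moreover have "card (fixed S p 2 - fixed S p 1) = 2"
      using f finite_S8 fixed_1_subset[of S p 2] by (simp add: card_Diff_subset)
    ultimately show ?thesis using A(3) that finite_S8 by (intro card_subset_eq) auto
  qed
  show "A = fixed S p 2" if "k = 3"
  proof -
    have "card (A \<inter> fixed S p 2) = 3"
      using prof(3)[OF that] f le[of 1] le[of 3] by auto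
    then show ?thesis
      using subset_fixedI[OF fin, of S p 2] A(3) that f finite_S8 by (intro card_subset_eq) auto
  qed
  show "k \<noteq> 4" using prof(4) f le[of 1] le[of 3] le[of 4] by auto
qed

lemma invariant_cycles_332:
  assumes p: "p \<in> cycles_332 S" and A: "A \<subseteq> S" "p ` A = A" "card A = k"
  shows "k \<noteq> 1" "k = 2 \<Longrightarrow> A = fixed S p 2"
    "k = 3 \<Longrightarrow> A \<subseteq> fixed S p 3 \<and> A \<inter> fixed S p 2 = {}" "k \<noteq> 4"
proof -
  have fin: "finite A" using A(1) finite_S8 finite_subset by blast
  note prof = restricted_profile[OF cycles_permutes(3)[OF p] A]
  note f = fixed_profile_cycles(3)[OF S p]
  note le = card_Int_fixed_le[OF finite_S8, of A p]
  show "k \<noteq> 1" using prof(1) f le[of 1] by auto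
  show "A = fixed S p 2" if "k = 2"
  proof -
    have "card (A \<inter> fixed S p 2) = 2"
      using prof(2)[OF that] f le[of 1] by auto
    then show ?thesis
      using subset_fixedI[OF fin, of S p 2] A(3) that f finite_S8 by (intro card_subset_eq) auto
  qed
  show "A \<subseteq> fixed S p 3 \<and> A \<inter> fixed S p 2 = {}" if "k = 3"
  proof -
    have "card (A \<inter> fixed S p 2) = 0" "card (A \<inter> fixed S p 3) = 3"
      using prof(3)[OF that] f le[of 1] by auto
    then show ?thesis
      using subset_fixedI[OF fin, of S p 3] A(3) that fin by auto
  qed
  show "k \<noteq> 4" using prof(4) f le[of 1] le[of 3] le[of 4] by auto
qed

lemma invariant_cycles_53:
  assumes p: "p \<in> cycles_53 S" and A: "A \<subseteq> S" "p ` A = A" "card A = k"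
  shows "k \<noteq> 1" "k \<noteq> 2" "k = 3 \<Longrightarrow> A = fixed S p 3" "k \<noteq> 4"
proof -
  have fin: "finite A" using A(1) finite_S8 finite_subset by blast
  note prof = restricted_profile[OF cycles_permutes(4)[OF p] A]
  note f = fixed_profile_cycles(4)[OF S p]
  note le = card_Int_fixed_le[OF finite_S8, of A p]
  show "k \<noteq> 1" "k \<noteq> 2" "k \<noteq> 4"
    using prof f le[of 1] le[of 2] le[of 3] le[of 4] by auto
  show "A = fixed S p 3" if "k = 3"
  proof -
    have "card (A \<inter> fixed S p 3) = 3"
      using prof(3)[OF that] f le[of 1] by auto
    then show ?thesis
      using subset_fixedI[OF fin, of S p 3] A(3) that f finite_S8 by (intro card_subset_eq) auto
  qed
qed

text \<open>Distinct invariant triples are disjoint: their intersection is invariant, so it cannot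
  be a single point, and two points would form the 2-cycle, which no triple meets. They all lie
  among the six points of the 3-cycles.\<close>

lemma card_invariant_triples_332:
  assumes p: "p \<in> cycles_332 S"
  shows "card {A. A \<subseteq> S \<and> card A = 3 \<and> p ` A = A} \<le> 2"
proof -
  let ?F = "{A. A \<subseteq> S \<and> card A = 3 \<and> p ` A = A}"
  note prof = invariant_cycles_332[OF p]
  have "disjoint ?F"
  proof (rule disjointI)
    fix A B assume AB: "A \<in> ?F" "B \<in> ?F" "A \<noteq> B"
    then have fin: "finite A" "finite B" using finite_S8 finite_subset by auto
    have inv: "p ` (A \<inter> B) = A \<inter> B"
      using AB image_Int[OF permutes_inj[OF cycles_permutes(3)[OF p]], of A B] by auto
    have "card (A \<inter> B) \<noteq> 1" using prof(1)[OF _ inv refl] AB by blast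
    moreover have "card (A \<inter> B) \<noteq> 2"
    proof
      assume 2: "card (A \<inter> B) = 2"
      then have "A \<inter> B = fixed S p 2" using prof(2)[OF _ inv 2] AB by blast
      moreover have "A \<inter> fixed S p 2 = {}" using prof(3)[of A 3] AB by blast
      ultimately have "A \<inter> B = {}" by blast
      with 2 show False by simp
    qed
    moreover have "card (A \<inter> B) \<noteq> 3"
    proof
      assume "card (A \<inter> B) = 3"
      then have "A \<inter> B = A" "A \<inter> B = B"
        using card_subset_eq[OF fin(1), of "A \<inter> B"] card_subset_eq[OF fin(2), of "A \<inter> B"] AB by simp_all
      then show False using AB(3) by simp
    qed
    moreover have "card (A \<inter> B) \<le> 3" using card_mono[OF fin(1), of "A \<inter> B"] AB by auto
    ultimately have "card (A \<inter> B) = 0" by linarith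
    then show "A \<inter> B = {}" using fin by simp
  qed
  then have "card (\<Union>?F) = sum card ?F"
    using finite_S8 finite_subset by (intro card_Union_disjoint) auto
  also have "\<dots> = 3 * card ?F" by simp
  finally have "card (\<Union>?F) = 3 * card ?F" .
  moreover have "card (\<Union>?F) \<le> card (fixed S p 3)"
    using prof(3)[of _ 3] finite_S8 by (intro card_mono) auto
  ultimately have "3 * card ?F \<le> card (fixed S p 3)" by simp
  then show ?thesis using fixed_profile_cycles(3)[OF S p] by simp
qed

end

text \<open>Each application of \<open>p\<close> changes sides, so an odd power cannot fix a
  point.\<close>

lemma swap_bisection:
  assumes p: "p permutes S" and B: "B \<subseteq> S" "p ` B = S - B"
  shows "i \<in> S \<Longrightarrow> (p ^^ k) i \<in> B \<longleftrightarrow> (if even k then i \<in> B else i \<notin> B)"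
    and "odd k \<Longrightarrow> fixed S p k = {}"
proof -
  have step: "p i \<in> B \<longleftrightarrow> i \<notin> B" if "i \<in> S" for i
  proof -
    have "p ` (S - B) = B"
      using image_set_diff[OF permutes_inj[OF p], of S B] permutes_image[OF p] B by (simp add: double_diff)
    then show ?thesis using B(2) that by blast
  qed
  have *: "(p ^^ k) i \<in> B \<longleftrightarrow> (if even k then i \<in> B else i \<notin> B)" if "i \<in> S" for i k
  proof (induction k)
    case (Suc k)
    have "(p ^^ k) i \<in> S" using permutes_in_image[OF permutes_funpow[OF p]] that by blast
    then show ?case using step Suc by simp
  qed simp
  show "i \<in> S \<Longrightarrow> (p ^^ k) i \<in> B \<longleftrightarrow> (if even k then i \<in> B else i \<notin> B)" using * .
  show "fixed S p k = {}" if "odd k"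
  proof -
    have "(p ^^ k) i \<noteq> i" if "i \<in> S" for i using *[OF that, of k] \<open>odd k\<close> by auto
    then show ?thesis by (auto simp: fixed_def)
  qed
qed

context
  fixes S :: "'a set"
  assumes S: "card S = 8"
begin

text \<open>No 4-set is invariant under an 8-cycle, so the sides alternate along the cycle and the
  set is determined by whether it contains \<open>a\<close>.\<close>

lemma card_bisections_cycles_8:
  assumes p: "p \<in> cycles_8 S"
  shows "card {B. B \<subseteq> S \<and> card B = 4 \<and> (p ` B = B \<or> p ` B = S - B)} \<le> 2"
proof -
  let ?F = "{B. B \<subseteq> S \<and> card B = 4 \<and> (p ` B = B \<or> p ` B = S - B)}"
  have p8: "eight_cycle S p" using p by (simp add: cycles_8_def)
  obtain a where a: "a \<in> S" using S by fastforce
  have swap: "B \<subseteq> S \<and> p ` B = S - B" if "B \<in> ?F" for B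
    using that no_invariant_cycles_8[OF S p, of B 4] by auto
  have "inj_on (\<lambda>B. a \<in> B) ?F"
  proof (rule inj_onI)
    fix B C assume BC: "B \<in> ?F" "C \<in> ?F" "(a \<in> B) = (a \<in> C)"
    have "i \<in> B \<longleftrightarrow> i \<in> C" if i: "i \<in> S" for i
    proof -
      obtain k where "i = (p ^^ k) a"
        using eight_cycle(3)[OF p8 S a] i by (auto simp: bij_betw_def)
      moreover have "(p ^^ k) a \<in> B \<longleftrightarrow> (if even k then a \<in> B else a \<notin> B)"
        using swap_bisection(1)[OF cycles_permutes(1)[OF p] _ _ a] swap[OF BC(1)] by blast
      moreover have "(p ^^ k) a \<in> C \<longleftrightarrow> (if even k then a \<in> C else a \<notin> C)"
        using swap_bisection(1)[OF cycles_permutes(1)[OF p] _ _ a] swap[OF BC(2)] by blast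
      ultimately show ?thesis using BC(3) by simp
    qed
    then show "B = C" using BC(1,2) by blast
  qed
  then have "card ?F \<le> card (UNIV :: bool set)"
    by (rule card_inj_on_le) auto
  then show ?thesis by simp
qed

text \<open>The first or third power has a fixed point, so the halves are not exchanged; and no
  union of cycles of these types has size 4.\<close>

lemma no_bisection:
  assumes "p \<in> cycles_521 S \<union> cycles_332 S \<union> cycles_53 S" and B: "B \<subseteq> S" "card B = 4"
  shows "p ` B \<noteq> B \<and> p ` B \<noteq> S - B"
proof -
  have p: "p permutes S" using assms(1) cycles_permutes by blast
  have "card (fixed S p 1) \<noteq> 0 \<or> card (fixed S p 3) \<noteq> 0"
    using assms(1) fixed_profile_cycles(2-4)[OF S] by force
  then have "p ` B \<noteq> S - B"
    using swap_bisection(2)[OF p B(1), of 1] swap_bisection(2)[OF p B(1), of 3] by auto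
  moreover have "p ` B \<noteq> B"
  proof
    assume eq: "p ` B = B"
    from assms(1) consider "p \<in> cycles_521 S" | "p \<in> cycles_332 S" | "p \<in> cycles_53 S" by blast
    then show False
      using invariant_cycles_521(4)[OF S _ B(1) eq B(2)] invariant_cycles_332(4)[OF S _ B(1) eq B(2)]
        invariant_cycles_53(4)[OF S _ B(1) eq B(2)] by cases simp_all
  qed
  ultimately show ?thesis by blast
qed

section \<open>Matchings commuting with a permutation\<close>

lemma commute_funpow:
  assumes "p \<circ> z = z \<circ> p"
  shows "z ((p ^^ k) i) = (p ^^ k) (z i)"
proof (induction k)
  case (Suc k)
  then show ?case using fun_cong[OF assms, of "(p ^^ k) i"] by simp
qed simp

text \<open>A permutation of \<open>S\<close> commuting with an 8-cycle is one of its powers, and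
  the only power that is an involution without fixed points is the fourth.\<close>

lemma card_matchings_cycles_8:
  assumes p: "p \<in> cycles_8 S"
  shows "card {z. matching S z \<and> p \<circ> z = z \<circ> p} \<le> 1"
proof (rule card_le_1I)
  fix z assume "z \<in> {z. matching S z \<and> p \<circ> z = z \<circ> p}"
  then have z: "matching S z" and comm: "p \<circ> z = z \<circ> p" by blast+
  have p8: "eight_cycle S p" using p by (simp add: cycles_8_def)
  have "z a = (p ^^ 4) a" if a: "a \<in> S" for a
  proof -
    have "z a \<in> S" using z permutes_in_image a by (fastforce simp: matching_def)
    then obtain j where j: "j < 8" "z a = (p ^^ j) a"
      using eight_cycle(3)[OF p8 S a] by (auto simp: bij_betw_def)
    have "a = z (z a)" using matching_apply[OF z] by simp
    also have "\<dots> = (p ^^ j) ((p ^^ j) a)" using j(2) commute_funpow[OF comm] by simp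
    also have "\<dots> = (p ^^ (j + j)) a" by (simp add: funpow_add)
    finally have "8 dvd j + j" using eight_cycle(2)[OF p8 S a, of "j + j"] by simp
    then have "4 dvd j" by presburger
    moreover have "j \<noteq> 0"
    proof
      assume "j = 0"
      then show False using j(2) z a by (simp add: matching_def)
    qed
    ultimately have "j = 4" using j(1) by presburger
    then show ?thesis using j(2) by simp
  qed
  moreover have "z a = (p ^^ 4) a" if "a \<notin> S" for a
    using that z permutes_not_in[OF permutes_funpow[OF cycles_permutes(1)[OF p]]]
      permutes_not_in[of z S a] by (simp add: matching_def)
  ultimately show "z = p ^^ 4" by blast
qed

lemma matching_fixed:
  assumes "p \<circ> z = z \<circ> p" "matching S z" "i \<in> fixed S p k"
  shows "z i \<in> fixed S p k" "z i \<noteq> i"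
proof -
  have i: "i \<in> S" "(p ^^ k) i = i" using assms(3) by (auto simp: fixed_def)
  have "z i \<in> S" using assms(2) permutes_in_image i(1) by (fastforce simp: matching_def)
  then show "z i \<in> fixed S p k"
    using commute_funpow[OF assms(1), of k i] i(2) by (simp add: fixed_def)
  show "z i \<noteq> i" using assms(2) i(1) by (simp add: matching_def)
qed

text \<open>A commuting matching would pair off the points fixed by a power of \<open>p\<close>, but
  the fixed set has one point for 5 + 2 + 1 (first power) and three points for 5 + 3 (third
  power).\<close>

lemma no_matching:
  assumes "p \<in> cycles_521 S \<union> cycles_53 S" "matching S z"
  shows "p \<circ> z \<noteq> z \<circ> p"
proof
  assume comm: "p \<circ> z = z \<circ> p"
  have even: "even (card A)" if A: "A = fixed S p k" "card A \<le> 4" for A k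
  proof -
    have AS: "A \<subseteq> S" unfolding A(1) by (rule fixed_subset)
    have z: "z permutes S" using assms(2) by (simp add: matching_def)
    have sub: "z ` A \<subseteq> A" using matching_fixed(1)[OF comm assms(2)] A(1) by blast
    have fin: "finite A" using AS finite_S8[OF S] finite_subset by blast
    have "z ` A = A"
      using card_subset_eq[OF fin sub] card_image[OF permutes_inj_on[OF z]] by blast
    then obtain c1 c2 c3 c4 :: nat where c: "card (A \<inter> fixed S z 1) = c1" "card (A \<inter> fixed S z 2) = c1 + 2 * c2"
      using restricted_cycle_type[OF z finite_S8[OF S] AS _ A(2)] by blast
    have "A \<inter> fixed S z 1 = {}" using assms(2) by (auto simp: fixed_def matching_def)
    moreover have "A \<inter> fixed S z 2 = A"
      using AS matching_apply[OF assms(2)] by (auto simp: fixed_def numeral_2_eq_2)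
    ultimately show ?thesis using c by simp
  qed
  from assms(1) show False
  proof
    assume "p \<in> cycles_521 S"
    then show False using even[OF refl, of 1] fixed_profile_cycles(2)[OF S, of p] by simp
  next
    assume "p \<in> cycles_53 S"
    then show False using even[OF refl, of 3] fixed_profile_cycles(4)[OF S, of p] by simp
  qed
qed

text \<open>A matching commuting with a permutation of type 3 + 3 + 2 interchanges its two 3-cycles and is
  determined by the image of one point.\<close>

lemma card_matchings_cycles_332:
  assumes p: "p \<in> cycles_332 S"
  shows "card {z. matching S z \<and> p \<circ> z = z \<circ> p} \<le> 3"
proof -
  let ?M = "{z. matching S z \<and> p \<circ> z = z \<circ> p}"
  note perm = cycles_permutes(3)[OF p]
  note f = fixed_profile_cycles(3)[OF S p]
  let ?F2 = "fixed S p 2" and ?F3 = "fixed S p 3"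
  have fin: "finite ?F2" "finite ?F3" using finite_S8[OF S] by simp_all
  have no_fixed: "p i \<noteq> i" if "i \<in> S" for i
  proof -
    have "fixed S p 1 = {}" using f finite_S8[OF S] by simp
    then show ?thesis using that by (auto simp: fixed_def)
  qed
  have disj: "?F2 \<inter> ?F3 = {}"
  proof (rule equals0I)
    fix i assume "i \<in> ?F2 \<inter> ?F3"
    then have "i \<in> S" "p (p i) = i" "p (p (p i)) = i"
      by (auto simp: fixed_def numeral_2_eq_2 numeral_3_eq_3)
    then show False using no_fixed by metis
  qed
  obtain a where a: "a \<in> ?F3" using f by fastforce
  then have aS: "a \<in> S" and ppp: "p (p (p a)) = a" by (auto simp: fixed_def numeral_3_eq_3)
  let ?A = "{a, p a, p (p a)}"
  have pS: "p a \<in> S" "p (p a) \<in> S" using permutes_in_image[OF perm] aS by simp_all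
  have "p a \<noteq> a" "p (p a) \<noteq> p a" "p (p a) \<noteq> a"
    using no_fixed[OF aS] no_fixed[OF pS(1)] ppp by metis+
  then have cardA: "card ?A = 3" by simp
  have AF3: "?A \<subseteq> ?F3" using a ppp pS by (simp add: fixed_def numeral_3_eq_3)
  have za: "z a \<in> ?F3 - ?A" if z: "z \<in> ?M" for z
  proof -
    have m: "matching S z" and c: "p \<circ> z = z \<circ> p" using z by blast+
    have comm: "p (z i) = z (p i)" for i using fun_cong[OF c, of i] by simp
    have zz: "z (z i) = i" for i using matching_apply[OF m] .
    have "z a \<noteq> a" "z a \<in> ?F3" using matching_fixed[OF c m a] by blast+
    moreover have "z a \<noteq> p a"
      using comm zz ppp no_fixed aS by metis
    moreover have "z a \<noteq> p (p a)"
      using comm zz ppp no_fixed aS by metis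
    ultimately show ?thesis by blast
  qed
  have "inj_on (\<lambda>z. z a) ?M"
  proof (rule inj_onI)
    fix z w assume zw: "z \<in> ?M" "w \<in> ?M" "z a = w a"
    \<comment> \<open>The set of agreement is a union of cycles of \<open>p\<close>. It contains the
      3-cycle of \<open>a\<close>, the point \<open>z a\<close> and the 2-cycle, so its complement
      has at most two points; no such nonempty union of cycles remains.\<close>
    define E where "E = {i \<in> S. z i = w i}"
    have m: "matching S z" "matching S w" and c: "p \<circ> z = z \<circ> p" "p \<circ> w = w \<circ> p"
      using zw(1,2) by blast+
    have comm: "p (z i) = z (p i)" "p (w i) = w (p i)" for i
      using fun_cong[OF c(1), of i] fun_cong[OF c(2), of i] by simp_all
    have ES: "E \<subseteq> S" and finE: "finite E" using finite_S8[OF S] by (auto simp: E_def)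
    have pE: "p i \<in> E" if "i \<in> E" for i
      using that comm permutes_in_image[OF perm] by (auto simp: E_def) metis
    then have "p ` E = E"
      using card_subset_eq[OF finE _ card_image[OF permutes_inj_on[OF perm]]] by blast
    then have inv: "p ` (S - E) = S - E"
      using image_set_diff[OF permutes_inj[OF perm], of S E] permutes_image[OF perm] by simp
    have "a \<in> E" using zw(3) aS by (simp add: E_def)
    then have "?A \<subseteq> E" using pE by blast
    moreover have "z a \<in> E"
    proof -
      have "w (w a) = a" "z (z a) = a" using matching_apply[OF m(1), of a] matching_apply[OF m(2), of a] by simp_all
      then have "z (z a) = w (z a)" using zw(3) by simp
      moreover have "z a \<in> S" using za[OF zw(1)] fixed_subset by fast
      ultimately show ?thesis by (simp add: E_def)
    qed
    moreover have F2E: "?F2 \<subseteq> E"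
    proof
      fix e assume e: "e \<in> ?F2"
      have mem: "z e \<in> ?F2 - {e}" "w e \<in> ?F2 - {e}"
        using matching_fixed[OF c(1) m(1) e] matching_fixed[OF c(2) m(2) e] by blast+
      have "card (?F2 - {e}) = 1" using e f fin by simp
      then have "z e = w e" using mem by (metis card_1_singletonE singletonD)
      then show "e \<in> E" using e by (simp add: E_def fixed_def)
    qed
    ultimately have sub: "insert (z a) ?A \<union> ?F2 \<subseteq> E" by blast
    have "card (insert (z a) ?A) = 4" using za[OF zw(1)] cardA by (subst card_insert_disjoint) auto
    moreover have "insert (z a) ?A \<inter> ?F2 = {}" using za[OF zw(1)] AF3 disj by blast
    ultimately have "card (insert (z a) ?A \<union> ?F2) = 6"
      using f fin by (subst card_Un_disjoint) auto
    then have "card E \<ge> 6" using card_mono[OF finE sub] by simp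
    then have le2: "card (S - E) \<le> 2" using ES S finE by (simp add: card_Diff_subset)
    have "card (S - E) \<noteq> 1" using invariant_cycles_332(1)[OF S p _ inv refl] by blast
    moreover have "card (S - E) \<noteq> 2"
    proof
      assume 2: "card (S - E) = 2"
      then have "S - E = ?F2" using invariant_cycles_332(2)[OF S p _ inv 2] by blast
      then have "S - E = {}" using F2E by blast
      with 2 show False by simp
    qed
    ultimately have "card (S - E) = 0" using le2 by linarith
    then have "S \<subseteq> E" using finite_S8[OF S] by simp
    then have "z i = w i" if "i \<in> S" for i using that by (auto simp: E_def)
    moreover have "z i = w i" if "i \<notin> S" for i
      using that m permutes_not_in unfolding matching_def by metis
    ultimately show "z = w" by blast
  qed
  moreover have "(\<lambda>z. z a) ` ?M \<subseteq> ?F3 - ?A" by (rule image_subsetI) (rule za)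
  ultimately have "card ?M \<le> card (?F3 - ?A)" using fin by (intro card_inj_on_le) auto
  also have "\<dots> = 3" using AF3 cardA f fin by (simp add: card_Diff_subset)
  finally show ?thesis .
qed

end

section \<open>Weights of proper subgroups\<close>

definition ratio :: "('a \<Rightarrow> 'a) set \<Rightarrow> ('a \<Rightarrow> 'a) set \<Rightarrow> real"
  where "ratio X H = real (card (X \<inter> H)) / real (card X)"

definition weight :: "'a set \<Rightarrow> ('a \<Rightarrow> 'a) set \<Rightarrow> real"
  where "weight S H = 35 * ratio (cycles_8 S) H + 8 * ratio (cycles_521 S) H
    + 20 * ratio (cycles_332 S) H + ratio (cycles_53 S) H"

lemma ratio_empty: "X \<inter> H = {} \<Longrightarrow> ratio X H = 0"
  by (simp add: ratio_def)

text \<open>For empty \<open>X\<close> the quotient is a division by zero, which yields 0 and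
  satisfies the bound.\<close>

lemma ratio_le:
  assumes "card (X \<inter> H) * N \<le> m * card X" "N > 0"
  shows "ratio X H \<le> real m / real N"
proof (cases "card X = 0")
  case False
  have "real (card (X \<inter> H)) * real N \<le> real m * real (card X)"
    using assms(1) by (metis of_nat_le_iff of_nat_mult)
  then show ?thesis
    using False assms(2) by (simp add: ratio_def divide_simps)
qed (simp add: ratio_def)

lemma ratio_le_card:
  assumes "card Y * N \<le> m * card X" "N > 0" "X \<inter> H \<subseteq> Y" "Y \<subseteq> X" "finite X"
  shows "ratio X H \<le> real m / real N"
proof -
  have "card (X \<inter> H) \<le> card Y"
    using assms(3-5) finite_subset by (intro card_mono) auto
  then have "card (X \<inter> H) * N \<le> m * card X"
    using assms(1) by (meson mult_le_mono1 order_trans)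
  then show ?thesis using assms(2) by (rule ratio_le)
qed

lemma ratio_le_1: "finite X \<Longrightarrow> ratio X H \<le> 1"
  using ratio_le_card[of X 1 1 X H] by simp

lemma finite_conj_invariant: "conj_invariant S X \<Longrightarrow> finite S \<Longrightarrow> finite X"
  using finite_permutations[of S] finite_subset by (auto simp: conj_invariant_def)

lemma card_le_0I: "(\<And>y. y \<in> Y \<Longrightarrow> False) \<Longrightarrow> card Y \<le> 0"
  by (metis card.empty equals0I order_refl)

context
  fixes S :: "'a set"
  assumes S: "card S = 8"
begin

lemmas finite_cycles = conj_invariant_cycles[THEN finite_conj_invariant, OF finite_S8[OF S]]

lemma ratio_stabilizer:
  assumes X: "conj_invariant S X" and A: "A \<subseteq> S" "card A = k" "\<forall>h\<in>H. h ` A = A"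
    and m: "\<And>p. p \<in> X \<Longrightarrow> card {B. B \<subseteq> S \<and> card B = k \<and> p ` B = B} \<le> m"
  shows "ratio X H \<le> real m / real (8 choose k)"
proof (rule ratio_le_card[where Y = "{p \<in> X. p ` A = A}"])
  show "card {p \<in> X. p ` A = A} * (8 choose k) \<le> m * card X"
    using card_class_stabilizer_le[OF finite_S8[OF S] X A(1,2) m] S by simp
  have "k \<le> 8" using card_mono[OF finite_S8[OF S] A(1)] A(2) S by simp
  then show "0 < (8 choose k)" by (rule zero_less_binomial)
qed (use A(3) finite_conj_invariant[OF X finite_S8[OF S]] in auto)

text \<open>The bounds obtained for sizes 1 to 4 are 8/8, (8 + 20)/28, (8 + 2 * 20 + 1)/56 = 49/56
  and 0. The first two show that neither 8 nor the sum 8 + 20 can be increased.\<close>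

lemma weight_stabilizer:
  assumes A: "A \<subseteq> S" "card A = k" "k \<in> {1, 2, 3, 4}" and H: "\<forall>h\<in>H. h ` A = A"
  shows "weight S H \<le> 1"
proof -
  let ?I = "\<lambda>p. {B. B \<subseteq> S \<and> card B = k \<and> p ` B = B}"
  note ratio = ratio_stabilizer[OF conj_invariant_cycles(1) A(1,2) H]
    ratio_stabilizer[OF conj_invariant_cycles(2) A(1,2) H]
    ratio_stabilizer[OF conj_invariant_cycles(3) A(1,2) H]
    ratio_stabilizer[OF conj_invariant_cycles(4) A(1,2) H]
  have choose: "(8::nat) choose 1 = 8" "(8::nat) choose 2 = 28" "(8::nat) choose 3 = 56" "(8::nat) choose 4 = 70"
    by (simp_all add: numeral_eq_Suc)
  have "card (?I p) \<le> 0" if "p \<in> cycles_8 S" for p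
    using no_invariant_cycles_8[OF S that] A(3) by (intro card_le_0I) blast
  from ratio(1)[OF this] have r8: "ratio (cycles_8 S) H \<le> 0" by simp
  consider "k = 1" | "k = 2" | "k = 3" | "k = 4" using A(3) by blast
  then show ?thesis
  proof cases
    case 1
    have "card (?I p) \<le> 1" if "p \<in> cycles_521 S" for p
      using invariant_cycles_521(1)[OF S that _ _ _ 1] by (intro card_le_1I) blast
    from ratio(2)[OF this] have "ratio (cycles_521 S) H \<le> 1 / 8" using 1 choose by simp
    moreover have "card (?I p) \<le> 0" if "p \<in> cycles_332 S" for p
      using invariant_cycles_332(1)[OF S that] 1 by (intro card_le_0I) blast
    from ratio(3)[OF this] have "ratio (cycles_332 S) H \<le> 0" by simp
    moreover have "card (?I p) \<le> 0" if "p \<in> cycles_53 S" for p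
      using invariant_cycles_53(1)[OF S that] 1 by (intro card_le_0I) blast
    from ratio(4)[OF this] have "ratio (cycles_53 S) H \<le> 0" by simp
    ultimately show ?thesis using r8 unfolding weight_def by linarith
  next
    case 2
    have "card (?I p) \<le> 1" if "p \<in> cycles_521 S" for p
      using invariant_cycles_521(2)[OF S that _ _ _ 2] by (intro card_le_1I) blast
    from ratio(2)[OF this] have "ratio (cycles_521 S) H \<le> 1 / 28" using 2 choose by simp
    moreover have "card (?I p) \<le> 1" if "p \<in> cycles_332 S" for p
      using invariant_cycles_332(2)[OF S that _ _ _ 2] by (intro card_le_1I) blast
    from ratio(3)[OF this] have "ratio (cycles_332 S) H \<le> 1 / 28" using 2 choose by simp
    moreover have "card (?I p) \<le> 0" if "p \<in> cycles_53 S" for p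
      using invariant_cycles_53(2)[OF S that] 2 by (intro card_le_0I) blast
    from ratio(4)[OF this] have "ratio (cycles_53 S) H \<le> 0" by simp
    ultimately show ?thesis using r8 unfolding weight_def by linarith
  next
    case 3
    have "card (?I p) \<le> 1" if "p \<in> cycles_521 S" for p
      using invariant_cycles_521(3)[OF S that _ _ _ 3] by (intro card_le_1I) blast
    from ratio(2)[OF this] have "ratio (cycles_521 S) H \<le> 1 / 56" using 3 choose by simp
    moreover have "card (?I p) \<le> 2" if "p \<in> cycles_332 S" for p
      using card_invariant_triples_332[OF S that] 3 by simp
    from ratio(3)[OF this] have "ratio (cycles_332 S) H \<le> 2 / 56" using 3 choose by simp
    moreover have "card (?I p) \<le> 1" if "p \<in> cycles_53 S" for p
      using invariant_cycles_53(3)[OF S that _ _ _ 3] by (intro card_le_1I) blast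
    from ratio(4)[OF this] have "ratio (cycles_53 S) H \<le> 1 / 56" using 3 choose by simp
    ultimately show ?thesis using r8 unfolding weight_def by linarith
  next
    case 4
    have "card (?I p) \<le> 0" if "p \<in> cycles_521 S" for p
      using invariant_cycles_521(4)[OF S that] 4 by (intro card_le_0I) blast
    from ratio(2)[OF this] have "ratio (cycles_521 S) H \<le> 0" by simp
    moreover have "card (?I p) \<le> 0" if "p \<in> cycles_332 S" for p
      using invariant_cycles_332(4)[OF S that] 4 by (intro card_le_0I) blast
    from ratio(3)[OF this] have "ratio (cycles_332 S) H \<le> 0" by simp
    moreover have "card (?I p) \<le> 0" if "p \<in> cycles_53 S" for p
      using invariant_cycles_53(4)[OF S that] 4 by (intro card_le_0I) blast
    from ratio(4)[OF this] have "ratio (cycles_53 S) H \<le> 0" by simp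
    ultimately show ?thesis using r8 unfolding weight_def by linarith
  qed
qed

lemma weight_bisection:
  assumes A: "A \<subseteq> S" "card A = 4" and H: "\<And>h. h \<in> H \<Longrightarrow> h ` A = A \<or> h ` A = S - A"
  shows "weight S H \<le> 1"
proof -
  have "ratio (cycles_8 S) H \<le> real 2 / real 70"
  proof (rule ratio_le_card[where Y = "{p \<in> cycles_8 S. p ` A = A \<or> p ` A = S - A}"])
    show "card {p \<in> cycles_8 S. p ` A = A \<or> p ` A = S - A} * 70 \<le> 2 * card (cycles_8 S)"
      using card_class_bisection_le[OF finite_S8[OF S] conj_invariant_cycles(1) A card_bisections_cycles_8[OF S]] S
      by (simp add: numeral_eq_Suc)
  qed (use H finite_cycles in auto)
  moreover have "ratio (cycles_521 S) H = 0" "ratio (cycles_332 S) H = 0" "ratio (cycles_53 S) H = 0"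
    by (rule ratio_empty, use no_bisection[OF S _ A] H in blast)+
  ultimately show ?thesis unfolding weight_def by simp
qed

text \<open>The bound is (35 + 3 * 20)/105 = 95/105.\<close>

lemma weight_matching:
  assumes y: "matching S y" and H: "\<And>h. h \<in> H \<Longrightarrow> h \<circ> y = y \<circ> h"
  shows "weight S H \<le> 1"
proof -
  have "ratio (cycles_8 S) H \<le> real 1 / real 105"
  proof (rule ratio_le_card[where Y = "{p \<in> cycles_8 S. p \<circ> y = y \<circ> p}"])
    show "card {p \<in> cycles_8 S. p \<circ> y = y \<circ> p} * 105 \<le> 1 * card (cycles_8 S)"
      by (rule card_class_matching_le[OF S conj_invariant_cycles(1) y card_matchings_cycles_8[OF S]])
    show "cycles_8 S \<inter> H \<subseteq> {p \<in> cycles_8 S. p \<circ> y = y \<circ> p}" using H by blast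
  qed (use finite_cycles in auto)
  moreover have "ratio (cycles_332 S) H \<le> real 3 / real 105"
  proof (rule ratio_le_card[where Y = "{p \<in> cycles_332 S. p \<circ> y = y \<circ> p}"])
    show "card {p \<in> cycles_332 S. p \<circ> y = y \<circ> p} * 105 \<le> 3 * card (cycles_332 S)"
      by (rule card_class_matching_le[OF S conj_invariant_cycles(3) y card_matchings_cycles_332[OF S]])
    show "cycles_332 S \<inter> H \<subseteq> {p \<in> cycles_332 S. p \<circ> y = y \<circ> p}" using H by blast
  qed (use finite_cycles in auto)
  moreover have "ratio (cycles_521 S) H = 0" "ratio (cycles_53 S) H = 0"
    by (rule ratio_empty, use no_matching[OF S _ y] H in blast)+
  ultimately show ?thesis unfolding weight_def by simp
qed

text \<open>A permutation \<open>g\<close> is determined by the conjugate of \<open>x\<close> under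
  it together with the image of one point, since \<open>x\<close> moves that point through all of
  \<open>S\<close>. Hence 8! is at most eight times the size of the class.\<close>

lemma card_cycles_8_ge:
  assumes x: "x \<in> cycles_8 S"
  shows "card (cycles_8 S) \<ge> 5040"
proof -
  have x8: "eight_cycle S x" using x by (simp add: cycles_8_def)
  obtain a where a: "a \<in> S" using S by fastforce
  let ?f = "\<lambda>g. (g \<circ> x \<circ> inv' g, g a)"
  have "card {g. g permutes S} \<le> card (cycles_8 S \<times> S)"
  proof (rule card_inj_on_le)
    show "inj_on ?f {g. g permutes S}"
    proof (rule inj_onI)
      fix g h assume "g \<in> {g. g permutes S}" "h \<in> {g. g permutes S}" and eq: "?f g = ?f h"
      then have g: "g permutes S" and h: "h permutes S" by auto
      have pow: "g ((x ^^ k) a) = h ((x ^^ k) a)" for k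
      proof -
        have "g \<circ> x ^^ k \<circ> inv' g = h \<circ> x ^^ k \<circ> inv' h"
          using eq funpow_conj[OF permutes_bij[OF g], where p = x and k = k] funpow_conj[OF permutes_bij[OF h], where p = x and k = k] by simp
        then have "(g \<circ> x ^^ k \<circ> inv' g) (g a) = (h \<circ> x ^^ k \<circ> inv' h) (h a)" using eq by simp
        then show ?thesis using permutes_inverses[OF g] permutes_inverses[OF h] by simp
      qed
      have "g i = h i" for i
      proof (cases "i \<in> S")
        case True
        then obtain k where "i = (x ^^ k) a"
          using eight_cycle(3)[OF x8 S a] by (auto simp: bij_betw_def)
        then show ?thesis using pow by simp
      qed (use g h permutes_not_in in metis)
      then show "g = h" by blast
    qed
    show "?f ` {g. g permutes S} \<subseteq> cycles_8 S \<times> S"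
      using conj_invariant_cycles(1)[of S] x a permutes_in_image by (fastforce simp: conj_invariant_def)
    show "finite (cycles_8 S \<times> S)" using finite_cycles finite_S8[OF S] by blast
  qed
  then have "fact 8 \<le> card (cycles_8 S) * 8"
    using card_permutations[OF S finite_S8[OF S]] S by (simp add: card_cartesian_product)
  then show ?thesis by (simp add: fact_numeral)
qed

end

context perm_group
begin

text \<open>Powers expose short cycles: the fifth power of type 5 + 2 + 1 and the third of type 3 +
  3 + 2 are transpositions, the fifth power of type 5 + 3 is a 3-cycle.\<close>

lemma weight_primitive:
  assumes S: "card S = 8" and prim: primitive and proper: "H \<noteq> {p. p permutes S}"
  shows "weight S H \<le> 1"
proof -
  have card_moved: "card (moved h) = 8 - card (fixed S h 1)" if "h \<in> H" for h
  proof -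
    have "moved h = S - fixed S h 1"
      using moved_subset[OF permutes[OF that]] by (auto simp: fixed_def moved_def)
    then show ?thesis using S finite_S fixed_subset[of S h 1] by (simp add: card_Diff_subset)
  qed
  have fixed_pow: "fixed S (h ^^ k) 1 = fixed S h k" for h k by (simp add: fixed_def)
  have no_transposition: "card (moved h) \<noteq> 2" if h: "h \<in> H" for h
  proof
    assume "card (moved h) = 2"
    then obtain a b where ab: "a \<noteq> b" "h = transpose a b"
      using moved_card_2 inj[OF h] by blast
    then have "a \<in> S" "b \<in> S" using moved_subset[OF permutes[OF h]] by (auto simp: moved_def)
    then have "p \<in> H" if "p permutes S" for p
      using primitive_transpose[OF prim _ _ ab(1)] ab(2) h that by blast
    then show False using proper permutes by blast
  qed
  have "cycles_521 S \<inter> H = {}"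
  proof (rule equals0I)
    fix p assume p: "p \<in> cycles_521 S \<inter> H"
    then have "card (fixed S (p ^^ 5) 1) = 6" unfolding fixed_pow by (simp add: cycles_521_def)
    moreover have "p ^^ 5 \<in> H" using funpow_closed p by blast
    ultimately show False using card_moved[of "p ^^ 5"] no_transposition[of "p ^^ 5"] by simp
  qed
  moreover have "cycles_332 S \<inter> H = {}"
  proof (rule equals0I)
    fix p assume p: "p \<in> cycles_332 S \<inter> H"
    then have "card (fixed S (p ^^ 3) 1) = 6" unfolding fixed_pow by (simp add: cycles_332_def)
    moreover have "p ^^ 3 \<in> H" using funpow_closed p by blast
    ultimately show False using card_moved[of "p ^^ 3"] no_transposition[of "p ^^ 3"] by simp
  qed
  moreover have "35 * ratio (cycles_8 S) H + ratio (cycles_53 S) H \<le> 1"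
  \<comment> \<open>Without 8-cycles only type 5 + 3 counts, with weight at most 1, as for the
    alternating group. With an 8-cycle that type disappears and 35 * 84 / 5040 = 7/12
    remains.\<close>
  proof (cases "cycles_8 S \<inter> H = {}")
    case True
    then show ?thesis using ratio_empty[OF True] ratio_le_1[OF finite_cycles(4)[OF S]] by simp
  next
    case False
    then obtain x where xH: "x \<in> H" "x \<in> cycles_8 S" by blast
    interpret primitive_8 S H x
      by unfold_locales (use S prim proper xH in \<open>auto simp: cycles_8_def\<close>)
    have "cycles_53 S \<inter> H = {}"
    proof (rule equals0I)
      fix p assume p: "p \<in> cycles_53 S \<inter> H"
      then have 5: "card (fixed S (p ^^ 5) 1) = 5" unfolding fixed_pow by (simp add: cycles_53_def)
      moreover have "p ^^ 5 \<in> H" using funpow_closed p by blast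
      ultimately have "p ^^ 5 = id" using small_support[of "p ^^ 5"] card_moved[of "p ^^ 5"] by simp
      then show False using 5 S by (simp add: fixed_def)
    qed
    moreover have "ratio (cycles_8 S) H \<le> real 84 / real 5040"
    proof (rule ratio_le)
      have "cycles_8 S \<inter> H = {h \<in> H. eight_cycle S h}" by (auto simp: cycles_8_def)
      then have "card (cycles_8 S \<inter> H) * 5040 \<le> 84 * 5040"
        using card_eight_cycles_le by simp
      also have "\<dots> \<le> 84 * card (cycles_8 S)" using card_cycles_8_ge[OF S xH(2)] by simp
      finally show "card (cycles_8 S \<inter> H) * 5040 \<le> 84 * card (cycles_8 S)" .
    qed simp
    ultimately show ?thesis by (simp add: ratio_empty)
  qed
  ultimately show ?thesis by (simp add: weight_def ratio_empty)
qed

text \<open>By transitivity the classes of an invariant equivalence have equal size, a divisor of 8,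
  and the sizes 1 and 8 belong to the trivial relations. Size 2 gives a matching centralized by
  \<open>H\<close>, size 4 a bisection preserved by \<open>H\<close>.\<close>

lemma weight_imprimitive:
  assumes S: "card S = 8" and trans: transitive and imprim: "\<not> primitive"
  shows "weight S H \<le> 1"
proof -
  obtain R where R: "equiv S R" "\<And>h a b. h \<in> H \<Longrightarrow> (a, b) \<in> R \<Longrightarrow> (h a, h b) \<in> R"
    "R \<noteq> Id_on S" "R \<noteq> S \<times> S"
    using imprim unfolding primitive_def invariant_equiv_def by blast
  have RS: "R `` {a} \<subseteq> S" for a using R(1) by (auto simp: equiv_def refl_on_def)
  have Sigma: "R = (SIGMA b:S. R `` {b})" using equiv_type[OF R(1)] by auto
  have fin: "finite (R `` {a})" for a using RS finite_S finite_subset by blast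
  have self: "a \<in> R `` {a}" if "a \<in> S" for a using R(1) that by (rule equiv_class_self)
  have image: "h ` (R `` {a}) = R `` {h a}" if h: "h \<in> H" for h a
  proof (rule Set.set_eqI, rule iffI)
    fix b assume "b \<in> R `` {h a}"
    then have "(inv' h (h a), inv' h b) \<in> R" using R(2)[OF inv_closed[OF h]] by blast
    then have "inv' h b \<in> R `` {a}" using h by simp
    then show "b \<in> h ` (R `` {a})" using h by (intro image_eqI[where x = "inv' h b"]) simp_all
  qed (use R(2) h in auto)
  obtain a where a: "a \<in> S" using S by fastforce
  have same_card: "card (R `` {b}) = card (R `` {a})" if "b \<in> S" for b
  proof -
    obtain h where h: "h \<in> H" "h a = b" using trans a \<open>b \<in> S\<close> unfolding transitive_def by blast
    then show ?thesis
      using image[OF h(1), of a] card_image[OF inj_on_subset[OF inj[OF h(1)] subset_UNIV], of "R `` {a}"] by simp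
  qed
  have "card (R `` {a}) * card (S // R) = card (\<Union>(S // R))"
  proof (rule card_partition)
    show "finite (S // R)" using finite_quotient[OF finite_S] R(1) by (auto simp: equiv_def)
    show "finite (\<Union>(S // R))" using Union_quotient[OF R(1)] finite_S by simp
    show "card c = card (R `` {a})" if "c \<in> S // R" for c using that same_card by (auto elim!: quotientE)
    show "c1 \<inter> c2 = {}" if "c1 \<in> S // R" "c2 \<in> S // R" "c1 \<noteq> c2" for c1 c2
      using quotient_disj[OF R(1) that(1,2)] that(3) by blast
  qed
  then have "card (R `` {a}) dvd 8" using Union_quotient[OF R(1)] S by (metis dvd_triv_left)
  moreover have "d = 1 \<or> d = 2 \<or> d = 4 \<or> d = 8" if "d dvd 8" for d :: nat
  proof -
    have "d \<le> 8" using that by (auto dest: dvd_imp_le)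
    then consider "d = 0" | "d = 1" | "d = 2" | "d = 3" | "d = 4" | "d = 5" | "d = 6" | "d = 7" | "d = 8"
      by linarith
    then show ?thesis using that by cases simp_all
  qed
  moreover have "card (R `` {a}) \<noteq> 1"
  proof
    assume 1: "card (R `` {a}) = 1"
    have cls: "R `` {b} = {b}" if "b \<in> S" for b
      using same_card[OF that] 1 self[OF that] by (metis card_1_singletonE singletonD)
    have "(SIGMA b:S. R `` {b}) = Id_on S" unfolding Id_on_def using cls by (simp add: Sigma_def)
    then have "R = Id_on S" using Sigma by simp
    then show False using R(3) by blast
  qed
  moreover have "card (R `` {a}) \<noteq> 8"
  proof
    assume 8: "card (R `` {a}) = 8"
    have cls: "R `` {b} = S" if "b \<in> S" for b
      using same_card[OF that] 8 RS finite_S S by (intro card_subset_eq) auto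
    have "(SIGMA b:S. R `` {b}) = S \<times> S" using cls by (intro Sigma_cong) auto
    then have "R = S \<times> S" using Sigma by simp
    then show False using R(4) by blast
  qed
  ultimately consider "card (R `` {a}) = 2" | "card (R `` {a}) = 4" by blast
  then show ?thesis
  proof cases
    case 1
    \<comment> \<open>The partner of \<open>i\<close> in its two-element class; the identity outside
      \<open>S\<close> makes \<open>y\<close> a permutation of \<open>S\<close>.\<close>
    define y where "y i = (if i \<in> S then (THE j. j \<in> R `` {i} \<and> j \<noteq> i) else i)" for i
    have y: "y i \<noteq> i \<and> R `` {i} = {i, y i}" if i: "i \<in> S" for i
    proof -
      have "card (R `` {i} - {i}) = 1" using same_card[OF i] 1 self[OF i] fin by simp
      then obtain j where "R `` {i} - {i} = {j}" by (elim card_1_singletonE)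
      then have j: "R `` {i} = {i, j}" "j \<noteq> i" using self[OF i] by blast+
      have "(THE j. j \<in> R `` {i} \<and> j \<noteq> i) = j" using j by (intro the_equality) auto
      then show ?thesis using j i by (simp add: y_def)
    qed
    have yS: "y i \<in> S" if "i \<in> S" for i using y[OF that] RS by blast
    have yI: "y i = j" if "i \<in> S" "(i, j) \<in> R" "j \<noteq> i" for i j
      using y[OF that(1)] that(2,3) by blast
    have yR: "(i, y i) \<in> R" if "i \<in> S" for i using y[OF that] by blast
    have yy: "y (y i) = i" for i
    proof (cases "i \<in> S")
      case True
      have "(y i, i) \<in> R" using yR[OF True] R(1) by (auto simp: equiv_def dest: symD)
      then show ?thesis using yI[OF yS[OF True]] y[OF True] by metis
    qed (simp add: y_def)
    have "matching S y"
    proof -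
      have "bij_betw y S S" by (rule bij_betwI[where g = y]) (use yS yy in auto)
      then have "y permutes S" by (rule bij_imp_permutes) (simp add: y_def)
      then show ?thesis using y yy by (auto simp: matching_def fun_eq_iff)
    qed
    moreover have "h \<circ> y = y \<circ> h" if h: "h \<in> H" for h
    proof
      fix i show "(h \<circ> y) i = (y \<circ> h) i"
      proof (cases "i \<in> S")
        case True
        have "h (y i) \<noteq> h i" using y[OF True] inj[OF h] by (simp add: inj_eq)
        then have "y (h i) = h (y i)" using yI[of "h i" "h (y i)"] R(2)[OF h yR[OF True]] in_S_iff[OF h] True by blast
        then show ?thesis by simp
      next
        case False
        then show ?thesis using permutes_not_in[OF permutes[OF h]] by (simp add: y_def)
      qed
    qed
    ultimately show ?thesis by (rule weight_matching[OF S])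
  next
    case 2
    have "h ` (R `` {a}) = R `` {a} \<or> h ` (R `` {a}) = S - R `` {a}" if h: "h \<in> H" for h
    proof (cases "(a, h a) \<in> R")
      case True
      then show ?thesis using image[OF h, of a] equiv_class_eq[OF R(1) True] by simp
    next
      case False
      have ha: "h a \<in> S" using in_S_iff[OF h] a by blast
      have "R `` {h a} \<inter> R `` {a} = {}"
      proof (rule equals0I)
        fix c assume "c \<in> R `` {h a} \<inter> R `` {a}"
        then have "(h a, c) \<in> R" "(a, c) \<in> R" by auto
        moreover have "sym R" "trans R" using R(1) by (auto elim: equivE)
        ultimately show False using False by (meson symD transD)
      qed
      then have "R `` {h a} = S - R `` {a}"
        using RS same_card[OF ha] 2 S finite_S fin by (intro card_subset_eq) (auto simp: card_Diff_subset)
      then show ?thesis using image[OF h, of a] by simp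
    qed
    then show ?thesis by (rule weight_bisection[OF S RS 2])
  qed
qed

text \<open>An orbit and its complement are both invariant, and one of them has at most four
  points.\<close>

lemma weight_intransitive:
  assumes S: "card S = 8" and intrans: "\<not> transitive"
  shows "weight S H \<le> 1"
proof -
  obtain a b where ab: "a \<in> S" "b \<in> S" "\<And>h. h \<in> H \<Longrightarrow> h a \<noteq> b"
    using intrans unfolding transitive_def by blast
  define A where "A = (\<lambda>h. h a) ` H"
  have AS: "A \<subseteq> S" using in_S_iff ab(1) by (auto simp: A_def)
  have fin: "finite A" using AS finite_S finite_subset by blast
  have ne: "A \<noteq> {}" "A \<noteq> S" using id_closed ab by (auto simp: A_def)
  have inv: "h ` A = A" if h: "h \<in> H" for h
  proof -
    have "h ` A \<subseteq> A"
    proof (rule image_subsetI)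
      fix i assume "i \<in> A"
      then obtain g where g: "g \<in> H" "i = g a" by (auto simp: A_def)
      then have "h i = (h \<circ> g) a" by simp
      then show "h i \<in> A" using comp_closed[OF h g(1)] unfolding A_def by blast
    qed
    then show ?thesis
      using card_subset_eq[OF fin] card_image[OF inj_on_subset[OF inj[OF h] subset_UNIV]] by metis
  qed
  have inv': "h ` (S - A) = S - A" if h: "h \<in> H" for h
    using image_set_diff[OF inj[OF h], of S A] permutes_image[OF permutes[OF h]] inv[OF h] by simp
  have "card A \<noteq> 0" using ne fin by simp
  moreover have "card A < 8" using psubset_card_mono[OF finite_S] AS ne(2) S by (metis psubsetI)
  moreover have "card (S - A) = 8 - card A" using AS fin S by (simp add: card_Diff_subset)
  ultimately have "card A \<in> {1, 2, 3, 4} \<or> card (S - A) \<in> {1, 2, 3, 4}"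
    by auto
  then consider "card A \<in> {1, 2, 3, 4}" | "card (S - A) \<in> {1, 2, 3, 4}"
    by blast
  then show ?thesis
  proof cases
    case 1
    then show ?thesis using weight_stabilizer[OF S AS refl] inv by simp
  next
    case 2
    then show ?thesis using weight_stabilizer[OF S Diff_subset refl] inv' by simp
  qed
qed

theorem weight_proper_le_1:
  assumes "card S = 8" "H \<noteq> {p. p permutes S}"
  shows "weight S H \<le> 1"
  using weight_primitive weight_imprimitive weight_intransitive assms by blast

end

section \<open>The covering number\<close>

lemma image_fixed:
  assumes "p permutes S" "finite S"
  shows "p ` fixed S p k = fixed S p k"
proof (rule card_subset_eq)
  show "p ` fixed S p k \<subseteq> fixed S p k"
    using permutes_in_image[OF assms(1)] by (auto simp: fixed_def funpow_swap1[symmetric])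
qed (use assms card_image[OF permutes_inj_on[OF assms(1)]] in auto)

text \<open>By the table an odd permutation has two fixed points, or a 2-cycle, or type 4 + 3 + 1,
  where the 3-cycle with the fixed point forms an invariant 4-set, or it is an 8-cycle, which
  exchanges the even and the odd positions.\<close>

lemma odd_permutation_invariant:
  assumes S: "card S = 8" and p: "p permutes S" "\<not> evenperm p"
  shows "(\<exists>A\<subseteq>S. card A = 2 \<and> p ` A = A) \<or> (\<exists>A\<subseteq>S. card A = 4 \<and> (p ` A = A \<or> p ` A = S - A))"
proof -
  note fin = finite_S8[OF S]
  have "card (fixed S p 1) \<ge> 2 \<or> card (fixed S p 2) > card (fixed S p 1) \<or> card (fixed S p 3) = 4
      \<or> card (fixed S p 3) = 0 \<and> card (fixed S p 4) = 0"
    using fixed_profile_8[OF p(1) S] by (elim insertE emptyE) (use p(2) in simp_all)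
  then consider "card (fixed S p 1) \<ge> 2" | "card (fixed S p 2) > card (fixed S p 1)"
    | "card (fixed S p 3) = 4" | "card (fixed S p 3) = 0" "card (fixed S p 4) = 0" by linarith
  then show ?thesis
  proof cases
    case 1
    then obtain A where A: "A \<subseteq> fixed S p 1" "card A = 2"
      by (rule obtain_subset_with_card_n)
    then have "p ` A = A" by (force simp: fixed_def)
    then show ?thesis using A fixed_subset[of S p 1] by blast
  next
    case 2
    then have "\<not> fixed S p 2 \<subseteq> fixed S p 1"
      using card_mono[of "fixed S p 1" "fixed S p 2"] fin by auto
    then obtain i where "i \<in> S" "p (p i) = i" "p i \<noteq> i" by (auto simp: fixed_def numeral_2_eq_2)
    then have "{i, p i} \<subseteq> S" "card {i, p i} = 2" "p ` {i, p i} = {i, p i}"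
      using permutes_in_image[OF p(1)] by auto
    then show ?thesis by blast
  next
    case 3
    then show ?thesis
      by (intro disjI2 exI[of _ "fixed S p 3"] conjI fixed_subset disjI1 image_fixed[OF p(1) fin])
  next
    case 4
    then have p8: "eight_cycle S p" using p fin by (simp add: eight_cycle_def)
    obtain a where a: "a \<in> S" using S by fastforce
    let ?f = "\<lambda>i. (p ^^ i) a"
    have inj_f: "inj_on ?f {..<8}" and S_eq: "S = ?f ` {..<8}"
      using eight_cycle(3)[OF p8 S a] by (auto simp: bij_betw_def)
    let ?A = "?f ` {0, 2, 4, 6}"
    have "p ` ?A = ?f ` {1, 3, 5, 7}" by (simp add: numeral_eq_Suc)
    also have "{1, 3, 5, 7} = {..<8} - {0, 2, 4, 6::nat}" by (auto simp: numeral_eq_Suc less_Suc_eq)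
    also have "?f ` \<dots> = S - ?A"
      unfolding S_eq by (rule inj_on_image_set_diff[OF inj_f]) auto
    finally have "p ` ?A = S - ?A" .
    moreover have "inj_on ?f {0, 2, 4, 6}" by (rule inj_on_subset[OF inj_f]) auto
    then have "card ?A = 4" by (subst card_image) auto
    moreover have "?A \<subseteq> S" unfolding S_eq by (rule image_mono) auto
    ultimately show ?thesis by blast
  qed
qed

text \<open>An empty class would have ratio 0 even in the whole group; all four must be inhabited
  for the total weight to be 64.\<close>

lemma cycles_nonempty:
  "cycles_8 {1..8::nat} \<noteq> {}" "cycles_521 {1..8::nat} \<noteq> {}"
  "cycles_332 {1..8::nat} \<noteq> {}" "cycles_53 {1..8::nat} \<noteq> {}"
proof -
  have perm: "cycle_of_list cs permutes {1..8}" if "set cs \<subseteq> {1..8}" for cs :: "nat list"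
    using permutes_subset[OF cycle_permutes that] .
  let ?cs = "[1..<9::nat]"
  have set: "set ?cs = {1..8}" by auto
  have "fixed {1..8} (cycle_of_list ?cs) k = {}" if "\<not> 8 dvd k" for k
  proof (rule equals0I)
    fix i assume "i \<in> fixed {1..8} (cycle_of_list ?cs) k"
    then have "i \<in> set ?cs" "(cycle_of_list ?cs ^^ k) i = i" unfolding set by (simp_all add: fixed_def)
    then have "length ?cs dvd k" using funpow_cycle_of_list_eq[OF distinct_upt] by blast
    then show False using that by simp
  qed
  then have "cycle_of_list ?cs \<in> cycles_8 {1..8}"
    using perm[of ?cs] set by (simp add: cycles_8_def eight_cycle_def del: upt_conv_Cons)
  then show "cycles_8 {1..8::nat} \<noteq> {}" by blast
  have card_fixed: "card (fixed {1..8} p k) = (let f = \<lambda>i. if (p ^^ k) i = i then 1 else 0 in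
      f 1 + f 2 + f 3 + f 4 + f 5 + f 6 + f 7 + f 8)" for p :: "nat \<Rightarrow> nat" and k
  proof -
    have "card (fixed {1..8} p k) = (\<Sum>i=1..8. if (p ^^ k) i = i then 1 else 0)"
      by (simp add: fixed_def sum.If_cases Int_def)
    also have "(\<Sum>i=1..8. f i) = f 1 + f 2 + f 3 + f 4 + f 5 + f 6 + f 7 + f 8" for f :: "nat \<Rightarrow> nat"
      by (simp add: numeral_eq_Suc)
    finally show ?thesis by (simp add: Let_def)
  qed
  have pow: "p ^^ 1 = p" "p ^^ 2 = (\<lambda>i. p (p i))" "p ^^ 3 = (\<lambda>i. p (p (p i)))"
      "p ^^ 5 = (\<lambda>i. p (p (p (p (p i)))))" for p :: "nat \<Rightarrow> nat"
    by (auto simp: numeral_eq_Suc)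
  define g where "g = (cycle_of_list [1, 2, 3, 4, 5] \<circ> cycle_of_list [6, 7] :: nat \<Rightarrow> nat)"
  have g: "g 1 = 2" "g 2 = 3" "g 3 = 4" "g 4 = 5" "g 5 = 1" "g 6 = 7" "g 7 = 6" "g 8 = 8"
    by (simp_all add: g_def transpose_def)
  have "g permutes {1..8}" unfolding g_def by (intro permutes_compose perm) auto
  moreover have "card (fixed {1..8} g 1) = 1" "card (fixed {1..8} g 2) = 3" "card (fixed {1..8} g 5) = 6"
    unfolding card_fixed pow by (simp_all add: g g[unfolded One_nat_def])
  ultimately show "cycles_521 {1..8::nat} \<noteq> {}" unfolding cycles_521_def by blast
  define h where "h = (cycle_of_list [1, 2, 3] \<circ> cycle_of_list [4, 5, 6] \<circ> cycle_of_list [7, 8] :: nat \<Rightarrow> nat)"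
  have h: "h 1 = 2" "h 2 = 3" "h 3 = 1" "h 4 = 5" "h 5 = 6" "h 6 = 4" "h 7 = 8" "h 8 = 7"
    by (simp_all add: h_def transpose_def)
  have "h permutes {1..8}" unfolding h_def by (intro permutes_compose perm) auto
  moreover have "card (fixed {1..8} h 1) = 0" "card (fixed {1..8} h 2) = 2" "card (fixed {1..8} h 3) = 6"
    unfolding card_fixed pow by (simp_all add: h h[unfolded One_nat_def])
  ultimately show "cycles_332 {1..8::nat} \<noteq> {}" unfolding cycles_332_def by blast
  define u where "u = (cycle_of_list [1, 2, 3, 4, 5] \<circ> cycle_of_list [6, 7, 8] :: nat \<Rightarrow> nat)"
  have u: "u 1 = 2" "u 2 = 3" "u 3 = 4" "u 4 = 5" "u 5 = 1" "u 6 = 7" "u 7 = 8" "u 8 = 6"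
    by (simp_all add: u_def transpose_def)
  have "u permutes {1..8}" unfolding u_def by (intro permutes_compose perm) auto
  moreover have "card (fixed {1..8} u 3) = 3" "card (fixed {1..8} u 5) = 5"
    unfolding card_fixed pow by (simp_all add: u u[unfolded One_nat_def])
  ultimately show "cycles_53 {1..8::nat} \<noteq> {}" unfolding cycles_53_def by blast
qed

lemma ratio_Union_le:
  assumes "finite \<A>" "finite X"
  shows "ratio X (\<Union>\<A>) \<le> (\<Sum>H\<in>\<A>. ratio X H)"
proof -
  have "card (X \<inter> \<Union>\<A>) \<le> (\<Sum>H\<in>\<A>. card (X \<inter> H))"
    unfolding Int_Union by (rule card_UN_le[OF assms(1)])
  then have "real (card (X \<inter> \<Union>\<A>)) \<le> (\<Sum>H\<in>\<A>. real (card (X \<inter> H)))"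
    by (metis of_nat_le_iff of_nat_sum)
  then show ?thesis
    unfolding ratio_def sum_divide_distrib[symmetric] by (rule divide_right_mono) simp
qed

lemma cover_ge_64:
  assumes "subgroup_cover (sym_group 8) \<A>"
  shows "card \<A> \<ge> 64"
proof -
  let ?S = "{1..8::nat}"
  have S: "card ?S = 8" by simp
  have fin: "finite \<A>" and sub: "\<And>H. H \<in> \<A> \<Longrightarrow> subgroup H (sym_group 8) \<and> H \<noteq> carrier (sym_group 8)"
    and Un: "\<Union>\<A> = {p. p permutes ?S}"
    using assms by (auto simp: subgroup_cover_def sym_group_def)
  have weight1: "weight ?S H \<le> 1" if H: "H \<in> \<A>" for H
  proof -
    have sg: "subgroup H (sym_group 8)" using sub H by blast
    interpret perm_group ?S H
    proof
      show "h permutes ?S" if "h \<in> H" for h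
        using subgroup.mem_carrier[OF sg that] by (simp add: sym_group_carrier)
      show "id \<in> H" using subgroup.one_closed[OF sg] by (simp add: sym_group_one)
      show "g \<circ> h \<in> H" if "g \<in> H" "h \<in> H" for g h
        using subgroup.m_closed[OF sg that] by (simp add: sym_group_mult)
      show "inv' h \<in> H" if "h \<in> H" for h
        using subgroup.m_inv_closed[OF sg that] sym_group_inv_equality[OF subgroup.mem_carrier[OF sg that]]
        by simp
    qed simp
    have "H \<noteq> {p. p permutes ?S}" using sub[OF H] by (simp add: sym_group_def)
    then show ?thesis by (rule weight_proper_le_1[OF S])
  qed
  note finX = finite_cycles[OF S]
  have ratio1: "ratio X (\<Union>\<A>) = 1" if "X \<noteq> {}" "finite X" "conj_invariant ?S X" for X
  proof -
    have "X \<inter> \<Union>\<A> = X" using that(3) Un by (auto simp: conj_invariant_def)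
    then show ?thesis using that(1,2) by (simp add: ratio_def)
  qed
  have "64 = weight ?S (\<Union>\<A>)"
    unfolding weight_def
    using ratio1[OF cycles_nonempty(1) finX(1) conj_invariant_cycles(1)]
      ratio1[OF cycles_nonempty(2) finX(2) conj_invariant_cycles(2)]
      ratio1[OF cycles_nonempty(3) finX(3) conj_invariant_cycles(3)]
      ratio1[OF cycles_nonempty(4) finX(4) conj_invariant_cycles(4)] by simp
  also have "\<dots> \<le> 35 * (\<Sum>H\<in>\<A>. ratio (cycles_8 ?S) H) + 8 * (\<Sum>H\<in>\<A>. ratio (cycles_521 ?S) H)
      + 20 * (\<Sum>H\<in>\<A>. ratio (cycles_332 ?S) H) + (\<Sum>H\<in>\<A>. ratio (cycles_53 ?S) H)"
    unfolding weight_def using finX ratio_Union_le[OF fin] by (intro add_mono mult_left_mono) auto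
  also have "\<dots> = (\<Sum>H\<in>\<A>. weight ?S H)"
    by (simp add: weight_def sum.distrib sum_distrib_left)
  also have "\<dots> \<le> (\<Sum>H\<in>\<A>. 1)" using weight1 by (rule sum_mono)
  finally show ?thesis by simp
qed

section \<open>The cover with 64 members\<close>

lemma sym_group_subgroupI:
  assumes "H \<subseteq> {p. p permutes {1..n}}" "id \<in> H"
    and "\<And>g h. g \<in> H \<Longrightarrow> h \<in> H \<Longrightarrow> g \<circ> h \<in> H" "\<And>h. h \<in> H \<Longrightarrow> inv' h \<in> H"
  shows "subgroup H (sym_group n)"
proof (rule group.subgroupI[OF sym_group_is_group])
  show "H \<subseteq> carrier (sym_group n)" using assms(1) by (simp add: sym_group_def)
  show "inv\<^bsub>sym_group n\<^esub> h \<in> H" if "h \<in> H" for h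
    using assms(1,4) that by (subst sym_group_inv_equality) (auto simp: sym_group_def)
  show "g \<otimes>\<^bsub>sym_group n\<^esub> h \<in> H" if "g \<in> H" "h \<in> H" for g h
    using assms(3) that by (simp add: sym_group_mult)
qed (use assms(2) in auto)

text \<open>Letting \<open>B\<close> be \<open>A\<close> or its complement treats the stabilizer of
  a set and that of a bisection in one proof; in both cases a member permutes the family formed by
  \<open>A\<close> and \<open>B\<close>.\<close>

lemma bisection_stabilizer_subgroup:
  assumes A: "A \<subseteq> {1..n}" and B: "B = A \<or> B = {1..n} - A"
  shows "subgroup {p. p permutes {1..n} \<and> (p ` A = A \<or> p ` A = B)} (sym_group n)" (is "subgroup ?H _")
proof (rule sym_group_subgroupI)
  show "id \<in> ?H" by simp
  have img: "p ` B = (if p ` A = A then B else A)" if "p \<in> ?H" for p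
  proof -
    have p: "p permutes {1..n}" using that by simp
    have "p ` ({1..n} - A) = {1..n} - p ` A"
      using image_set_diff[OF permutes_inj[OF p]] permutes_image[OF p] by metis
    then show ?thesis using that A B by (auto simp: double_diff)
  qed
  show "g \<circ> h \<in> ?H" if "g \<in> ?H" "h \<in> ?H" for g h
  proof -
    have "h ` A = A \<or> h ` A = B" "g ` A = A \<or> g ` A = B" using that by simp_all
    then have "g ` (h ` A) = A \<or> g ` (h ` A) = B" using img[OF that(1)] by (elim disjE) auto
    then have "(g \<circ> h) ` A = A \<or> (g \<circ> h) ` A = B" by (simp add: image_comp)
    then show ?thesis using that by (simp add: permutes_compose)
  qed
  show "inv' h \<in> ?H" if "h \<in> ?H" for h
  proof -
    have h: "h permutes {1..n}" using that by simp
    have inv_img: "inv' h ` (h ` C) = C" for C using permutes_inverses(2)[OF h] by (simp add: image_image)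
    have "h ` A = A \<or> h ` B = A" using that img[OF that] by auto
    then have "inv' h ` A = A \<or> inv' h ` A = B" using inv_img[of A] inv_img[of B] by auto
    then show ?thesis using permutes_inv[OF h] by simp
  qed
qed blast

text \<open>Exchanging a point of \<open>A\<close> with one outside is not allowed: the image
  contains the outside point, so it is not \<open>A\<close>, and a second point of \<open>A\<close>,
  so it is not the complement.\<close>

lemma bisection_stabilizer_proper:
  assumes A: "A \<subseteq> {1..n}" "card A \<ge> 2" "A \<noteq> {1..n}" and B: "B = A \<or> B = {1..n} - A"
  shows "{p. p permutes {1..n} \<and> (p ` A = A \<or> p ` A = B)} \<noteq> carrier (sym_group n)"
proof -
  obtain C where "C \<subseteq> A" "card C = 2" using obtain_subset_with_card_n[OF A(2)] by blast
  moreover from \<open>card C = 2\<close> obtain a b where "C = {a, b}" "a \<noteq> b"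
    unfolding card_2_iff by blast
  ultimately have ab: "a \<in> A" "b \<in> A" "a \<noteq> b" by auto
  obtain c where c: "c \<in> {1..n}" "c \<notin> A" using A(1,3) by blast
  let ?t = "transpose a c"
  have "c \<in> ?t ` A" using ab(1) by (metis image_eqI transpose_apply_first)
  moreover have "b \<in> ?t ` A" using ab c by (metis image_eqI transpose_apply_other)
  ultimately have "?t ` A \<noteq> A" "?t ` A \<noteq> {1..n} - A" using c ab by auto
  moreover have "?t permutes {1..n}" by (rule permutes_swap_id) (use ab A(1) c in auto)
  ultimately show ?thesis using B by (auto simp: sym_group_def)
qed

lemma cover_64: "\<exists>\<A>. subgroup_cover (sym_group 8) \<A> \<and> card \<A> \<le> 64"
proof -
  let ?S = "{1..8::nat}"
  \<comment> \<open>Each partition 4 + 4 is represented by the half containing 1, which leaves 7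
    choose 3 = 35 sets.\<close>
  let ?P = "{A. A \<subseteq> ?S \<and> card A = 2}" and ?Q = "{A. A \<subseteq> ?S \<and> card A = 4 \<and> 1 \<in> A}"
  \<comment> \<open>The repeated disjunct is the instance \<open>B = A\<close> of
    \<open>bisection_stabilizer_subgroup\<close>.\<close>
  define stab where "stab A = {p. p permutes ?S \<and> (p ` A = A \<or> p ` A = A)}" for A
  define bis where "bis A = {p. p permutes ?S \<and> (p ` A = A \<or> p ` A = ?S - A)}" for A
  let ?\<A> = "{carrier (alt_group 8)} \<union> stab ` ?P \<union> bis ` ?Q"
  have finP: "finite ?P" and finQ: "finite ?Q" by (auto intro: finite_subset[OF _ finite_Pow_iff[THEN iffD2]])
  have "card ?P = 28" using n_subsets[of ?S 2] by (simp add: numeral_eq_Suc)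
  then have cardP: "card (stab ` ?P) \<le> 28" using card_image_le[OF finP, of stab] by simp
  have "?Q \<subseteq> insert 1 ` {A. A \<subseteq> {2..8} \<and> card A = 3}"
  proof
    fix A assume A: "A \<in> ?Q"
    then have "card (A - {1}) = 3" by (simp add: card_Diff_singleton)
    moreover have "A - {1} \<subseteq> {2..8}" using A by force
    moreover have "A = insert 1 (A - {1})" using A by blast
    ultimately show "A \<in> insert 1 ` {A. A \<subseteq> {2..8} \<and> card A = 3}" by blast
  qed
  moreover have fin3: "finite {A. A \<subseteq> {2..8::nat} \<and> card A = 3}" by simp
  ultimately have "card ?Q \<le> card {A. A \<subseteq> {2..8::nat} \<and> card A = 3}"
    by (meson card_image_le card_mono finite_imageI order_trans)
  also have "\<dots> = 35" using n_subsets[of "{2..8::nat}" 3] by (simp add: numeral_eq_Suc)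
  finally have cardQ: "card (bis ` ?Q) \<le> 35" using card_image_le[OF finQ, of bis] by simp
  have "card ?\<A> \<le> card {carrier (alt_group 8)} + card (stab ` ?P) + card (bis ` ?Q)"
    by (meson add_le_mono1 card_Un_le order_trans)
  then have le: "card ?\<A> \<le> 64" using cardP cardQ by simp
  have sub: "subgroup H (sym_group 8) \<and> H \<noteq> carrier (sym_group 8)" if H: "H \<in> ?\<A>" for H
  proof -
    have "H = carrier (alt_group 8) \<or> H \<in> stab ` ?P \<or> H \<in> bis ` ?Q"
      using H by (simp only: Un_iff singleton_iff disj_assoc)
    then consider "H = carrier (alt_group 8)" | "H \<in> stab ` ?P" | "H \<in> bis ` ?Q"
      by argo
    then show ?thesis
    proof cases
      case 1
      have "transpose 1 2 \<in> carrier (sym_group 8)"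
        unfolding sym_group_carrier by (rule permutes_swap_id) auto
      moreover have "transpose 1 (2::nat) \<notin> carrier (alt_group 8)"
        by (simp add: alt_group_carrier evenperm_swap)
      ultimately show ?thesis using 1 alt_group_is_subgroup by auto
    next
      case 2
      then obtain A where A: "A \<in> ?P" "H = stab A" by (elim imageE)
      then have "A \<noteq> ?S" by auto
      then show ?thesis
        using A bisection_stabilizer_subgroup[of A 8 A] bisection_stabilizer_proper[of A 8 A]
        by (simp add: stab_def)
    next
      case 3
      then obtain A where A: "A \<in> ?Q" "H = bis A" by (elim imageE)
      then have "A \<noteq> ?S" by auto
      then show ?thesis
        using A bisection_stabilizer_subgroup[of A 8 "?S - A"] bisection_stabilizer_proper[of A 8 "?S - A"]
        by (simp add: bis_def)
    qed
  qed
  have "subgroup_cover (sym_group 8) ?\<A>"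
    unfolding subgroup_cover_def
  proof (intro conjI ballI)
    show "finite ?\<A>" using finP finQ by simp
    show "subgroup H (sym_group 8)" "H \<noteq> carrier (sym_group 8)" if "H \<in> ?\<A>" for H
      using sub[OF that] by blast+
    show "\<Union>?\<A> = carrier (sym_group 8)"
    proof (rule subset_antisym)
      show "\<Union>?\<A> \<subseteq> carrier (sym_group 8)"
        by (auto simp: sym_group_carrier alt_group_carrier stab_def bis_def)
      show "carrier (sym_group 8) \<subseteq> \<Union>?\<A>"
      proof
        fix p assume "p \<in> carrier (sym_group 8)"
        then have p: "p permutes ?S" by (simp add: sym_group_carrier)
        show "p \<in> \<Union>?\<A>"
        proof (cases "evenperm p")
          case True
          then show ?thesis using p by (simp add: alt_group_carrier)
        next
          case False
          then consider A where "A \<in> ?P" "p ` A = A"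
            | A where "A \<subseteq> ?S" "card A = 4" "p ` A = A \<or> p ` A = ?S - A"
            using odd_permutation_invariant[OF _ p] by auto
          then show ?thesis
          proof cases
            case 1
            then have "p \<in> stab A" using p by (simp add: stab_def)
            then show ?thesis using 1(1) by blast
          next
            case 2
            show ?thesis
            proof (cases "1 \<in> A")
              case True
              then have "p \<in> bis A" "A \<in> ?Q" using 2 p by (auto simp: bis_def)
              then show ?thesis by blast
            next
              case False
              let ?B = "?S - A"
              have "p ` ?B = ?S - p ` A"
                using image_set_diff[OF permutes_inj[OF p]] permutes_image[OF p] by metis
              then have "p ` ?B = ?B \<or> p ` ?B = ?S - ?B" using 2(1,3) by (auto simp: double_diff)
              then have "p \<in> bis ?B" using p by (simp add: bis_def)
              moreover have "card ?B = 4" using 2(1,2) finite_subset[OF 2(1)] by (simp add: card_Diff_subset)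
              then have "?B \<in> ?Q" using False by simp
              ultimately show ?thesis by blast
            qed
          qed
        qed
      qed
    qed
  qed
  with le show ?thesis by blast
qed

theorem theorem2p1:
  shows "covering_number (sym_group 8) = 64"
proof (rule antisym)
  obtain \<A> where A: "subgroup_cover (sym_group 8) \<A>" "card \<A> \<le> 64" using cover_64 by blast
  then have "covering_number (sym_group 8) \<le> enat (card \<A>)"
    unfolding covering_number_def by (intro INF_lower) simp
  also have "\<dots> \<le> enat 64" using A(2) by simp
  finally show "covering_number (sym_group 8) \<le> 64" by (simp add: numeral_eq_enat)
  show "64 \<le> covering_number (sym_group 8)"
    unfolding covering_number_def
    by (rule INF_greatest) (use cover_ge_64 in \<open>simp add: numeral_eq_enat\<close>)
qed

end
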